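(* Let $n,m,p\to\infty$ and suppose $H_0:X\overset{d}{=}Y$ holds. Assume: (i) $m/n\to\alpha_0$ with $\alpha_0>0$. (ii) As $n,m,p\to\infty$, $$\frac1{n^2}\frac{E[H^4(X,X')]}{(E[H^2(X,X')])^2}=o(1),\qquad \frac1n\frac{E[H^2(X,X'')H^2(X',X'')]}{(E[H^2(X,X')])^2}=o(1),$$ $$\frac{E[H(X,X'')H(X',X'')H(X,X''')H(X',X''')]}{(E[H^2(X,X')])^2}=o(1).$$ (iii) $E[L^2(X,X')]=O(\alpha_p^2)$, where $\alpha_p$ is a positive real sequence with $\tau_X\alpha_p^2=o(1)$ as $p\to\infty$; and, as $n,p\to\infty$, $$\frac{n^4\,\tau_X^4\,E[R^4(X,X')]}{(E[H^2(X,X')])^2}=o(1).$$ Then $T_{n,m}\overset{d}{\longrightarrow}N(0,1)$.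
   Context: For each $p$, $X=(X_{(1)},\dots,X_{(p)})$ and $Y=(Y_{(1)},\dots,Y_{(p)})$ are independent random vectors in $\mathbb R^{\tilde p}$, $\tilde p=\sum_{i=1}^pd_i$, with $X_{(i)},Y_{(i)}\in\mathbb R^{d_i}$ and $d_i$ bounded. $X',X'',X'''$ are independent copies of $X$. $X_1,\dots,X_n$ are i.i.d. copies of $X$ and, independently, $Y_1,\dots,Y_m$ are i.i.d. copies of $Y$. Distance: $K(x,x')=\sqrt{\sum_{i=1}^p\rho_i(x_{(i)},x'_{(i)})}$, where either (Case S1) each $\rho_i$ is a metric of strong negative type on $\mathbb R^{d_i}$, or (Case S2) $\rho_i(x_{(i)},x'_{(i)})=\|x_{(i)}-x'_{(i)}\|^2$ for each $i$. A metric $\rho$ on $\mathbb R^d$ has negative type if $\sum_{k,l}\alpha_k\alpha_l\rho(x_k,x_l)\le0$ whenever $\sum_k\alpha_k=0$; strong negative type if moreover, for Borel probability measures $\mu,\nu$ with finite first $\rho$-moment, $2\iint\rho\,d\mu\,d\nu-\iint\rho\,d\mu\,d\mu-\iint\rho\,d\nu\,d\nu=0$ only if $\mu=\nu$. $\tau_X^2=EK(X,X')^2$; $L(X,X')=\frac{K^2(X,X')-\tau_X^2}{\tau_X^2}$; $R(X,X')=\frac{K(X,X')}{\tau_X}-1-\frac12L(X,X')$; $H(X,X')=\frac1{\tau_X}\sum_{i=1}^p\big\{\rho_i(X_{(i)},X'_{(i)})-E[\rho_i(X_{(i)},X'_{(i)})|X_{(i)}]-E[\rho_i(X_{(i)},X'_{(i)})|X'_{(i)}]+E[\rho_i(X_{(i)},X'_{(i)})]\big\}$.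 Statistics: $$\mathcal E_{n,m}(X,Y)=\frac2{nm}\sum_{k=1}^n\sum_{l=1}^mK(X_k,Y_l)-\frac1{n(n-1)}\sum_{k\ne l}K(X_k,X_l)-\frac1{m(m-1)}\sum_{k\ne l}K(Y_k,Y_l).$$ $cdCov^2_{n,m}(X,Y)=\frac1{(n-1)(m-1)}\sum_{k=1}^n\sum_{l=1}^m\widehat K(X_k,Y_l)^2$, where $\widehat K(X_k,Y_l)=K(X_k,Y_l)-\frac1n\sum_{i=1}^nK(X_i,Y_l)-\frac1m\sum_{j=1}^mK(X_k,Y_j)+\frac1{nm}\sum_{i=1}^n\sum_{j=1}^mK(X_i,Y_j)$. For an $n\times n$ matrix $A=(a_{kl})$ its $\mathcal U$-centered version has entries $\tilde a_{kl}=a_{kl}-\frac1{n-2}\sum_ja_{kj}-\frac1{n-2}\sum_ia_{il}+\frac1{(n-1)(n-2)}\sum_{i,j}a_{ij}$ for $k\ne l$ and $\tilde a_{kk}=0$. $\widetilde{\mathcal D^2_n}(X,X)=\frac1{n(n-3)}\sum_{k\ne l}\tilde a_{kl}^2$ with $a_{kl}=K(X_k,X_l)$; $\widetilde{\mathcal D^2_m}(Y,Y)$ is defined likewise from $(K(Y_k,Y_l))_{k,l=1}^m$. With $v_s=s(s-3)/2$, $$S_{n,m}=\frac{4(n-1)(m-1)\,cdCov^2_{n,m}(X,Y)+4v_n\widetilde{\mathcal D^2_n}(X,X)+4v_m\widetilde{\mathcal D^2_m}(Y,Y)}{(n-1)(m-1)+v_n+v_m},$$ $a_{nm}=\sqrt{\frac1{nm}+\frac1{2n(n-1)}+\frac1{2m(m-1)}}$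 and $T_{n,m}=\frac{\mathcal E_{n,m}(X,Y)}{a_{nm}\sqrt{S_{n,m}}}$. *)

theory Defs
  imports "HOL-Probability.Probability" "HOL-Library.Landau_Symbols"
begin

text \<open>
  The dimensions vary inside the statement, so a vector of dimension \<open>d\<close> is an extensional
  function on \<open>{..<d}\<close>, and a vector made of \<open>p\<close> blocks of dimensions \<open>d 1, \<dots>, d p\<close> is an
  extensional function on \<open>{1..p}\<close> with such values. The product sigma-algebras are the Borel
  sigma-algebras of these Euclidean spaces.
\<close>

definition eucl :: "nat \<Rightarrow> (nat \<Rightarrow> real) measure" where
  "eucl d = (\<Pi>\<^sub>M j\<in>{..<d}. borel)"

definition blocks :: "(nat \<Rightarrow> nat) \<Rightarrow> nat \<Rightarrow> (nat \<Rightarrow> nat \<Rightarrow> real) measure" where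
  "blocks d p = (\<Pi>\<^sub>M i\<in>{1..p}. eucl (d i))"

definition sq_dist :: "nat \<Rightarrow> (nat \<Rightarrow> real) \<Rightarrow> (nat \<Rightarrow> real) \<Rightarrow> real" where
  "sq_dist d x y = (L2_set (\<lambda>j. x j - y j) {..<d})\<^sup>2"

definition negative_type :: "'v set \<Rightarrow> ('v \<Rightarrow> 'v \<Rightarrow> real) \<Rightarrow> bool" where
  "negative_type A \<rho> \<longleftrightarrow>
     (\<forall>(N::nat) (x :: nat \<Rightarrow> 'v) (\<alpha> :: nat \<Rightarrow> real).
        (\<forall>k<N. x k \<in> A) \<and> (\<Sum>k<N. \<alpha> k) = 0 \<longrightarrow>
        (\<Sum>k<N. \<Sum>l<N. \<alpha> k * \<alpha> l * \<rho> (x k) (x l)) \<le> 0)"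

definition finite_first_moment :: "('v \<Rightarrow> 'v \<Rightarrow> real) \<Rightarrow> 'v measure \<Rightarrow> bool" where
  "finite_first_moment \<rho> \<mu> \<longleftrightarrow> (\<exists>z\<in>space \<mu>. integrable \<mu> (\<lambda>x. \<rho> z x))"

text \<open>
  \<open>S\<close> only provides the measurable space. The iterated integrals below are finite when \<open>\<rho>\<close> is
  a measurable metric, by the triangle inequality.
\<close>

definition strong_negative_type :: "'v measure \<Rightarrow> ('v \<Rightarrow> 'v \<Rightarrow> real) \<Rightarrow> bool" where
  "strong_negative_type S \<rho> \<longleftrightarrow> negative_type (space S) \<rho> \<and>
     (\<forall>\<mu> \<nu>. prob_space \<mu> \<and> sets \<mu> = sets S \<and> finite_first_moment \<rho> \<mu> \<and>
            prob_space \<nu> \<and> sets \<nu> = sets S \<and> finite_first_moment \<rho> \<nu> \<and>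
            2 * (\<integral>x. (\<integral>y. \<rho> x y \<partial>\<nu>) \<partial>\<mu>) - (\<integral>x. (\<integral>y. \<rho> x y \<partial>\<mu>) \<partial>\<mu>)
              - (\<integral>x. (\<integral>y. \<rho> x y \<partial>\<nu>) \<partial>\<nu>) = 0
            \<longrightarrow> \<mu> = \<nu>)"

definition K_dist ::
    "(nat \<Rightarrow> 'v \<Rightarrow> 'v \<Rightarrow> real) \<Rightarrow> nat \<Rightarrow> (nat \<Rightarrow> 'v) \<Rightarrow> (nat \<Rightarrow> 'v) \<Rightarrow> real" where
  "K_dist \<rho> p x y = sqrt (\<Sum>i=1..p. \<rho> i (x i) (y i))"

definition L_fun :: "real \<Rightarrow> ('a \<Rightarrow> 'a \<Rightarrow> real) \<Rightarrow> 'a \<Rightarrow> 'a \<Rightarrow> real" where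
  "L_fun \<tau> K x y = ((K x y)\<^sup>2 - \<tau>\<^sup>2) / \<tau>\<^sup>2"

definition R_fun :: "real \<Rightarrow> ('a \<Rightarrow> 'a \<Rightarrow> real) \<Rightarrow> 'a \<Rightarrow> 'a \<Rightarrow> real" where
  "R_fun \<tau> K x y = K x y / \<tau> - 1 - L_fun \<tau> K x y / 2"

text \<open>\<open>cond_exp_on M S Z f\<close> is the conditional expectation of \<open>f\<close> given the \<open>S\<close>-valued random
  variable \<open>Z\<close>.\<close>

definition cond_exp_on ::
    "'w measure \<Rightarrow> 'v measure \<Rightarrow> ('w \<Rightarrow> 'v) \<Rightarrow> ('w \<Rightarrow> real) \<Rightarrow> 'w \<Rightarrow> real" where
  "cond_exp_on M S Z f = real_cond_exp M (vimage_algebra (space M) Z S) f"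

definition H_rv ::
    "'w measure \<Rightarrow> (nat \<Rightarrow> nat) \<Rightarrow> (nat \<Rightarrow> (nat \<Rightarrow> real) \<Rightarrow> (nat \<Rightarrow> real) \<Rightarrow> real) \<Rightarrow> nat \<Rightarrow> real \<Rightarrow>
     ('w \<Rightarrow> nat \<Rightarrow> nat \<Rightarrow> real) \<Rightarrow> ('w \<Rightarrow> nat \<Rightarrow> nat \<Rightarrow> real) \<Rightarrow> 'w \<Rightarrow> real" where
  "H_rv M d \<rho> p \<tau> U V \<omega> = 1 / \<tau> * (\<Sum>i=1..p.
     \<rho> i (U \<omega> i) (V \<omega> i)
     - cond_exp_on M (eucl (d i)) (\<lambda>\<omega>'. U \<omega>' i) (\<lambda>\<omega>'. \<rho> i (U \<omega>' i) (V \<omega>' i)) \<omega>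
     - cond_exp_on M (eucl (d i)) (\<lambda>\<omega>'. V \<omega>' i) (\<lambda>\<omega>'. \<rho> i (U \<omega>' i) (V \<omega>' i)) \<omega>
     + (\<integral>\<omega>'. \<rho> i (U \<omega>' i) (V \<omega>' i) \<partial>M))"

text \<open>Sample statistics, for samples \<open>x 1, \<dots>, x n\<close> and \<open>y 1, \<dots>, y m\<close>. All arithmetic on sample
  sizes is carried out in the reals.\<close>

definition energy_stat ::
    "('a \<Rightarrow> 'a \<Rightarrow> real) \<Rightarrow> nat \<Rightarrow> nat \<Rightarrow> (nat \<Rightarrow> 'a) \<Rightarrow> (nat \<Rightarrow> 'a) \<Rightarrow> real" where
  "energy_stat K n m x y =
     2 / (real n * real m) * (\<Sum>k=1..n. \<Sum>l=1..m. K (x k) (y l))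
     - 1 / (real n * (real n - 1)) * (\<Sum>k=1..n. \<Sum>l\<in>{1..n}-{k}. K (x k) (x l))
     - 1 / (real m * (real m - 1)) * (\<Sum>k=1..m. \<Sum>l\<in>{1..m}-{k}. K (y k) (y l))"

definition K_hat ::
    "('a \<Rightarrow> 'a \<Rightarrow> real) \<Rightarrow> nat \<Rightarrow> nat \<Rightarrow> (nat \<Rightarrow> 'a) \<Rightarrow> (nat \<Rightarrow> 'a) \<Rightarrow> nat \<Rightarrow> nat \<Rightarrow> real" where
  "K_hat K n m x y k l =
     K (x k) (y l)
     - 1 / real n * (\<Sum>i=1..n. K (x i) (y l))
     - 1 / real m * (\<Sum>j=1..m. K (x k) (y j))
     + 1 / (real n * real m) * (\<Sum>i=1..n. \<Sum>j=1..m. K (x i) (y j))"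

definition cdCov2 ::
    "('a \<Rightarrow> 'a \<Rightarrow> real) \<Rightarrow> nat \<Rightarrow> nat \<Rightarrow> (nat \<Rightarrow> 'a) \<Rightarrow> (nat \<Rightarrow> 'a) \<Rightarrow> real" where
  "cdCov2 K n m x y =
     1 / ((real n - 1) * (real m - 1)) * (\<Sum>k=1..n. \<Sum>l=1..m. (K_hat K n m x y k l)\<^sup>2)"

definition U_center :: "nat \<Rightarrow> (nat \<Rightarrow> nat \<Rightarrow> real) \<Rightarrow> nat \<Rightarrow> nat \<Rightarrow> real" where
  "U_center n A k l =
     (if k = l then 0
      else A k l - 1 / (real n - 2) * (\<Sum>j=1..n. A k j) - 1 / (real n - 2) * (\<Sum>i=1..n. A i l)
           + 1 / ((real n - 1) * (real n - 2)) * (\<Sum>i=1..n. \<Sum>j=1..n. A i j))"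

definition dCov2 :: "('a \<Rightarrow> 'a \<Rightarrow> real) \<Rightarrow> nat \<Rightarrow> (nat \<Rightarrow> 'a) \<Rightarrow> real" where
  "dCov2 K n x =
     1 / (real n * (real n - 3)) *
       (\<Sum>k=1..n. \<Sum>l\<in>{1..n}-{k}. (U_center n (\<lambda>k l. K (x k) (x l)) k l)\<^sup>2)"

definition v_const :: "nat \<Rightarrow> real" where
  "v_const s = real s * (real s - 3) / 2"

definition S_stat ::
    "('a \<Rightarrow> 'a \<Rightarrow> real) \<Rightarrow> nat \<Rightarrow> nat \<Rightarrow> (nat \<Rightarrow> 'a) \<Rightarrow> (nat \<Rightarrow> 'a) \<Rightarrow> real" where
  "S_stat K n m x y =
     (4 * (real n - 1) * (real m - 1) * cdCov2 K n m x y
        + 4 * v_const n * dCov2 K n x + 4 * v_const m * dCov2 K m y)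
     / ((real n - 1) * (real m - 1) + v_const n + v_const m)"

definition a_const :: "nat \<Rightarrow> nat \<Rightarrow> real" where
  "a_const n m = sqrt (1 / (real n * real m) + 1 / (2 * real n * (real n - 1))
                         + 1 / (2 * real m * (real m - 1)))"

definition T_stat ::
    "('a \<Rightarrow> 'a \<Rightarrow> real) \<Rightarrow> nat \<Rightarrow> nat \<Rightarrow> (nat \<Rightarrow> 'a) \<Rightarrow> (nat \<Rightarrow> 'a) \<Rightarrow> real" where
  "T_stat K n m x y = energy_stat K n m x y / (a_const n m * sqrt (S_stat K n m x y))"

end

theory Submission
  imports Defs
begin

text \<open>
  \<^bold>\<open>Idea.\<close> Write \<open>K(x, y) = c + u(x) + u(y) + H(x, y) / 2 + \<tau> R(x, y)\<close>. All statistics are centred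
  so that the additive part \<open>c + u(x) + u(y)\<close> disappears from them. What is left of the energy statistic,
  divided by \<open>a\<^bsub>nm\<^esub>\<close>, is a quadratic form \<open>W\<close> in the degenerate kernel \<open>H\<close> over the pooled sample, plus a
  remainder that is small in \<open>L\<^sup>1\<close> by the bound on \<open>R\<close>. Write \<open>2 W\<close> as the sum over sample points \<open>i\<close> of
  the terms \<open>Y\<^sub>i\<close> that involve \<open>i\<close>. Since \<open>W - Y\<^sub>i\<close> does not involve \<open>i\<close>, degeneracy gives
  \<open>E [Y\<^sub>i exp (i s (W - Y\<^sub>i))] = 0\<close>. Expanding \<open>E [W exp (i s W)]\<close> around this shows that the characteristic
  function \<open>\<phi>\<close> of \<open>W\<close> satisfies \<open>\<phi>'(s) = - s \<phi>(s)\<close> up to an error governed by the variance of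
  \<open>\<Sum>Y\<^sub>i\<^sup>2\<close> and by \<open>\<Sum>E Y\<^sub>i\<^sup>4\<close>, which are small by (ii). The variance estimator is compared with
  \<open>E [H\<^sup>2]\<close> in \<open>L\<^sup>1\<close>, and Slutsky's argument concludes.
\<close>

section \<open>Characteristic functions\<close>

text \<open>The dimension moves with the sample sizes, so there is no limiting kernel to compare
  with. Every estimate is therefore an inequality with explicit constants at one fixed dimension and
  fixed sample sizes, and limits are taken only in the last proof. The kernel is divided by the
  square root of \<open>EH2\<close>, a scaling that \<open>T_stat\<close> does not notice. The pair
  weights have order \<open>1 / N\<close> with \<open>N = n + m\<close>, and for such weights the
  errors are small as soon as the normalised moments satisfy
  \<open>A4 \<le> \<epsilon> * N^2\<close>, \<open>B4 \<le> \<epsilon> * N\<close> and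
  \<open>\<bar>C4\<bar> \<le> \<epsilon>\<close>; these are the three rates of (ii). The remainder
  is summed over about \<open>N^2\<close> pairs with the same weights, so its normalised norm has to
  be small against \<open>1 / N\<close>; at the level of fourth moments this is the factor
  \<open>n^4\<close> of (iii). A second obstacle is that \<open>H\<close> is given through
  conditional expectations, hence only up to null sets, whereas integrating out one sample point
  needs a function of two points. A version of \<open>H\<close> of this form is therefore built
  explicitly.\<close>

lemma gaussian_char_ode:
  fixes \<phi> \<phi>' :: "real \<Rightarrow> complex"
  assumes der: "\<And>s. (\<phi> has_vector_derivative \<phi>' s) (at s)"
    and zero: "\<phi> 0 = 1"
    and le: "\<And>s. \<bar>s\<bar> \<le> \<bar>t\<bar> \<Longrightarrow> cmod (\<phi>' s + of_real s * \<phi> s) \<le> e"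
  shows "cmod (\<phi> t - of_real (exp (- (t\<^sup>2) / 2))) \<le> \<bar>t\<bar> * e"
proof -
  \<comment> \<open>Integrating factor: \<open>\<psi>\<close> would be constant if the differential
    equation held exactly. Its derivative is bounded with a factor \<open>exp (t^2 / 2)\<close>,
    which multiplying back at \<open>t\<close> cancels, so the error stays linear in
    \<open>e\<close> without exponential growth.\<close>
  define \<psi> where "\<psi> s = \<phi> s * of_real (exp (s\<^sup>2 / 2))" for s
  define \<psi>' where "\<psi>' s = (\<phi>' s + of_real s * \<phi> s) * of_real (exp (s\<^sup>2 / 2))" for s
  have der': "(\<psi> has_vector_derivative \<psi>' s) (at s)" for s
  proof -
    have "((\<lambda>s. exp (s\<^sup>2 / 2)) has_real_derivative s * exp (s\<^sup>2 / 2)) (at s)"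
      by (auto intro!: derivative_eq_intros simp: field_simps)
    then have "((\<lambda>s. complex_of_real (exp (s\<^sup>2 / 2))) has_vector_derivative
        of_real (s * exp (s\<^sup>2 / 2))) (at s)"
      by (intro has_vector_derivative_of_real) (simp add: has_real_derivative_iff_has_vector_derivative)
    from has_vector_derivative_mult[OF der[of s] this] show ?thesis
      unfolding \<psi>_def \<psi>'_def by (simp add: algebra_simps)
  qed
  have "norm (\<psi> t - \<psi> 0) \<le> (e * exp (t\<^sup>2 / 2)) * norm (t - 0)"
  proof (rule differentiable_bound[of "{-\<bar>t\<bar>..\<bar>t\<bar>}" \<psi> "\<lambda>s h. h *\<^sub>R \<psi>' s"])
    show "(\<psi> has_derivative (\<lambda>h. h *\<^sub>R \<psi>' s)) (at s within {-\<bar>t\<bar>..\<bar>t\<bar>})" for s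
      using der'[of s] by (simp add: has_vector_derivative_def has_derivative_at_withinI)
    show "onorm (\<lambda>h. h *\<^sub>R \<psi>' s) \<le> e * exp (t\<^sup>2 / 2)" if "s \<in> {-\<bar>t\<bar>..\<bar>t\<bar>}" for s
    proof -
      from that have s: "\<bar>s\<bar> \<le> \<bar>t\<bar>" by auto
      then have "s\<^sup>2 \<le> t\<^sup>2" by (simp add: abs_le_square_iff)
      moreover have "0 \<le> e" using le[OF s] by (rule order_trans[OF norm_ge_zero])
      ultimately have "norm (\<psi>' s) \<le> e * exp (t\<^sup>2 / 2)"
        unfolding \<psi>'_def norm_mult using le[OF s]
        by (intro mult_mono) (auto simp del: of_real_exp)
      then show ?thesis
        by (intro onorm_le) (simp add: mult.commute mult_left_mono)
    qed
  qed auto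
  then have b: "norm (\<psi> t - 1) \<le> \<bar>t\<bar> * e * exp (t\<^sup>2 / 2)"
    by (simp add: \<psi>_def zero mult_ac)
  have "\<phi> t - of_real (exp (- (t\<^sup>2) / 2)) = (\<psi> t - 1) * of_real (exp (- (t\<^sup>2) / 2))"
    by (simp add: \<psi>_def algebra_simps flip: of_real_mult exp_add)
  then have "norm (\<phi> t - of_real (exp (- (t\<^sup>2) / 2))) = norm (\<psi> t - 1) * exp (- (t\<^sup>2) / 2)"
    by (simp add: norm_mult del: of_real_exp)
  also have "\<dots> \<le> (\<bar>t\<bar> * e * exp (t\<^sup>2 / 2)) * exp (- (t\<^sup>2) / 2)"
    using b by (intro mult_right_mono) auto
  also have "\<dots> = \<bar>t\<bar> * e"
    by (simp add: flip: exp_add)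
  finally show ?thesis .
qed

lemma norm_iexp_minus_1_le: "cmod (iexp x - 1 - \<i> * of_real x) \<le> x\<^sup>2 / 2"
proof -
  have "iexp x - (\<Sum>k\<le>1. (\<i> * x) ^ k / fact k) = iexp x - 1 - \<i> * of_real x"
    by (simp add: algebra_simps)
  then show ?thesis using iexp_approx1[of x 1] unfolding One_nat_def [symmetric] by (simp only:) (simp add: power2_eq_square)
qed

lemma norm_iexp_minus_1_le1: "cmod (iexp x - 1) \<le> \<bar>x\<bar>"
  using iexp_approx1[of x 0] by simp

lemma diff_add_cancel_mid: "(b - c) + (a - b) = a - (c :: 'a :: ab_group_add)"
  by simp

lemma half_combine: "a - s / 2 * b + s * c = a - s / 2 * (b - 2 * c)" for a b c s :: complex
  by (simp add: field_simps)

lemma norm_integral_le: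
  fixes f :: "'a \<Rightarrow> 'b::{banach,second_countable_topology}"
  assumes "integrable M f" "integrable M g" "\<And>x. x \<in> space M \<Longrightarrow> norm (f x) \<le> g x"
  shows "norm (\<integral>x. f x \<partial>M) \<le> (\<integral>x. g x \<partial>M)"
proof -
  have "norm (\<integral>x. f x \<partial>M) \<le> (\<integral>x. norm (f x) \<partial>M)" by (rule integral_norm_bound)
  also have "\<dots> \<le> (\<integral>x. g x \<partial>M)" using assms by (intro integral_mono) auto
  finally show ?thesis .
qed

context prob_space
begin

lemma integrable_iexp_mult:
  fixes f :: "'a \<Rightarrow> complex"
  assumes [measurable]: "W \<in> borel_measurable M" and f: "integrable M f"
  shows "integrable M (\<lambda>x. iexp (W x) * f x)"
  by (rule Bochner_Integration.integrable_bound[OF f])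
     (use f in \<open>auto simp: norm_mult\<close>)

lemma integrable_if_square:
  fixes f :: "'a \<Rightarrow> real"
  assumes [measurable]: "f \<in> borel_measurable M" and "integrable M (\<lambda>x. (f x)\<^sup>2)"
  shows "integrable M f"
  using square_integrable_imp_integrable[OF assms] .

lemma expectation_le_sqrt:
  fixes f :: "'a \<Rightarrow> real"
  assumes [measurable]: "f \<in> borel_measurable M" and i: "integrable M (\<lambda>x. (f x)\<^sup>2)"
    and le: "expectation (\<lambda>x. (f x)\<^sup>2) \<le> b"
  shows "expectation (\<lambda>x. \<bar>f x\<bar>) \<le> sqrt b"
proof -
  have "integrable M (\<lambda>x. \<bar>f x\<bar>)" using integrable_if_square[OF assms(1,2)] by simp
  then have "(expectation (\<lambda>x. \<bar>f x\<bar>))\<^sup>2 \<le> expectation (\<lambda>x. (\<bar>f x\<bar>)\<^sup>2)"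
    using i variance_positive[of "\<lambda>x. \<bar>f x\<bar>"] by (subst (asm) variance_eq) auto
  then show ?thesis using le by (intro real_le_rsqrt) simp
qed

text \<open>A second moment dominates the second-order Taylor error of the exponential, so the
  difference quotient can be estimated directly under the integral, with an error quadratic in
  \<open>t - s\<close>.\<close>

lemma char_has_vector_derivative:
  assumes [measurable]: "W \<in> borel_measurable M" and sq: "integrable M (\<lambda>x. (W x)\<^sup>2)"
  shows "((\<lambda>t. expectation (\<lambda>x. iexp (t * W x))) has_vector_derivative
           expectation (\<lambda>x. \<i> * W x * iexp (s * W x))) (at s)"
proof -
  let ?f = "\<lambda>t. expectation (\<lambda>x. iexp (t * W x))"
  let ?D = "expectation (\<lambda>x. \<i> * W x * iexp (s * W x))"
  have W: "integrable M W" using integrable_if_square[OF assms] .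
  have i1: "integrable M (\<lambda>x. \<i> * W x * iexp (s * W x))"
    using integrable_iexp_mult[of "\<lambda>x. s * W x" "\<lambda>x. \<i> * W x"] W
    by (simp add: mult_ac)
  have i0: "integrable M (\<lambda>x. iexp (t * W x))" for t
    by (rule integrable_iexp) auto
  have bound: "norm (?f t - ?f s - (t - s) *\<^sub>R ?D) \<le> (t - s)\<^sup>2 / 2 * expectation (\<lambda>x. (W x)\<^sup>2)" for t
  proof -
    have "?f t - ?f s - (t - s) *\<^sub>R ?D =
       expectation (\<lambda>x. iexp (t * W x) - iexp (s * W x) - (t - s) *\<^sub>R (\<i> * W x * iexp (s * W x)))"
      using i0 i1 by (simp add: Bochner_Integration.integral_diff)
    also have "norm \<dots> \<le> expectation (\<lambda>x. (t - s)\<^sup>2 / 2 * (W x)\<^sup>2)"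
    proof (rule norm_integral_le)
      show "integrable M (\<lambda>x. iexp (t * W x) - iexp (s * W x) - (t - s) *\<^sub>R (\<i> * W x * iexp (s * W x)))"
        using i0 i1 by (intro Bochner_Integration.integrable_diff integrable_scaleR_right) auto
      show "integrable M (\<lambda>x. (t - s)\<^sup>2 / 2 * (W x)\<^sup>2)" using sq by simp
      fix x
      have "iexp (t * W x) - iexp (s * W x) - (t - s) *\<^sub>R (\<i> * W x * iexp (s * W x)) =
         iexp (s * W x) * (iexp ((t - s) * W x) - 1 - \<i> * of_real ((t - s) * W x))"
        by (simp add: algebra_simps scaleR_conv_of_real flip: exp_add)
      then have "norm (iexp (t * W x) - iexp (s * W x) - (t - s) *\<^sub>R (\<i> * W x * iexp (s * W x))) =
          norm (iexp ((t - s) * W x) - 1 - \<i> * of_real ((t - s) * W x))"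
        by (simp only: norm_mult norm_exp_i_times mult_1)
      also have "\<dots> \<le> ((t - s) * W x)\<^sup>2 / 2" by (rule norm_iexp_minus_1_le)
      finally show "norm (iexp (t * W x) - iexp (s * W x) - (t - s) *\<^sub>R (\<i> * W x * iexp (s * W x)))
          \<le> (t - s)\<^sup>2 / 2 * (W x)\<^sup>2" by (simp add: power_mult_distrib)
    qed
    finally show ?thesis by simp
  qed
  define c where "c = expectation (\<lambda>x. (W x)\<^sup>2) / 2"
  have c: "0 \<le> c" by (simp add: c_def)
  have b: "norm (?f t - ?f s - (t - s) *\<^sub>R ?D) \<le> \<bar>t - s\<bar> * (c * \<bar>t - s\<bar>)" for t
    using bound[of t] by (simp add: c_def power2_eq_square mult_ac flip: abs_mult)
  have "((\<lambda>t. norm (?f t - ?f s - (t - s) *\<^sub>R ?D) / norm (t - s)) \<longlongrightarrow> 0) (at s)"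
  proof (rule tendsto_sandwich[of "\<lambda>_. 0" _ _ "\<lambda>t. c * \<bar>t - s\<bar>"])
    show "\<forall>\<^sub>F t in at s. norm (?f t - ?f s - (t - s) *\<^sub>R ?D) / norm (t - s) \<le> c * \<bar>t - s\<bar>"
      using b by (auto simp: eventually_at_filter field_simps intro!: always_eventually)
    show "((\<lambda>t. c * \<bar>t - s\<bar>) \<longlongrightarrow> 0) (at s)"
      by (auto intro!: tendsto_eq_intros)
  qed auto
  then show ?thesis
    unfolding has_vector_derivative_def has_derivative_iff_norm
    by (auto simp: bounded_linear_scaleR_left)
qed

text \<open>Each pair of sample points is seen from both of its ends, hence the half in
  \<open>W\<close> and the target 2 for the sum of squares; together they give the coefficient
  \<open>- s\<close> of the Gaussian equation. Degeneracy and independence enter only through the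
  hypothesis \<open>zero\<close>, so the lemma is free of any product structure.\<close>

lemma stein_tikhomirov:
  fixes Y :: "'i \<Rightarrow> 'a \<Rightarrow> real"
  assumes fin: "finite I"
    and Ym[measurable]: "\<And>i. i \<in> I \<Longrightarrow> Y i \<in> borel_measurable M"
    and Y4: "\<And>i. i \<in> I \<Longrightarrow> integrable M (\<lambda>x. (Y i x) ^ 4)"
    and W: "\<And>x. x \<in> space M \<Longrightarrow> W x = (\<Sum>i\<in>I. Y i x) / 2"
    and Wm[measurable]: "W \<in> borel_measurable M"
    and W2: "integrable M (\<lambda>x. (W x)\<^sup>2)"
    and zero: "\<And>i s. i \<in> I \<Longrightarrow> expectation (\<lambda>x. iexp (s * (W x - Y i x)) * Y i x) = 0"
    and Q: "expectation (\<lambda>x. \<bar>(\<Sum>i\<in>I. (Y i x)\<^sup>2) - 2\<bar>) \<le> q"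
    and Y3: "(\<Sum>i\<in>I. expectation (\<lambda>x. \<bar>Y i x\<bar> ^ 3)) \<le> r"
  shows "cmod (expectation (\<lambda>x. iexp (t * W x)) - of_real (exp (- (t\<^sup>2) / 2)))
           \<le> \<bar>t\<bar> * (\<bar>t\<bar> / 2 * q + t\<^sup>2 / 4 * r)"
proof -
  have i4: "integrable M (\<lambda>x. \<bar>Y i x\<bar> ^ k)" if "i \<in> I" "k \<le> 4" for i k
  proof (rule Bochner_Integration.integrable_bound[where f="\<lambda>x. 1 + (Y i x) ^ 4"])
    show "integrable M (\<lambda>x. 1 + (Y i x) ^ 4)" using Y4[OF that(1)] by simp
    show "(\<lambda>x. \<bar>Y i x\<bar> ^ k) \<in> borel_measurable M" using that by measurable
    show "AE x in M. norm (\<bar>Y i x\<bar> ^ k) \<le> norm (1 + (Y i x) ^ 4)"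
    proof (rule AE_I2)
      fix x
      have "\<bar>Y i x\<bar> ^ k \<le> 1 + \<bar>Y i x\<bar> ^ 4"
      proof (cases "\<bar>Y i x\<bar> \<le> 1")
        case True
        then have "\<bar>Y i x\<bar> ^ k \<le> 1" by (intro power_le_one) auto
        then show ?thesis by (simp add: add_increasing2)
      next
        case False
        then have "\<bar>Y i x\<bar> ^ k \<le> \<bar>Y i x\<bar> ^ 4" using that by (intro power_increasing) auto
        then show ?thesis by simp
      qed
      then show "norm (\<bar>Y i x\<bar> ^ k) \<le> norm (1 + (Y i x) ^ 4)"
        by (simp add: power_even_abs)
    qed
  qed
  have iY: "integrable M (Y i)" and iY2: "integrable M (\<lambda>x. (Y i x)\<^sup>2)" if "i \<in> I" for i
    using i4[OF that, of 1] i4[OF that, of 2] that by (auto simp: integrable_abs_iff)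
  let ?\<phi> = "\<lambda>s. expectation (\<lambda>x. iexp (s * W x))"
  let ?\<phi>' = "\<lambda>s. expectation (\<lambda>x. \<i> * W x * iexp (s * W x))"
  have iW: "integrable M (\<lambda>x. iexp (s * W x))" for s
    by (rule integrable_iexp) auto
  show ?thesis
  proof (rule gaussian_char_ode[of ?\<phi> ?\<phi>'])
    show "(?\<phi> has_vector_derivative ?\<phi>' s) (at s)" for s
      by (rule char_has_vector_derivative) (use W2 in auto)
    show "?\<phi> 0 = 1" by simp (simp add: prob_space)
    fix s :: real assume s: "\<bar>s\<bar> \<le> \<bar>t\<bar>"
    define D where "D i x = iexp (s * W x) * Y i x - iexp (s * (W x - Y i x)) * Y i x
       - iexp (s * W x) * (\<i> * s * (Y i x)\<^sup>2)" for i x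
    have iD1: "integrable M (\<lambda>x. iexp (s * W x) * Y i x)"
      and iD2: "integrable M (\<lambda>x. iexp (s * (W x - Y i x)) * Y i x)"
      and iD3: "integrable M (\<lambda>x. iexp (s * W x) * (\<i> * s * (Y i x)\<^sup>2))"
      if [simp]: "i \<in> I" for i
      using iY iY2 by (intro integrable_iexp_mult; auto simp flip: of_real_power)+
    have iD: "integrable M (D i)" if "i \<in> I" for i
      unfolding D_def using iD1 iD2 iD3 that by auto
    have nD: "norm (D i x) \<le> s\<^sup>2 / 2 * \<bar>Y i x\<bar> ^ 3" for i x
    proof -
      have "D i x = - iexp (s * W x) * Y i x * (iexp (- (s * Y i x)) - 1 - \<i> * of_real (- (s * Y i x)))"
        by (simp add: D_def algebra_simps power2_eq_square flip: exp_add)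
      then have "norm (D i x) = \<bar>Y i x\<bar> * norm (iexp (- (s * Y i x)) - 1 - \<i> * of_real (- (s * Y i x)))"
        by (simp only: norm_mult norm_minus_cancel norm_exp_i_times norm_of_real mult_1)
      also have "\<dots> \<le> \<bar>Y i x\<bar> * ((- (s * Y i x))\<^sup>2 / 2)"
        by (intro mult_left_mono norm_iexp_minus_1_le) auto
      also have "\<dots> = s\<^sup>2 / 2 * \<bar>Y i x\<bar> ^ 3"
        by (simp add: power2_eq_square power3_eq_cube mult_ac abs_mult_self_eq)
      finally show ?thesis .
    qed
    have eD: "expectation (\<lambda>x. iexp (s * W x) * Y i x) =
        expectation (D i) + expectation (\<lambda>x. iexp (s * W x) * (\<i> * s * (Y i x)\<^sup>2))" if "i \<in> I" for i
      unfolding D_def using iD1[OF that] iD2[OF that] iD3[OF that] zero[OF that, of s]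
      by (simp add: Bochner_Integration.integral_diff)
    have "?\<phi>' s = expectation (\<lambda>x. \<Sum>i\<in>I. (\<i> / 2) * (iexp (s * W x) * Y i x))"
      by (intro Bochner_Integration.integral_cong)
         (auto simp: W sum_distrib_left sum_distrib_right sum_divide_distrib mult_ac)
    also have "\<dots> = (\<Sum>i\<in>I. (\<i> / 2) * expectation (\<lambda>x. iexp (s * W x) * Y i x))"
      using iD1 by (subst Bochner_Integration.integral_sum) auto
    also have "\<dots> = (\<i> / 2) * (\<Sum>i\<in>I. expectation (D i)) +
        (\<i> / 2) * (\<Sum>i\<in>I. expectation (\<lambda>x. iexp (s * W x) * (\<i> * s * (Y i x)\<^sup>2)))"
      unfolding distrib_left[symmetric] sum_distrib_left[symmetric] sum.distrib[symmetric]
      by (intro arg_cong[of _ _ "(*) (\<i> / 2)"] sum.cong eD refl)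
    also have "(\<i> / 2) * (\<Sum>i\<in>I. expectation (\<lambda>x. iexp (s * W x) * (\<i> * s * (Y i x)\<^sup>2))) =
        (\<i> / 2) * expectation (\<lambda>x. \<Sum>i\<in>I. iexp (s * W x) * (\<i> * s * (Y i x)\<^sup>2))"
      using iD3 by (subst Bochner_Integration.integral_sum) auto
    also have "(\<lambda>x. \<Sum>i\<in>I. iexp (s * W x) * (\<i> * s * (Y i x)\<^sup>2)) =
        (\<lambda>x. (\<i> * s) * (iexp (s * W x) * of_real (\<Sum>i\<in>I. (Y i x)\<^sup>2)))"
      by (auto simp: sum_distrib_left mult_ac)
    finally have e1: "?\<phi>' s = (\<i> / 2) * (\<Sum>i\<in>I. expectation (D i)) -
        s / 2 * expectation (\<lambda>x. iexp (s * W x) * of_real (\<Sum>i\<in>I. (Y i x)\<^sup>2))"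
      by (simp add: mult_ac)
    have iS: "integrable M (\<lambda>x. \<Sum>i\<in>I. (Y i x)\<^sup>2)" using iY2 by auto
    have iS': "integrable M (\<lambda>x. iexp (s * W x) * of_real (\<Sum>i\<in>I. (Y i x)\<^sup>2))"
      using iS by (intro integrable_iexp_mult) (auto simp del: of_real_sum intro: integrable_of_real)
    have "expectation (\<lambda>x. iexp (s * W x) * of_real ((\<Sum>i\<in>I. (Y i x)\<^sup>2) - 2)) =
       expectation (\<lambda>x. iexp (s * W x) * of_real (\<Sum>i\<in>I. (Y i x)\<^sup>2)) - 2 * ?\<phi> s"
      using iS' iW[of s] by (simp add: right_diff_distrib Bochner_Integration.integral_diff mult.commute del: of_real_sum)
    then have e2: "?\<phi>' s + s * ?\<phi> s = (\<i> / 2) * (\<Sum>i\<in>I. expectation (D i)) -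
       s / 2 * expectation (\<lambda>x. iexp (s * W x) * of_real ((\<Sum>i\<in>I. (Y i x)\<^sup>2) - 2))"
      using half_combine[of "(\<i> / 2) * (\<Sum>i\<in>I. expectation (D i))" s] unfolding e1
      by (simp only: of_real_divide of_real_numeral)
    have "norm (\<Sum>i\<in>I. expectation (D i)) \<le> (\<Sum>i\<in>I. norm (expectation (D i)))" by (rule norm_sum)
    also have "\<dots> \<le> (\<Sum>i\<in>I. s\<^sup>2 / 2 * expectation (\<lambda>x. \<bar>Y i x\<bar> ^ 3))"
    proof (rule sum_mono)
      fix i assume i: "i \<in> I"
      have "norm (expectation (D i)) \<le> expectation (\<lambda>x. s\<^sup>2 / 2 * \<bar>Y i x\<bar> ^ 3)"
        using iD[OF i] i4[OF i, of 3] nD by (intro norm_integral_le) auto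
      then show "norm (expectation (D i)) \<le> s\<^sup>2 / 2 * expectation (\<lambda>x. \<bar>Y i x\<bar> ^ 3)" by simp
    qed
    also have "\<dots> \<le> t\<^sup>2 / 2 * r"
      unfolding sum_distrib_left[symmetric] using s Y3
      by (intro mult_mono) (auto simp: abs_le_square_iff intro!: sum_nonneg Bochner_Integration.integral_nonneg)
    finally have n1: "norm (\<Sum>i\<in>I. expectation (D i)) \<le> t\<^sup>2 / 2 * r" .
    have n2: "norm (expectation (\<lambda>x. iexp (s * W x) * of_real ((\<Sum>i\<in>I. (Y i x)\<^sup>2) - 2))) \<le> q"
    proof -
      have "norm (expectation (\<lambda>x. iexp (s * W x) * of_real ((\<Sum>i\<in>I. (Y i x)\<^sup>2) - 2))) \<le>
         expectation (\<lambda>x. \<bar>(\<Sum>i\<in>I. (Y i x)\<^sup>2) - 2\<bar>)"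
        using iS by (intro norm_integral_le integrable_iexp_mult)
          (auto simp: norm_mult simp del: of_real_sum of_real_diff intro!: integrable_of_real)
      then show ?thesis using Q by simp
    qed
    have "norm (?\<phi>' s + s * ?\<phi> s) \<le> 1 / 2 * norm (\<Sum>i\<in>I. expectation (D i)) +
       \<bar>s\<bar> / 2 * norm (expectation (\<lambda>x. iexp (s * W x) * of_real ((\<Sum>i\<in>I. (Y i x)\<^sup>2) - 2)))"
      unfolding e2 by (rule norm_triangle_le_diff) (simp add: norm_mult norm_divide del: of_real_diff of_real_sum)
    also have "\<dots> \<le> 1 / 2 * (t\<^sup>2 / 2 * r) + \<bar>t\<bar> / 2 * q"
      using s n1 n2 by (intro add_mono mult_mono) (auto)
    finally show "norm (?\<phi>' s + s * ?\<phi> s) \<le> \<bar>t\<bar> / 2 * q + t\<^sup>2 / 4 * r" by simp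
  qed
qed

section \<open>Studentization and Slutsky's argument\<close>

lemma char_ratio_diff_le:
  assumes [measurable]: "S \<in> borel_measurable M"
    and W: "integrable M W" and R: "integrable M R" and S: "integrable M (\<lambda>x. \<bar>S x - 1\<bar>)"
    and \<delta>: "0 < \<delta>" "\<delta> \<le> 1 / 2"
  shows "cmod (expectation (\<lambda>x. iexp (s * ((W x + R x) / sqrt (S x)))) - expectation (\<lambda>x. iexp (s * W x)))
     \<le> \<bar>s\<bar> * expectation (\<lambda>x. \<bar>R x\<bar>)
       + 2 * \<delta> * \<bar>s\<bar> * (expectation (\<lambda>x. \<bar>W x\<bar>) + expectation (\<lambda>x. \<bar>R x\<bar>))
       + 2 / \<delta> * expectation (\<lambda>x. \<bar>S x - 1\<bar>)"
proof -
  have [measurable]: "W \<in> borel_measurable M" "R \<in> borel_measurable M" using W R by auto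
  let ?g = "\<lambda>x. \<bar>s\<bar> * \<bar>R x\<bar> + 2 * \<delta> * \<bar>s\<bar> * (\<bar>W x\<bar> + \<bar>R x\<bar>) + 2 / \<delta> * \<bar>S x - 1\<bar>"
  have iR: "integrable M (\<lambda>x. \<bar>R x\<bar>)" and iW: "integrable M (\<lambda>x. \<bar>W x\<bar>)"
    using R W by (auto intro: integrable_abs)
  have g: "expectation ?g = \<bar>s\<bar> * expectation (\<lambda>x. \<bar>R x\<bar>)
       + 2 * \<delta> * \<bar>s\<bar> * (expectation (\<lambda>x. \<bar>W x\<bar>) + expectation (\<lambda>x. \<bar>R x\<bar>))
       + 2 / \<delta> * expectation (\<lambda>x. \<bar>S x - 1\<bar>)"
    using iR iW S by (simp only: Bochner_Integration.integral_add Bochner_Integration.integrable_add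
        Bochner_Integration.integral_mult_right_zero Bochner_Integration.integrable_mult_right)
  have i1: "integrable M (\<lambda>x. iexp (s * ((W x + R x) / sqrt (S x))))"
    and i2: "integrable M (\<lambda>x. iexp (s * W x))" by (rule integrable_iexp; simp)+
  have d: "expectation (\<lambda>x. iexp (s * ((W x + R x) / sqrt (S x)))) - expectation (\<lambda>x. iexp (s * W x)) =
     expectation (\<lambda>x. iexp (s * ((W x + R x) / sqrt (S x))) - iexp (s * W x))"
    by (intro Bochner_Integration.integral_diff[symmetric] i1 i2)
  have "cmod (expectation (\<lambda>x. iexp (s * ((W x + R x) / sqrt (S x))) - iexp (s * W x))) \<le> expectation ?g"
  proof (rule norm_integral_le)
    show "integrable M (\<lambda>x. iexp (s * ((W x + R x) / sqrt (S x))) - iexp (s * W x))"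
      by (intro Bochner_Integration.integrable_diff i1 i2)
    show "integrable M ?g" using W R S by auto
    fix x
    define V where "V = W x + R x"
    have lip: "cmod (iexp a - iexp b) \<le> \<bar>a - b\<bar>" for a b :: real
    proof -
      have "iexp a - iexp b = iexp b * (iexp (a - b) - 1)"
        by (simp add: algebra_simps flip: exp_add)
      then have "cmod (iexp a - iexp b) = cmod (iexp (a - b) - 1)"
        by (simp only: norm_mult norm_exp_i_times mult_1)
      then show ?thesis using norm_iexp_minus_1_le1[of "a - b"] by (simp only:)
    qed
    have a1: "cmod (iexp (s * V) - iexp (s * W x)) \<le> \<bar>s\<bar> * \<bar>R x\<bar>"
      using lip[of "s * V" "s * W x"] by (simp add: V_def ring_distribs abs_mult)
    \<comment> \<open>Near 1 the factor \<open>1 / sqrt (S x)\<close> differs from 1 by at most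
      \<open>2 * \<delta>\<close>. Away from 1 the trivial bound 2 is below
      \<open>2 / \<delta> * \<bar>S x - 1\<bar>\<close>, a pointwise form of Markov's inequality.
      Points with nonpositive \<open>S x\<close> fall under the second case: the quotient is still
      some real number and the exponential still has modulus 1.\<close>
    have a2: "cmod (iexp (s * (V / sqrt (S x))) - iexp (s * V)) \<le>
        2 * \<delta> * \<bar>s\<bar> * (\<bar>W x\<bar> + \<bar>R x\<bar>) + 2 / \<delta> * \<bar>S x - 1\<bar>"
    proof (cases "\<bar>S x - 1\<bar> \<le> \<delta>")
      case True
      define r where "r = sqrt (S x)"
      have S: "S x \<ge> 1 / 2" using True \<delta> by linarith
      have r: "r\<^sup>2 = S x" "r > 0" using S by (auto simp: r_def)
      have "r \<ge> 1 / 2"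
        unfolding r_def by (rule real_le_rsqrt) (use S in \<open>simp add: power2_eq_square\<close>)
      have "\<bar>1 / r - 1\<bar> * (r * (1 + r)) = \<bar>S x - 1\<bar>"
      proof -
        have "(1 / r - 1) * (r * (1 + r)) = 1 - S x"
          using r by (simp add: field_simps power2_eq_square)
        then have "\<bar>1 / r - 1\<bar> * \<bar>r * (1 + r)\<bar> = \<bar>1 - S x\<bar>" by (simp only: flip: abs_mult)
        then show ?thesis using r by (simp add: abs_minus_commute)
      qed
      moreover have "r * (1 + r) \<ge> 1 / 2"
        using mult_mono[of "1/2" r "1" "1+r"] \<open>r \<ge> 1/2\<close> by auto
      ultimately have "\<bar>1 / r - 1\<bar> * (1 / 2) \<le> \<delta>"
        using mult_left_mono[of "1/2" "r * (1 + r)" "\<bar>1 / r - 1\<bar>"] True by linarith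
      then have d: "\<bar>1 / r - 1\<bar> \<le> 2 * \<delta>" by simp
      have "cmod (iexp (s * (V / r)) - iexp (s * V)) \<le> \<bar>s * (V / r) - s * V\<bar>" by (rule lip)
      also have "s * (V / r) - s * V = s * V * (1 / r - 1)" by (simp add: algebra_simps)
      also have "\<bar>\<dots>\<bar> \<le> \<bar>s\<bar> * \<bar>V\<bar> * (2 * \<delta>)"
        unfolding abs_mult using d by (intro mult_left_mono) auto
      also have "\<dots> \<le> \<bar>s\<bar> * (\<bar>W x\<bar> + \<bar>R x\<bar>) * (2 * \<delta>)"
        using \<delta> by (intro mult_right_mono mult_left_mono) (auto simp: V_def)
      finally show ?thesis using \<delta> by (simp add: r_def mult_ac add_increasing2)
    next
      case False
      have "cmod (iexp (s * (V / sqrt (S x))) - iexp (s * V)) \<le> 1 + 1"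
        by (rule norm_triangle_le_diff) (simp only: norm_exp_i_times)
      also have "\<dots> \<le> 2 / \<delta> * \<bar>S x - 1\<bar>" using False \<delta> by (simp add: field_simps)
      finally show ?thesis using \<delta> by (simp add: add_increasing)
    qed
    show "cmod (iexp (s * ((W x + R x) / sqrt (S x))) - iexp (s * W x)) \<le> ?g x"
    proof -
      have "iexp (s * ((W x + R x) / sqrt (S x))) - iexp (s * W x) =
          (iexp (s * V) - iexp (s * W x)) + (iexp (s * (V / sqrt (S x))) - iexp (s * V))"
        unfolding V_def by (rule sym, rule diff_add_cancel_mid)
      then show ?thesis
        using norm_triangle_le[OF add_mono[OF a1 a2]] by (simp only: add.assoc)
    qed
  qed
  then show ?thesis unfolding g d .
qed

end

text \<open>The probability space changes with \<open>t\<close>, so the error terms are measured in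
  the \<open>L^1\<close> norm of the current space. The decomposition is asked for only eventually,
  whereas \<open>T t\<close> must be measurable for every \<open>t\<close>, because the continuity
  theorem speaks about a full sequence of distributions.\<close>

lemma weak_conv_studentized:
  fixes P :: "nat \<Rightarrow> 'a measure" and W R S :: "nat \<Rightarrow> 'a \<Rightarrow> real"
  assumes P: "\<And>t. prob_space (P t)"
    and T[measurable]: "\<And>t. T t \<in> borel_measurable (P t)"
    and S: "\<forall>\<^sub>F t in sequentially. S t \<in> borel_measurable (P t) \<and> integrable (P t) (W t) \<and>
       integrable (P t) (R t) \<and> integrable (P t) (\<lambda>x. \<bar>S t x - 1\<bar>) \<and> (\<integral>x. \<bar>W t x\<bar> \<partial>P t) \<le> C \<and>
       (\<forall>x\<in>space (P t). T t x = (W t x + R t x) / sqrt (S t x))"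
    and R0: "(\<lambda>t. \<integral>x. \<bar>R t x\<bar> \<partial>P t) \<longlonglongrightarrow> 0"
    and S1: "(\<lambda>t. \<integral>x. \<bar>S t x - 1\<bar> \<partial>P t) \<longlonglongrightarrow> 0"
    and W: "\<And>s. (\<lambda>t. \<integral>x. iexp (s * W t x) \<partial>P t) \<longlonglongrightarrow> of_real (exp (- (s\<^sup>2) / 2))"
  shows "weak_conv_m (\<lambda>t. distr (P t) borel (T t)) std_normal_distribution"
proof (rule levy_continuity)
  show "real_distribution (distr (P t) borel (T t))" for t
    using prob_space.real_distribution_distr[OF P T] .
  show "real_distribution std_normal_distribution" by (rule real_dist_normal_dist)
  fix s :: real
  define f where "f t = (\<integral>x. iexp (s * T t x) \<partial>P t)" for t
  define g where "g t = (\<integral>x. iexp (s * W t x) \<partial>P t)" for t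
  have "(\<lambda>t. f t - g t) \<longlonglongrightarrow> 0"
  proof (rule tendsto_norm_zero_cancel, rule LIMSEQ_I)
    fix e :: real assume e: "0 < e"
    have C: "0 \<le> \<bar>C\<bar>" by simp
    \<comment> \<open>For fixed \<open>\<delta>\<close> the terms with \<open>R\<close> and
      \<open>S\<close> vanish in the limit. What stays is
      \<open>2 * \<delta> * \<bar>s\<bar> * C\<close>, and this choice keeps it at most
      \<open>e / 4\<close>.\<close>
    define \<delta> where "\<delta> = min (1 / 2) (e / (8 * (\<bar>s\<bar> + 1) * (\<bar>C\<bar> + 1)))"
    have \<delta>: "0 < \<delta>" "\<delta> \<le> 1 / 2"
      using e unfolding \<delta>_def by (simp, intro min.cobounded1)
    have "\<delta> \<le> e / (8 * (\<bar>s\<bar> + 1) * (\<bar>C\<bar> + 1))" by (simp add: \<delta>_def)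
    then have \<delta>e: "8 * \<delta> * ((\<bar>s\<bar> + 1) * (\<bar>C\<bar> + 1)) \<le> e"
      by (subst (asm) pos_le_divide_eq) (auto simp: mult_ac intro: mult_pos_pos)
    have l: "(\<lambda>t. \<bar>s\<bar> * (\<integral>x. \<bar>R t x\<bar> \<partial>P t) + 2 * \<delta> * \<bar>s\<bar> * (C + (\<integral>x. \<bar>R t x\<bar> \<partial>P t))
        + 2 / \<delta> * (\<integral>x. \<bar>S t x - 1\<bar> \<partial>P t)) \<longlonglongrightarrow> \<bar>s\<bar> * 0 + 2 * \<delta> * \<bar>s\<bar> * (C + 0) + 2 / \<delta> * 0"
      by (intro tendsto_intros R0 S1)
    have "\<bar>s\<bar> * C \<le> \<bar>s\<bar> * \<bar>C\<bar>" by (intro mult_left_mono) auto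
    also have "\<dots> \<le> (\<bar>s\<bar> + 1) * (\<bar>C\<bar> + 1)" by (intro mult_mono) auto
    finally have "2 * \<delta> * \<bar>s\<bar> * C \<le> 2 * \<delta> * ((\<bar>s\<bar> + 1) * (\<bar>C\<bar> + 1))"
      using \<delta> unfolding mult.assoc by (intro mult_left_mono) auto
    then have "2 * \<delta> * \<bar>s\<bar> * C < e" using \<delta>e e by linarith
    then have ev: "\<forall>\<^sub>F t in sequentially. \<bar>s\<bar> * (\<integral>x. \<bar>R t x\<bar> \<partial>P t) + 2 * \<delta> * \<bar>s\<bar> * (C + (\<integral>x. \<bar>R t x\<bar> \<partial>P t))
        + 2 / \<delta> * (\<integral>x. \<bar>S t x - 1\<bar> \<partial>P t) < e"
      using l by (intro order_tendstoD(2)[OF l]) simp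
    have "\<forall>\<^sub>F t in sequentially. norm (norm (f t - g t) - 0) < e"
      using ev S
    proof eventually_elim
      case (elim t)
      interpret prob_space "P t" by (rule P)
      have "f t = (\<integral>x. iexp (s * ((W t x + R t x) / sqrt (S t x))) \<partial>P t)"
        unfolding f_def using elim by (intro Bochner_Integration.integral_cong) auto
      then have "norm (f t - g t) \<le> \<bar>s\<bar> * expectation (\<lambda>x. \<bar>R t x\<bar>)
       + 2 * \<delta> * \<bar>s\<bar> * (expectation (\<lambda>x. \<bar>W t x\<bar>) + expectation (\<lambda>x. \<bar>R t x\<bar>))
       + 2 / \<delta> * expectation (\<lambda>x. \<bar>S t x - 1\<bar>)"
        using char_ratio_diff_le[of "S t" "W t" "R t" \<delta> s] elim \<delta> by (simp add: g_def)
      also have "\<dots> \<le> \<bar>s\<bar> * expectation (\<lambda>x. \<bar>R t x\<bar>)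
       + 2 * \<delta> * \<bar>s\<bar> * (C + expectation (\<lambda>x. \<bar>R t x\<bar>))
       + 2 / \<delta> * expectation (\<lambda>x. \<bar>S t x - 1\<bar>)"
        using elim \<delta> by (intro add_mono mult_left_mono) auto
      finally show ?case using elim by simp
    qed
    then show "\<exists>n0. \<forall>n\<ge>n0. norm (norm (f n - g n) - 0) < e"
      by (simp add: eventually_sequentially)
  qed
  from tendsto_add[OF this W[of s, folded g_def]]
  have "f \<longlonglongrightarrow> of_real (exp (- (s\<^sup>2) / 2))" by simp
  moreover have "f = (\<lambda>t. char (distr (P t) borel (T t)) s)"
    unfolding f_def char_def by (subst integral_distr) auto
  ultimately show "(\<lambda>n. char (distr (P n) borel (T n)) s) \<longlonglongrightarrow> char std_normal_distribution s"
    unfolding char_std_normal_distribution by (simp only:)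
qed

section \<open>Moments of a degenerate kernel\<close>

text \<open>Coordinates of an i.i.d. family taken along an injection are again i.i.d. with the same
  law. So every expectation over distinct sample points reduces to one over a fixed small product,
  whatever the sample size.\<close>

lemma integral_PiM_reindex:
  fixes \<Phi> :: "('j \<Rightarrow> 'a) \<Rightarrow> 'b::{banach, second_countable_topology}"
  assumes "prob_space \<mu>" "inj_on f J" "f \<in> J \<rightarrow> I"
    and [measurable]: "\<Phi> \<in> borel_measurable (\<Pi>\<^sub>M j\<in>J. \<mu>)"
  shows "(\<integral>x. \<Phi> (\<lambda>j\<in>J. x (f j)) \<partial>(\<Pi>\<^sub>M i\<in>I. \<mu>)) = (\<integral>x. \<Phi> x \<partial>(\<Pi>\<^sub>M j\<in>J. \<mu>))"
    and "integrable (\<Pi>\<^sub>M i\<in>I. \<mu>) (\<lambda>x. \<Phi> (\<lambda>j\<in>J. x (f j))) \<longleftrightarrow> integrable (\<Pi>\<^sub>M j\<in>J. \<mu>) \<Phi>"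
proof -
  have eq: "distr (\<Pi>\<^sub>M i\<in>I. \<mu>) (\<Pi>\<^sub>M j\<in>J. \<mu>) (\<lambda>x. \<lambda>j\<in>J. x (f j)) = (\<Pi>\<^sub>M j\<in>J. \<mu>)"
    using distr_PiM_reindex[of I "\<lambda>_. \<mu>" f J] assms by simp
  have [measurable]: "(\<lambda>x. \<lambda>j\<in>J. x (f j)) \<in> measurable (\<Pi>\<^sub>M i\<in>I. \<mu>) (\<Pi>\<^sub>M j\<in>J. \<mu>)"
    using assms(3) by (intro measurable_restrict measurable_component_singleton) auto
  show "(\<integral>x. \<Phi> (\<lambda>j\<in>J. x (f j)) \<partial>(\<Pi>\<^sub>M i\<in>I. \<mu>)) = (\<integral>x. \<Phi> x \<partial>(\<Pi>\<^sub>M j\<in>J. \<mu>))"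
    using integral_distr[of "\<lambda>x. \<lambda>j\<in>J. x (f j)" "\<Pi>\<^sub>M i\<in>I. \<mu>" "\<Pi>\<^sub>M j\<in>J. \<mu>" \<Phi>] unfolding eq by simp
  show "integrable (\<Pi>\<^sub>M i\<in>I. \<mu>) (\<lambda>x. \<Phi> (\<lambda>j\<in>J. x (f j))) \<longleftrightarrow> integrable (\<Pi>\<^sub>M j\<in>J. \<mu>) \<Phi>"
    using integrable_distr_eq[of "\<lambda>x. \<lambda>j\<in>J. x (f j)" "\<Pi>\<^sub>M i\<in>I. \<mu>" "\<Pi>\<^sub>M j\<in>J. \<mu>" \<Phi>] unfolding eq by simp
qed

lemma abs_prod4_le:
  fixes a b c d :: real
  shows "\<bar>a * b * c * d\<bar> \<le> a ^ 4 + b ^ 4 + c ^ 4 + d ^ 4"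
proof -
  have 1: "\<bar>u * v\<bar> \<le> u\<^sup>2 + v\<^sup>2" for u v :: real
  proof -
    have "2 * (\<bar>u\<bar> * \<bar>v\<bar>) \<le> u\<^sup>2 + v\<^sup>2"
      using sum_squares_bound[of "\<bar>u\<bar>" "\<bar>v\<bar>"] by (simp add: mult.assoc)
    moreover have "0 \<le> \<bar>u\<bar> * \<bar>v\<bar>" by simp
    ultimately show ?thesis unfolding abs_mult by linarith
  qed
  have 2: "2 * (u * v) \<le> u\<^sup>2 + v\<^sup>2" for u v :: real
    using sum_squares_bound[of u v] by (simp add: mult.assoc)
  have "\<bar>a * b * c * d\<bar> = \<bar>a * b\<bar> * \<bar>c * d\<bar>" by (simp add: abs_mult)
  also have "\<dots> \<le> (a\<^sup>2 + b\<^sup>2) * (c\<^sup>2 + d\<^sup>2)" by (intro mult_mono 1) auto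
  also have "2 * \<dots> \<le> (a\<^sup>2 + b\<^sup>2)\<^sup>2 + (c\<^sup>2 + d\<^sup>2)\<^sup>2" by (rule 2)
  also have "(a\<^sup>2 + b\<^sup>2)\<^sup>2 \<le> 2 * (a ^ 4 + b ^ 4)"
    using 2[of "a\<^sup>2" "b\<^sup>2"] by (simp add: power2_sum)
  also have "(c\<^sup>2 + d\<^sup>2)\<^sup>2 \<le> 2 * (c ^ 4 + d ^ 4)"
    using 2[of "c\<^sup>2" "d\<^sup>2"] by (simp add: power2_sum)
  finally show ?thesis by simp
qed

lemma sum_if_le:
  fixes b :: real
  assumes "finite S" "finite X" "{q\<in>S. P q} \<subseteq> X" "card X \<le> n" "0 \<le> b"
  shows "(\<Sum>q\<in>S. if P q then b else 0) \<le> real n * b"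
proof -
  have "(\<Sum>q\<in>S. if P q then b else 0) = real (card {q\<in>S. P q}) * b"
    using assms(1) by (simp add: sum.If_cases Int_def)
  also have "\<dots> \<le> real n * b"
    using card_mono[OF assms(2,3)] assms(4,5) by (intro mult_right_mono) auto
  finally show ?thesis .
qed

text \<open>The product over \<open>{..<4}\<close> carries the four copies that occur in the moment
  conditions. At least four indices are required so that any pattern of fewer distinct indices can
  be completed to four and compared with this product. Symmetry is demanded for all arguments, also
  outside the space, so that \<open>G i j\<close> and \<open>G j i\<close> are equal as
  functions.\<close>

locale degenerate_kernel =
  fixes \<mu> :: "'a measure" and I :: "'i set" and h :: "'a \<Rightarrow> 'a \<Rightarrow> real"
  assumes prob_space_\<mu>: "prob_space \<mu>"
    and fin: "finite I" and card4: "4 \<le> card I"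
    and h_measurable: "(\<lambda>(x, y). h x y) \<in> borel_measurable (\<mu> \<Otimes>\<^sub>M \<mu>)"
    and sym: "h x y = h y x"
    and fourth: "integrable (\<Pi>\<^sub>M _\<in>{..<4::nat}. \<mu>) (\<lambda>x. h (x 0) (x 1) ^ 4)"
    and unit: "(\<integral>x. (h (x 0) (x 1))\<^sup>2 \<partial>(\<Pi>\<^sub>M _\<in>{..<4::nat}. \<mu>)) = 1"
    and degenerate: "AE x in \<mu>. has_bochner_integral \<mu> (\<lambda>y. h y x) 0"
begin

text \<open>The three moments of (ii). The second moment is 1 here, so their denominators have
  disappeared. Only \<open>C4\<close> can be negative.\<close>

definition A4 :: real where "A4 = (\<integral>x. h (x 0) (x 1) ^ 4 \<partial>(\<Pi>\<^sub>M _\<in>{..<4::nat}. \<mu>))"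
definition B4 :: real where
  "B4 = (\<integral>x. (h (x 0) (x 2))\<^sup>2 * (h (x 1) (x 2))\<^sup>2 \<partial>(\<Pi>\<^sub>M _\<in>{..<4::nat}. \<mu>))"
definition C4 :: real where
  "C4 = (\<integral>x. h (x 0) (x 2) * h (x 1) (x 2) * h (x 0) (x 3) * h (x 1) (x 3) \<partial>(\<Pi>\<^sub>M _\<in>{..<4::nat}. \<mu>))"

abbreviation P :: "('i \<Rightarrow> 'a) measure" where "P \<equiv> (\<Pi>\<^sub>M _\<in>I. \<mu>)"

definition D :: "('i \<times> 'i) set" where "D = {p \<in> I \<times> I. fst p \<noteq> snd p}"

definition G :: "'i \<Rightarrow> 'i \<Rightarrow> ('i \<Rightarrow> 'a) \<Rightarrow> real" where "G i j x = h (x i) (x j)"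

lemma G_sym: "G i j = G j i"
  by (simp add: G_def fun_eq_iff sym)

sublocale PP: prob_space P
  using prob_space_\<mu> by (intro prob_space_PiM)

lemma finD[simp]: "finite D"
  using fin unfolding D_def by (intro finite_Collect_conjI) auto

lemma h_measurable': "i \<in> J \<Longrightarrow> j \<in> J \<Longrightarrow> (\<lambda>x. h (x i) (x j)) \<in> borel_measurable (\<Pi>\<^sub>M _\<in>J. \<mu>)"
proof -
  assume [simp]: "i \<in> J" "j \<in> J"
  have "(\<lambda>x. (x i, x j)) \<in> measurable (\<Pi>\<^sub>M _\<in>J. \<mu>) (\<mu> \<Otimes>\<^sub>M \<mu>)"
    by (intro measurable_Pair measurable_component_singleton) auto
  from measurable_compose[OF this h_measurable] show ?thesis by simp
qed

lemma G_measurable[measurable (raw)]: "i \<in> I \<Longrightarrow> j \<in> I \<Longrightarrow> G i j \<in> borel_measurable P"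
  using h_measurable'[of i I j] unfolding G_def[abs_def] .

lemma moment4:
  fixes \<Phi> :: "(nat \<Rightarrow> 'a) \<Rightarrow> real"
  assumes "distinct [i, j, k, l]" "{i, j, k, l} \<subseteq> I"
    and \<Phi>: "\<Phi> \<in> borel_measurable (\<Pi>\<^sub>M _\<in>{..<4::nat}. \<mu>)"
  shows "(\<integral>x. \<Phi> (\<lambda>n\<in>{..<4}. x ([i, j, k, l] ! n)) \<partial>P) = (\<integral>x. \<Phi> x \<partial>(\<Pi>\<^sub>M _\<in>{..<4::nat}. \<mu>))"
    and "integrable P (\<lambda>x. \<Phi> (\<lambda>n\<in>{..<4}. x ([i, j, k, l] ! n))) \<longleftrightarrow> integrable (\<Pi>\<^sub>M _\<in>{..<4::nat}. \<mu>) \<Phi>"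
proof -
  have 1: "inj_on (\<lambda>n. [i, j, k, l] ! n) {..<4}"
    using assms(1) inj_on_nth[of "[i,j,k,l]" "{..<4}"] by simp
  have 2: "(\<lambda>n. [i, j, k, l] ! n) \<in> {..<4} \<rightarrow> I"
    using assms(2) by (auto simp: less_Suc_eq numeral_eq_Suc)
  show "(\<integral>x. \<Phi> (\<lambda>n\<in>{..<4}. x ([i, j, k, l] ! n)) \<partial>P) = (\<integral>x. \<Phi> x \<partial>(\<Pi>\<^sub>M _\<in>{..<4::nat}. \<mu>))"
    "integrable P (\<lambda>x. \<Phi> (\<lambda>n\<in>{..<4}. x ([i, j, k, l] ! n))) \<longleftrightarrow> integrable (\<Pi>\<^sub>M _\<in>{..<4::nat}. \<mu>) \<Phi>"
    using integral_PiM_reindex[OF prob_space_\<mu> 1 2 \<Phi>] by auto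
qed

lemma ex_fresh: "length xs < 4 \<Longrightarrow> \<exists>l. l \<in> I \<and> l \<notin> set xs"
  using card_mono[of "set xs" I] card_length[of xs] card4 by fastforce

lemma E_C4:
  assumes "distinct [i, j, k, l]" "{i, j, k, l} \<subseteq> I"
  shows "(\<integral>x. G i k x * G j k x * G i l x * G j l x \<partial>P) = C4"
proof -
  have "(\<lambda>x. h (x 0) (x 2) * h (x 1) (x 2) * h (x 0) (x 3) * h (x 1) (x 3))
      \<in> borel_measurable (\<Pi>\<^sub>M _\<in>{..<4::nat}. \<mu>)"
    by (intro borel_measurable_times h_measurable') auto
  from moment4(1)[OF assms this] show ?thesis by (simp add: G_def C4_def)
qed

lemma E_B4:
  assumes "distinct [i, j, k]" "{i, j, k} \<subseteq> I"
  shows "(\<integral>x. (G i k x)\<^sup>2 * (G j k x)\<^sup>2 \<partial>P) = B4"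
proof -
  obtain l where l: "l \<in> I" "l \<notin> {i,j,k}" using ex_fresh[of "[i,j,k]"] by auto
  then have d: "distinct [i,j,k,l]" "{i,j,k,l} \<subseteq> I" using assms by auto
  have "(\<lambda>x. (h (x 0) (x 2))\<^sup>2 * (h (x 1) (x 2))\<^sup>2) \<in> borel_measurable (\<Pi>\<^sub>M _\<in>{..<4::nat}. \<mu>)"
    by (intro borel_measurable_times borel_measurable_power h_measurable') auto
  from moment4(1)[OF d this] show ?thesis by (simp add: G_def B4_def)
qed

lemma
  assumes "i \<in> I" "j \<in> I" "i \<noteq> j"
  shows E_A4: "(\<integral>x. (G i j x) ^ 4 \<partial>P) = A4"
    and E_unit: "(\<integral>x. (G i j x)\<^sup>2 \<partial>P) = 1"
    and G_fourth: "integrable P (\<lambda>x. (G i j x) ^ 4)"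
proof -
  obtain k where k: "k \<in> I" "k \<notin> {i,j}" using ex_fresh[of "[i,j]"] by auto
  obtain l where l: "l \<in> I" "l \<notin> {i,j,k}" using ex_fresh[of "[i,j,k]"] by auto
  have d: "distinct [i,j,k,l]" "{i,j,k,l} \<subseteq> I" using assms k l by auto
  have m: "(\<lambda>x. h (x 0) (x 1) ^ n) \<in> borel_measurable (\<Pi>\<^sub>M _\<in>{..<4::nat}. \<mu>)" for n
    by (intro borel_measurable_power h_measurable') auto
  show "(\<integral>x. (G i j x) ^ 4 \<partial>P) = A4"
    using moment4(1)[OF d m[of 4]] by (simp add: G_def A4_def)
  show "(\<integral>x. (G i j x)\<^sup>2 \<partial>P) = 1"
    using moment4(1)[OF d m[of 2]] unit by (simp add: G_def)
  show "integrable P (\<lambda>x. (G i j x) ^ 4)"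
    using moment4(2)[OF d m[of 4]] fourth by (simp add: G_def)
qed

lemma A4_nonneg: "0 \<le> A4" and B4_nonneg: "0 \<le> B4"
  by (auto simp: A4_def B4_def intro!: Bochner_Integration.integral_nonneg)

text \<open>A product of four numbers is dominated by the sum of their fourth powers. The single
  hypothesis \<open>fourth\<close> thus covers every quartic expression below, with no distinction
  of which indices coincide.\<close>

lemma integrable_G4:
  assumes "(a, b) \<in> D" "(c, d) \<in> D" "(e, f) \<in> D" "(g, k) \<in> D"
  shows "integrable P (\<lambda>x. G a b x * G c d x * G e f x * G g k x)"
proof (rule Bochner_Integration.integrable_bound)
  show "integrable P (\<lambda>x. (G a b x) ^ 4 + (G c d x) ^ 4 + (G e f x) ^ 4 + (G g k x) ^ 4)"
    using assms by (auto simp: D_def intro!: G_fourth Bochner_Integration.integrable_add)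
  show "(\<lambda>x. G a b x * G c d x * G e f x * G g k x) \<in> borel_measurable P"
    using assms by (auto simp: D_def)
  show "AE x in P. norm (G a b x * G c d x * G e f x * G g k x) \<le>
      norm ((G a b x) ^ 4 + (G c d x) ^ 4 + (G e f x) ^ 4 + (G g k x) ^ 4)"
    using abs_prod4_le by (intro AE_I2) (simp add: abs_of_nonneg)
qed

lemma integrable_G2:
  assumes "(a, b) \<in> D" "(c, d) \<in> D"
  shows "integrable P (\<lambda>x. G a b x * G c d x)"
proof (rule PP.integrable_if_square)
  show "(\<lambda>x. G a b x * G c d x) \<in> borel_measurable P" using assms by (auto simp: D_def)
  show "integrable P (\<lambda>x. (G a b x * G c d x)\<^sup>2)"
    using integrable_G4[OF assms assms] by (simp add: power2_eq_square mult_ac)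
qed

lemma integrable_G:
  assumes "(a, b) \<in> D" shows "integrable P (G a b)"
  by (rule PP.integrable_if_square)
     (use integrable_G2[OF assms assms] assms in \<open>auto simp: D_def power2_eq_square\<close>)

text \<open>Fubini with coordinate \<open>a\<close> innermost: \<open>F\<close> is constant in it
  and the kernel integrates to zero. \<open>F\<close> is vector valued because it is a real product
  in the moment bounds and a complex exponential in the characteristic function.\<close>

lemma degenerate_integral_zero:
  fixes F :: "('i \<Rightarrow> 'a) \<Rightarrow> 'b::{banach, second_countable_topology}"
  assumes ab: "a \<in> I" "b \<in> I" "a \<noteq> b"
    and F: "\<And>x y. F (x(a := y)) = F x"
    and int: "integrable P (\<lambda>x. G a b x *\<^sub>R F x)"
  shows "(\<integral>x. G a b x *\<^sub>R F x \<partial>P) = 0"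
proof -
  interpret \<mu>: prob_space \<mu> by (rule prob_space_\<mu>)
  interpret product_sigma_finite "\<lambda>_ :: 'i. \<mu>" by standard
  define J where "J = I - {a}"
  have J: "insert a J = I" "a \<notin> J" "finite J" "b \<in> J" using ab fin by (auto simp: J_def)
  have "(\<integral>x. G a b x *\<^sub>R F x \<partial>P) = (\<integral>x. (\<integral>y. G a b (x(a := y)) *\<^sub>R F (x(a := y)) \<partial>\<mu>) \<partial>(\<Pi>\<^sub>M _\<in>J. \<mu>))"
    using product_integral_insert[OF J(3,2), of "\<lambda>x. G a b x *\<^sub>R F x"] int J(1) by simp
  also have "\<dots> = 0"
  proof (rule integral_eq_zero_AE)
    \<comment> \<open>Degeneracy is known only for almost every second argument. That argument is
      coordinate \<open>b\<close>, which is still free in the outer integral, so an exceptional null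
      set does no harm.\<close>
    have "AE x in (\<Pi>\<^sub>M _\<in>J. \<mu>). has_bochner_integral \<mu> (\<lambda>y. h y (x b)) 0"
      using AE_PiM_component[of J "\<lambda>_. \<mu>" b] degenerate J(4) prob_space_\<mu> by auto
    then show "AE x in (\<Pi>\<^sub>M _\<in>J. \<mu>). (\<integral>y. G a b (x(a := y)) *\<^sub>R F (x(a := y)) \<partial>\<mu>) = 0"
    proof eventually_elim
      case (elim x)
      have "has_bochner_integral \<mu> (\<lambda>y. h y (x b) *\<^sub>R F x) (0 *\<^sub>R F x)"
        using elim by (rule has_bochner_integral_scaleR_left)
      then show ?case using ab by (simp add: G_def F has_bochner_integral_integral_eq)
    qed
  qed
  finally show ?thesis by simp
qed

end

lemma (in prob_space) expectation_square_sum: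
  fixes f :: "'s \<Rightarrow> 'a \<Rightarrow> real"
  assumes "finite S" "\<And>s t. s \<in> S \<Longrightarrow> t \<in> S \<Longrightarrow> integrable M (\<lambda>x. f s x * f t x)"
  shows "expectation (\<lambda>x. (\<Sum>s\<in>S. f s x)\<^sup>2) = (\<Sum>s\<in>S. \<Sum>t\<in>S. expectation (\<lambda>x. f s x * f t x))"
    and "integrable M (\<lambda>x. (\<Sum>s\<in>S. f s x)\<^sup>2)"
  using assms by (simp_all add: power2_eq_square sum_product)

lemma mult_swap: "a * (b * c) = b * a * (c :: real)"
  by simp

lemma card_pair_le: "card {a, b} \<le> 2" by (cases "a = b") auto

lemma card_triple_le: "card {a, b, c} \<le> 3"
  using card_length[of "[a, b, c]"] unfolding list.set list.size by simp

section \<open>Second moments of sums over pairs\<close>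

context degenerate_kernel
begin

lemma G_upd: "i \<noteq> a \<Longrightarrow> j \<noteq> a \<Longrightarrow> G i j (x(a := y)) = G i j x"
  by (simp add: G_def)

lemma E_zero:
  fixes F :: "('i \<Rightarrow> 'a) \<Rightarrow> real"
  assumes "(a, b) \<in> D" "\<And>x y. F (x(a := y)) = F x" "integrable P (\<lambda>x. G a b x * F x)"
  shows "(\<integral>x. G a b x * F x \<partial>P) = 0"
  using degenerate_integral_zero[of a b F] assms by (auto simp: D_def)

lemma D_iff: "(i, j) \<in> D \<longleftrightarrow> i \<in> I \<and> j \<in> I \<and> i \<noteq> j"
  by (auto simp: D_def)

text \<open>If the two unordered pairs differ, some index occurs in one factor only and can be
  integrated out. The kernel values at different pairs are thus orthogonal although they are not
  independent.\<close>

lemma E_G2: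
  assumes "(i, j) \<in> D" "(k, l) \<in> D"
  shows "(\<integral>x. G i j x * G k l x \<partial>P) = (if (k, l) = (i, j) \<or> (k, l) = (j, i) then 1 else 0)"
proof (cases "(k, l) = (i, j) \<or> (k, l) = (j, i)")
  case True
  then have "G k l = G i j" by (auto intro: G_sym)
  then show ?thesis using True E_unit[of i j] assms by (simp add: D_iff power2_eq_square)
next
  case False
  then consider "i \<notin> {k, l}" | "j \<notin> {k, l}" using assms by (auto simp: D_iff)
  then have "(\<integral>x. G i j x * G k l x \<partial>P) = 0"
  proof cases
    case 1 then show ?thesis
      using assms integrable_G2[OF assms] by (intro E_zero) (auto simp: G_upd)
  next
    case 2
    have "(j, i) \<in> D" using assms by (auto simp: D_iff)
    with 2 have "(\<integral>x. G j i x * G k l x \<partial>P) = 0"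
      using assms integrable_G2[of j i k l] by (intro E_zero) (auto simp: G_upd)
    then show ?thesis by (simp add: G_sym[of j i])
  qed
  then show ?thesis using False by auto
qed

lemma sum_D_swap: "(\<Sum>p\<in>D. f (snd p, fst p)) = (\<Sum>p\<in>D. f p)"
  by (rule sum.reindex_bij_witness[where i="\<lambda>p. (snd p, fst p)" and j="\<lambda>p. (snd p, fst p)"])
     (auto simp: D_def)

text \<open>By orthogonality a pair meets only itself and its reversal. The product of the
  coefficients of the two orders is at most half the sum of their squares, and this gives the factor
  2 for coefficients that may be asymmetric.\<close>

lemma linear_second_moment:
  fixes c :: "'i \<Rightarrow> 'i \<Rightarrow> real"
  shows "(\<integral>x. (\<Sum>(i, j)\<in>D. c i j * G i j x)\<^sup>2 \<partial>P) \<le> 2 * (\<Sum>(i, j)\<in>D. (c i j)\<^sup>2)"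
    and "integrable P (\<lambda>x. (\<Sum>(i, j)\<in>D. c i j * G i j x)\<^sup>2)"
proof -
  let ?f = "\<lambda>p x. c (fst p) (snd p) * G (fst p) (snd p) x"
  have i: "integrable P (\<lambda>x. ?f p x * ?f q x)" if "p \<in> D" "q \<in> D" for p q
    using integrable_mult_right[OF integrable_G2[of "fst p" "snd p" "fst q" "snd q"], of "c (fst p) (snd p) * c (fst q) (snd q)"] that
    by (simp add: mult_ac)
  show "integrable P (\<lambda>x. (\<Sum>(i, j)\<in>D. c i j * G i j x)\<^sup>2)"
    using PP.expectation_square_sum(2)[OF finD i] by (simp add: case_prod_unfold)
  have "(\<integral>x. (\<Sum>(i, j)\<in>D. c i j * G i j x)\<^sup>2 \<partial>P) = (\<Sum>p\<in>D. \<Sum>q\<in>D. \<integral>x. ?f p x * ?f q x \<partial>P)"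
    using PP.expectation_square_sum(1)[OF finD i] by (simp add: case_prod_unfold)
  also have "\<dots> = (\<Sum>p\<in>D. (c (fst p) (snd p))\<^sup>2 + c (fst p) (snd p) * c (snd p) (fst p))"
  proof (rule sum.cong[OF refl])
    fix p assume p: "p \<in> D"
    obtain i j where ij: "p = (i, j)" by (cases p)
    have "(\<Sum>q\<in>D. \<integral>x. ?f p x * ?f q x \<partial>P) =
        (\<Sum>q\<in>D. c i j * c (fst q) (snd q) * (if q = (i, j) \<or> q = (j, i) then 1 else 0))"
    proof (rule sum.cong[OF refl])
      fix q assume q: "q \<in> D"
      obtain k l where kl: "q = (k, l)" by (cases q)
      have "(\<integral>x. ?f p x * ?f q x \<partial>P) = (\<integral>x. (c i j * c k l) * (G i j x * G k l x) \<partial>P)"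
        by (simp add: ij kl mult_ac)
      also have "\<dots> = c i j * c k l * (\<integral>x. G i j x * G k l x \<partial>P)" by simp
      also have "\<dots> = c i j * c k l * (if (k, l) = (i, j) \<or> (k, l) = (j, i) then 1 else 0)"
        using E_G2 p q ij kl by simp
      finally show "(\<integral>x. ?f p x * ?f q x \<partial>P) =
          c i j * c (fst q) (snd q) * (if q = (i, j) \<or> q = (j, i) then 1 else 0)"
        by (simp add: kl)
    qed
    also have "\<dots> = (\<Sum>q\<in>{(i, j), (j, i)}. c i j * c (fst q) (snd q))"
      using p ij by (intro sum.mono_neutral_cong_right) (auto simp: D_iff)
    also have "\<dots> = (c i j)\<^sup>2 + c i j * c j i"
      using p ij by (simp add: D_iff power2_eq_square)
    finally show "(\<Sum>q\<in>D. \<integral>x. ?f p x * ?f q x \<partial>P) =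
        (c (fst p) (snd p))\<^sup>2 + c (fst p) (snd p) * c (snd p) (fst p)" by (simp add: ij)
  qed
  also have "\<dots> \<le> (\<Sum>p\<in>D. 3 / 2 * (c (fst p) (snd p))\<^sup>2 + 1 / 2 * (c (snd p) (fst p))\<^sup>2)"
  proof (rule sum_mono)
    fix p
    show "(c (fst p) (snd p))\<^sup>2 + c (fst p) (snd p) * c (snd p) (fst p) \<le>
        3 / 2 * (c (fst p) (snd p))\<^sup>2 + 1 / 2 * (c (snd p) (fst p))\<^sup>2"
      using sum_squares_bound[of "c (fst p) (snd p)" "c (snd p) (fst p)"] by simp
  qed
  also have "\<dots> = 2 * (\<Sum>p\<in>D. (c (fst p) (snd p))\<^sup>2)"
    using sum_D_swap[of "\<lambda>p. (c (fst p) (snd p))\<^sup>2"] by (simp add: sum.distrib flip: sum_distrib_left sum_divide_distrib)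
  finally show "(\<integral>x. (\<Sum>(i, j)\<in>D. c i j * G i j x)\<^sup>2 \<partial>P) \<le> 2 * (\<Sum>(i, j)\<in>D. (c i j)\<^sup>2)"
    by (simp add: case_prod_unfold)
qed

text \<open>Squares are not degenerate, so here the product structure itself is used: the law on
  \<open>{i, j} \<union> {k, l}\<close> splits into two factors, and each factor contributes a
  second moment equal to 1.\<close>

lemma E_indep:
  assumes d: "distinct [i, j, k, l]" "{i, j, k, l} \<subseteq> I"
  shows "(\<integral>x. (G i j x)\<^sup>2 * (G k l x)\<^sup>2 \<partial>P) = 1"
proof -
  interpret \<mu>: prob_space \<mu> by (rule prob_space_\<mu>)
  interpret product_sigma_finite "\<lambda>_ :: 'i. \<mu>" by standard
  let ?\<Phi> = "\<lambda>x. (h (x i) (x j))\<^sup>2 * (h (x k) (x l))\<^sup>2"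
  have m: "?\<Phi> \<in> borel_measurable (\<Pi>\<^sub>M _\<in>{i, j} \<union> {k, l}. \<mu>)"
    by (intro borel_measurable_times borel_measurable_power h_measurable') auto
  have one: "(\<integral>x. (h (x a) (x b))\<^sup>2 \<partial>(\<Pi>\<^sub>M _\<in>{a, b}. \<mu>)) = 1" if "a \<in> I" "b \<in> I" "a \<noteq> b" for a b
  proof -
    have "(\<lambda>x. (h (x a) (x b))\<^sup>2) \<in> borel_measurable (\<Pi>\<^sub>M _\<in>{a, b}. \<mu>)"
      by (intro borel_measurable_power h_measurable') auto
    from integral_PiM_reindex(1)[OF prob_space_\<mu> _ _ this, of "\<lambda>x. x" I]
    show ?thesis using that E_unit[of a b] by (simp add: G_def)
  qed
  have int: "integrable P (\<lambda>x. (G i j x)\<^sup>2 * (G k l x)\<^sup>2)"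
    using integrable_G4[of i j i j k l k l] d by (simp add: D_iff power2_eq_square mult_ac)
  note re = integral_PiM_reindex[OF prob_space_\<mu> _ _ m, of "\<lambda>x. x" I]
  have e1: "(\<integral>x. (G i j x)\<^sup>2 * (G k l x)\<^sup>2 \<partial>P) = (\<integral>x. ?\<Phi> x \<partial>(\<Pi>\<^sub>M _\<in>{i, j} \<union> {k, l}. \<mu>))"
    using re(1) d by (simp add: G_def)
  have int': "integrable (\<Pi>\<^sub>M _\<in>{i, j} \<union> {k, l}. \<mu>) ?\<Phi>"
    using re(2) d int by (simp add: G_def)
  have "(\<integral>x. ?\<Phi> x \<partial>(\<Pi>\<^sub>M _\<in>{i, j} \<union> {k, l}. \<mu>)) =
      (\<integral>x. \<integral>y. ?\<Phi> (merge {i, j} {k, l} (x, y)) \<partial>(\<Pi>\<^sub>M _\<in>{k, l}. \<mu>) \<partial>(\<Pi>\<^sub>M _\<in>{i, j}. \<mu>))"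
    using d by (intro product_integral_fold int') auto
  also have "\<dots> = (\<integral>x. \<integral>y. (h (x i) (x j))\<^sup>2 * (h (y k) (y l))\<^sup>2 \<partial>(\<Pi>\<^sub>M _\<in>{k, l}. \<mu>) \<partial>(\<Pi>\<^sub>M _\<in>{i, j}. \<mu>))"
  proof -
    have "k \<noteq> i" "k \<noteq> j" "l \<noteq> i" "l \<noteq> j" using d by auto
    then show ?thesis by (simp add: merge_def)
  qed
  also have "\<dots> = 1" using d one[of i j] one[of k l] by simp
  finally show ?thesis using e1 by simp
qed

lemma integrable_sq_sq: "(i, j) \<in> D \<Longrightarrow> (k, l) \<in> D \<Longrightarrow> integrable P (\<lambda>x. (G i j x)\<^sup>2 * (G k l x)\<^sup>2)"
  using integrable_G4[of i j i j k l k l] by (simp add: power2_eq_square mult_ac)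

lemma integrable_sq: "(i, j) \<in> D \<Longrightarrow> integrable P (\<lambda>x. (G i j x)\<^sup>2)"
  using integrable_G2[of i j i j] by (simp add: power2_eq_square)

lemma E_sq_sq:
  assumes ij: "(i, j) \<in> D" and kl: "(k, l) \<in> D"
  shows "(\<integral>x. (G i j x)\<^sup>2 * (G k l x)\<^sup>2 \<partial>P) \<le>
    (if (k, l) = (i, j) \<or> (k, l) = (j, i) then A4 else if k \<in> {i, j} \<or> l \<in> {i, j} then B4 else 1)"
proof -
  consider "(k, l) = (i, j) \<or> (k, l) = (j, i)" | "k = i" "l \<noteq> j" | "k = j" "l \<noteq> i" | "l = i" "k \<noteq> j"
    | "l = j" "k \<noteq> i" | "k \<notin> {i, j}" "l \<notin> {i, j}" by auto
  then show ?thesis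
  proof cases
    case 1
    then have "G k l = G i j" by (auto intro: G_sym)
    then show ?thesis using 1 E_A4[of i j] ij by (simp add: D_iff power4_eq_xxxx power2_eq_square mult_ac)
  next
    case 2 then show ?thesis using E_B4[of j l i] ij kl by (auto simp: D_iff G_sym[of i])
  next
    case 3 then show ?thesis using E_B4[of i l j] ij kl by (auto simp: D_iff G_sym[of j l])
  next
    case 4 then show ?thesis using E_B4[of j k i] ij kl by (auto simp: D_iff G_sym[of i j])
  next
    case 5 then show ?thesis using E_B4[of i k j] ij kl by (auto simp: D_iff)
  next
    case 6 then show ?thesis using E_indep[of i j k l] ij kl by (auto simp: D_iff)
  qed
qed

lemma card_D_le: "card D \<le> card I ^ 2"
proof -
  have "card D \<le> card (I \<times> I)"
    using fin by (intro card_mono) (auto simp: D_def)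
  then show ?thesis by (simp only: card_cartesian_product power2_eq_square)
qed

lemma sum_E_sq_sq_le:
  assumes "(i, j) \<in> D"
  shows "(\<Sum>q\<in>D. if q = (i, j) \<or> q = (j, i) then A4 else 0) \<le> 2 * A4"
    and "(\<Sum>q\<in>D. if fst q \<in> {i, j} \<or> snd q \<in> {i, j} then B4 else 0) \<le> 4 * real (card I) * B4"
proof -
  have "finite {(i, j), (j, i)}" "{q \<in> D. q = (i, j) \<or> q = (j, i)} \<subseteq> {(i, j), (j, i)}"
    by auto
  from sum_if_le[OF finD this card_pair_le A4_nonneg]
  show "(\<Sum>q\<in>D. if q = (i, j) \<or> q = (j, i) then A4 else 0) \<le> 2 * A4"
    by (simp only: of_nat_numeral)
  let ?X = "({i, j} \<times> I) \<union> (I \<times> {i, j})"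
  have "card ?X \<le> card ({i, j} \<times> I) + card (I \<times> {i, j})" by (rule card_Un_le)
  also have "\<dots> = 2 * card {i, j} * card I"
    unfolding card_cartesian_product by simp
  also have "\<dots> \<le> 4 * card I" using card_pair_le[of i j] by (intro mult_le_mono1) linarith
  finally have c: "card ?X \<le> 4 * card I" .
  have X: "finite ?X" "{q \<in> D. fst q \<in> {i, j} \<or> snd q \<in> {i, j}} \<subseteq> ?X"
    using fin by (auto simp: D_def mem_Times_iff)
  show "(\<Sum>q\<in>D. if fst q \<in> {i, j} \<or> snd q \<in> {i, j} then B4 else 0) \<le> 4 * real (card I) * B4"
    using sum_if_le[OF finD X c B4_nonneg] by (simp only: of_nat_mult of_nat_numeral)
qed

text \<open>Centred squares at disjoint pairs are uncorrelated, so only overlapping pairs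
  contribute. For a given pair these are its two orders, each costing \<open>A4\<close>, and at most
  \<open>4 * card I\<close> pairs that share an index, each costing \<open>B4\<close>. The
  \<open>- 1\<close> of a covariance is dropped in these cases; the nonnegative weights make this an
  upper bound.\<close>

lemma square_second_moment:
  fixes v :: "'i \<Rightarrow> 'i \<Rightarrow> real"
  assumes v: "\<And>i j. 0 \<le> v i j" "\<And>i j. v i j \<le> \<nu>"
  shows "(\<integral>x. (\<Sum>(i, j)\<in>D. v i j * ((G i j x)\<^sup>2 - 1))\<^sup>2 \<partial>P) \<le>
      \<nu>\<^sup>2 * (real (card I))\<^sup>2 * (2 * A4 + 4 * real (card I) * B4)"
    and "integrable P (\<lambda>x. (\<Sum>(i, j)\<in>D. v i j * ((G i j x)\<^sup>2 - 1))\<^sup>2)"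
proof -
  let ?f = "\<lambda>p x. v (fst p) (snd p) * ((G (fst p) (snd p) x)\<^sup>2 - 1)"
  have i: "integrable P (\<lambda>x. ((G i j x)\<^sup>2 - 1) * ((G k l x)\<^sup>2 - 1))"
    and e: "(\<integral>x. ((G i j x)\<^sup>2 - 1) * ((G k l x)\<^sup>2 - 1) \<partial>P) = (\<integral>x. (G i j x)\<^sup>2 * (G k l x)\<^sup>2 \<partial>P) - 1"
    if "(i, j) \<in> D" "(k, l) \<in> D" for i j k l
    using that integrable_sq_sq[OF that] integrable_sq[OF that(1)] integrable_sq[OF that(2)] E_unit[of i j] E_unit[of k l]
    by (simp_all add: left_diff_distrib right_diff_distrib D_iff PP.prob_space)
  have i': "integrable P (\<lambda>x. ?f p x * ?f q x)" if "p \<in> D" "q \<in> D" for p q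
    using integrable_mult_right[OF i[of "fst p" "snd p" "fst q" "snd q"], of "v (fst p) (snd p) * v (fst q) (snd q)"] that
    by (simp add: mult_ac)
  show "integrable P (\<lambda>x. (\<Sum>(i, j)\<in>D. v i j * ((G i j x)\<^sup>2 - 1))\<^sup>2)"
    using PP.expectation_square_sum(2)[OF finD i'] by (simp add: case_prod_unfold)
  have \<nu>: "0 \<le> \<nu>" using v[of undefined undefined] by linarith
  have "(\<integral>x. (\<Sum>(i, j)\<in>D. v i j * ((G i j x)\<^sup>2 - 1))\<^sup>2 \<partial>P) = (\<Sum>p\<in>D. \<Sum>q\<in>D. \<integral>x. ?f p x * ?f q x \<partial>P)"
    using PP.expectation_square_sum(1)[OF finD i'] by (simp add: case_prod_unfold)
  also have "\<dots> \<le> (\<Sum>p\<in>D. \<nu>\<^sup>2 * (2 * A4 + 4 * real (card I) * B4))"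
  proof (rule sum_mono)
    fix p assume p: "p \<in> D"
    obtain i j where ij: "p = (i, j)" by (cases p)
    have "(\<Sum>q\<in>D. \<integral>x. ?f p x * ?f q x \<partial>P) \<le> (\<Sum>q\<in>D. \<nu>\<^sup>2 * ((if q = (i, j) \<or> q = (j, i) then A4 else 0) +
        (if fst q \<in> {i, j} \<or> snd q \<in> {i, j} then B4 else 0)))"
    proof (rule sum_mono)
      fix q assume q: "q \<in> D"
      obtain k l where kl: "q = (k, l)" by (cases q)
      have "(\<integral>x. ?f p x * ?f q x \<partial>P) =
          (\<integral>x. (v i j * v k l) * (((G i j x)\<^sup>2 - 1) * ((G k l x)\<^sup>2 - 1)) \<partial>P)"
        by (simp add: ij kl mult_ac)
      also have "\<dots> = v i j * v k l * ((\<integral>x. (G i j x)\<^sup>2 * (G k l x)\<^sup>2 \<partial>P) - 1)"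
        using e p q by (simp add: ij kl)
      also have "\<dots> \<le> v i j * v k l * ((if q = (i, j) \<or> q = (j, i) then A4 else 0) +
        (if fst q \<in> {i, j} \<or> snd q \<in> {i, j} then B4 else 0))"
        using E_sq_sq[of i j k l] p q A4_nonneg B4_nonneg v(1)
        by (intro mult_left_mono) (auto simp: ij kl split: if_splits)
      also have "\<dots> \<le> \<nu>\<^sup>2 * ((if q = (i, j) \<or> q = (j, i) then A4 else 0) +
        (if fst q \<in> {i, j} \<or> snd q \<in> {i, j} then B4 else 0))"
        using v \<nu> A4_nonneg B4_nonneg unfolding power2_eq_square
        by (intro mult_right_mono mult_mono) auto
      finally show "(\<integral>x. ?f p x * ?f q x \<partial>P) \<le> \<nu>\<^sup>2 * ((if q = (i, j) \<or> q = (j, i) then A4 else 0) +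
        (if fst q \<in> {i, j} \<or> snd q \<in> {i, j} then B4 else 0))" .
    qed
    also have "\<dots> \<le> \<nu>\<^sup>2 * (2 * A4 + 4 * real (card I) * B4)"
      unfolding sum_distrib_left[symmetric] sum.distrib
      using sum_E_sq_sq_le p ij by (intro mult_left_mono add_mono) auto
    finally show "(\<Sum>q\<in>D. \<integral>x. ?f p x * ?f q x \<partial>P) \<le> \<nu>\<^sup>2 * (2 * A4 + 4 * real (card I) * B4)" .
  qed
  also have "\<dots> = real (card D) * (\<nu>\<^sup>2 * (2 * A4 + 4 * real (card I) * B4))" by simp
  also have "\<dots> \<le> (real (card I))\<^sup>2 * (\<nu>\<^sup>2 * (2 * A4 + 4 * real (card I) * B4))"
  proof (rule mult_right_mono)
    show "real (card D) \<le> (real (card I))\<^sup>2"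
      using card_D_le by (metis of_nat_le_iff of_nat_power)
  qed (use A4_nonneg B4_nonneg in auto)
  also have "\<dots> = \<nu>\<^sup>2 * (real (card I))\<^sup>2 * (2 * A4 + 4 * real (card I) * B4)"
    by (rule mult_swap)
  finally show "(\<integral>x. (\<Sum>(i, j)\<in>D. v i j * ((G i j x)\<^sup>2 - 1))\<^sup>2 \<partial>P) \<le>
      \<nu>\<^sup>2 * (real (card I))\<^sup>2 * (2 * A4 + 4 * real (card I) * B4)" .
qed

end

section \<open>Products of kernel values sharing an index, and fourth moments\<close>

context degenerate_kernel
begin

text \<open>Read the four factors as edges between indices. If the two triples have the same
  vertices, the product is bounded by the mean of two squares, each with expectation
  \<open>B4\<close>. Otherwise either some vertex has degree one, and integrating it out gives zero,
  or the edges form the four-cycle \<open>i\<close>, \<open>j\<close>, \<open>i'\<close>,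
  \<open>k\<close>, whose expectation is \<open>C4\<close>.\<close>

lemma E_T_le:
  assumes t: "distinct [i, j, k]" "{i, j, k} \<subseteq> I" and t': "distinct [i', j', k']" "{i', j', k'} \<subseteq> I"
  shows "\<bar>\<integral>x. G i j x * G i k x * (G i' j' x * G i' k' x) \<partial>P\<bar> \<le>
    (if i' \<noteq> i \<and> ((j', k') = (j, k) \<or> (j', k') = (k, j)) then \<bar>C4\<bar> else 0) +
    (if (i', j', k') \<in> {i, j, k} \<times> {i, j, k} \<times> {i, j, k} then B4 else 0)"
proof -
  let ?E = "\<integral>x. G i j x * G i k x * (G i' j' x * G i' k' x) \<partial>P"
  have D: "(i, j) \<in> D" "(i, k) \<in> D" "(i', j') \<in> D" "(i', k') \<in> D"
    "(j, i) \<in> D" "(k, i) \<in> D" "(j', i') \<in> D" "(k', i') \<in> D"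
    using t t' by (auto simp: D_iff)
  have int: "integrable P (\<lambda>x. G i j x * G i k x * (G i' j' x * G i' k' x))"
    using integrable_G4[OF D(1-4)] by (simp add: mult.assoc)
  let ?a = "if i' \<noteq> i \<and> ((j', k') = (j, k) \<or> (j', k') = (k, j)) then \<bar>C4\<bar> else 0"
  let ?b = "if (i', j', k') \<in> {i, j, k} \<times> {i, j, k} \<times> {i, j, k} then B4 else 0"
  have ab: "0 \<le> ?a" "0 \<le> ?b" using B4_nonneg by simp_all
  then have zero: "?E = 0 \<Longrightarrow> \<bar>?E\<bar> \<le> ?a + ?b" by linarith
  \<comment> \<open>Exhaustive: if the second triple leaves \<open>{i, j, k}\<close> while
    \<open>j'\<close> and \<open>k'\<close> stay inside, then \<open>i'\<close> is the new vertex.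
    If moreover \<open>j\<close> and \<open>k\<close> occur in the second triple, they can only be
    \<open>j'\<close> and \<open>k'\<close> in some order.\<close>
  consider "{i', j', k'} \<subseteq> {i, j, k}"
    | "\<not> {i', j', k'} \<subseteq> {i, j, k}" "(j', k') = (j, k) \<or> (j', k') = (k, j)"
    | "j' \<notin> {i, j, k}" | "k' \<notin> {i, j, k}"
    | "\<not> {i', j', k'} \<subseteq> {i, j, k}" "j \<notin> {i', j', k'}" | "\<not> {i', j', k'} \<subseteq> {i, j, k}" "k \<notin> {i', j', k'}"
    using t t' by auto
  then show ?thesis
  proof cases
    case 1
    let ?J = "\<integral>x. ((G i j x)\<^sup>2 * (G i k x)\<^sup>2 + (G i' j' x)\<^sup>2 * (G i' k' x)\<^sup>2) / 2 \<partial>P"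
    have le: "\<bar>?E\<bar> \<le> (\<integral>x. ((G i j x)\<^sup>2 * (G i k x)\<^sup>2 + (G i' j' x)\<^sup>2 * (G i' k' x)\<^sup>2) / 2 \<partial>P)"
      unfolding real_norm_def[symmetric]
    proof (rule norm_integral_le[OF int])
      show "integrable P (\<lambda>x. ((G i j x)\<^sup>2 * (G i k x)\<^sup>2 + (G i' j' x)\<^sup>2 * (G i' k' x)\<^sup>2) / 2)"
        using integrable_sq_sq D by auto
      fix x
      have "2 * (\<bar>G i j x * G i k x\<bar> * \<bar>G i' j' x * G i' k' x\<bar>) \<le>
          (G i j x * G i k x)\<^sup>2 + (G i' j' x * G i' k' x)\<^sup>2"
        using sum_squares_bound[of "\<bar>G i j x * G i k x\<bar>" "\<bar>G i' j' x * G i' k' x\<bar>"]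
        by (simp only: power2_abs mult.assoc)
      then show "norm (G i j x * G i k x * (G i' j' x * G i' k' x)) \<le>
          ((G i j x)\<^sup>2 * (G i k x)\<^sup>2 + (G i' j' x)\<^sup>2 * (G i' k' x)\<^sup>2) / 2"
        by (simp add: power_mult_distrib abs_mult mult_ac)
    qed
    have eq: "?J = B4"
    proof -
      have "(\<integral>x. (G j i x)\<^sup>2 * (G k i x)\<^sup>2 \<partial>P) = B4" using t by (intro E_B4) auto
      moreover have "(\<integral>x. (G j' i' x)\<^sup>2 * (G k' i' x)\<^sup>2 \<partial>P) = B4" using t' by (intro E_B4) auto
      ultimately show ?thesis
        using integrable_sq_sq[OF D(1,2)] integrable_sq_sq[OF D(3,4)]
        by (simp only: G_sym[of j i] G_sym[of k i] G_sym[of j' i'] G_sym[of k' i']) simp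
    qed
    have "?b = B4" using 1 unfolding insert_subset by (elim conjE, intro if_P SigmaI)
    with le eq ab show ?thesis by linarith
  next
    case 2
    have "?E = (\<integral>x. G j i x * G k i x * G j i' x * G k i' x \<partial>P)"
      using 2 unfolding G_sym[of j i] G_sym[of k i] G_sym[of j i'] G_sym[of k i'] by (auto simp: mult_ac)
    also have "\<dots> = C4" using 2 t t' by (intro E_C4) auto
    finally have "\<bar>?E\<bar> = \<bar>C4\<bar>" by simp
    also have "\<dots> = ?a" using 2 by (intro if_P[symmetric]) auto
    finally show ?thesis using ab by linarith
  next
    case 3
    have "(\<integral>x. G j' i' x * (G i j x * G i k x * G i' k' x) \<partial>P) = 0"
      using 3 t' int by (intro E_zero D) (auto simp: G_upd G_sym[of j' i'] mult_ac)
    then have "?E = 0" by (simp add: G_sym[of j' i'] mult_ac)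
    then show ?thesis by (rule zero)
  next
    case 4
    have "(\<integral>x. G k' i' x * (G i j x * G i k x * G i' j' x) \<partial>P) = 0"
      using 4 t' int by (intro E_zero D) (auto simp: G_upd G_sym[of k' i'] mult_ac)
    then have "?E = 0" by (simp add: G_sym[of k' i'] mult_ac)
    then show ?thesis by (rule zero)
  next
    case 5
    have "(\<integral>x. G j i x * (G i k x * G i' j' x * G i' k' x) \<partial>P) = 0"
      using 5 t int by (intro E_zero D) (auto simp: G_upd G_sym[of j i] mult_ac)
    then have "?E = 0" by (simp add: G_sym[of j i] mult_ac)
    then show ?thesis by (rule zero)
  next
    case 6
    have "(\<integral>x. G k i x * (G i j x * G i' j' x * G i' k' x) \<partial>P) = 0"
      using 6 t int by (intro E_zero D) (auto simp: G_upd G_sym[of k i] mult_ac)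
    then have "?E = 0" by (simp add: G_sym[of k i] mult_ac)
    then show ?thesis by (rule zero)
  qed
qed

definition Tr :: "('i \<times> 'i \<times> 'i) set" where
  "Tr = {(i, j, k). {i, j, k} \<subseteq> I \<and> distinct [i, j, k]}"

lemma finTr[simp]: "finite Tr"
  by (rule finite_subset[of _ "I \<times> I \<times> I"]) (use fin in \<open>auto simp: Tr_def\<close>)

lemma card_Tr_le: "card Tr \<le> card I ^ 3"
proof -
  have "card Tr \<le> card (I \<times> I \<times> I)" using fin by (intro card_mono) (auto simp: Tr_def)
  then show ?thesis by (simp only: card_cartesian_product power3_eq_cube mult.assoc)
qed

definition TG :: "('i \<Rightarrow> 'i \<Rightarrow> real) \<Rightarrow> 'i \<times> 'i \<times> 'i \<Rightarrow> ('i \<Rightarrow> 'a) \<Rightarrow> real" where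
  "TG w t x = (case t of (i, j, k) \<Rightarrow> w i j * w i k * (G i j x * G i k x))"

lemma integrable_TG: "s \<in> Tr \<Longrightarrow> t \<in> Tr \<Longrightarrow> integrable P (\<lambda>x. TG w s x * TG w t x)"
proof -
  assume s: "s \<in> Tr" and t: "t \<in> Tr"
  obtain i j k i' j' k' where e: "s = (i, j, k)" "t = (i', j', k')" by (cases s, cases t)
  have "integrable P (\<lambda>x. (w i j * w i k * w i' j' * w i' k') * (G i j x * G i k x * G i' j' x * G i' k' x))"
    using s t by (intro integrable_mult_right integrable_G4) (auto simp: e Tr_def D_iff)
  then show ?thesis by (simp add: TG_def e mult_ac)
qed

lemma E_TG_le:
  assumes w: "\<And>i j. \<bar>w i j\<bar> \<le> \<kappa>" and st: "(i, j, k) \<in> Tr" "t \<in> Tr"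
  shows "(\<integral>x. TG w (i, j, k) x * TG w t x \<partial>P) \<le>
    \<kappa> ^ 4 * ((if fst t \<noteq> i \<and> (snd t = (j, k) \<or> snd t = (k, j)) then \<bar>C4\<bar> else 0) +
      (if t \<in> {i, j, k} \<times> {i, j, k} \<times> {i, j, k} then B4 else 0))"
    (is "_ \<le> \<kappa> ^ 4 * ?b")
proof -
  have \<kappa>: "0 \<le> \<kappa>" using w[of undefined undefined] by linarith
  obtain i' j' k' where e: "t = (i', j', k')" by (cases t)
  let ?E = "\<integral>x. G i j x * G i k x * (G i' j' x * G i' k' x) \<partial>P"
  let ?w = "w i j * w i k * (w i' j' * w i' k')"
  have "(\<integral>x. TG w (i, j, k) x * TG w t x \<partial>P) =
      (\<integral>x. ?w * (G i j x * G i k x * (G i' j' x * G i' k' x)) \<partial>P)"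
    by (simp add: TG_def e mult_ac)
  also have "\<dots> = ?w * ?E" by (rule integral_mult_right_zero)
  also have "\<dots> \<le> \<bar>?w\<bar> * \<bar>?E\<bar>" unfolding abs_mult[symmetric] by (rule abs_ge_self)
  also have "\<dots> \<le> \<kappa> ^ 4 * ?b"
  proof (rule mult_mono)
    have "\<bar>?w\<bar> \<le> \<kappa> * \<kappa> * (\<kappa> * \<kappa>)"
      unfolding abs_mult using w \<kappa> by (intro mult_mono) auto
    then show "\<bar>?w\<bar> \<le> \<kappa> ^ 4" by (simp add: power4_eq_xxxx mult_ac)
    show "\<bar>?E\<bar> \<le> ?b"
      unfolding e fst_conv snd_conv by (rule E_T_le) (use st in \<open>auto simp: Tr_def e\<close>)
  qed (use \<kappa> in auto)
  finally show ?thesis .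
qed

text \<open>For a fixed triple, a partner forming a four-cycle is determined by its centre and the
  order of the common pair, hence \<open>2 * card I\<close>. Partners with the same vertices are
  counted generously by all 27 triples over three letters. Each of these partners costs one factor
  \<open>\<kappa> ^ 4\<close> from the weights.\<close>

lemma triple_second_moment:
  assumes w: "\<And>i j. \<bar>w i j\<bar> \<le> \<kappa>"
  shows "(\<integral>x. (\<Sum>t\<in>Tr. TG w t x)\<^sup>2 \<partial>P) \<le>
      \<kappa> ^ 4 * (real (card I)) ^ 3 * (2 * real (card I) * \<bar>C4\<bar> + 27 * B4)"
    and "integrable P (\<lambda>x. (\<Sum>t\<in>Tr. TG w t x)\<^sup>2)"
proof -
  have \<kappa>: "0 \<le> \<kappa>" using w[of undefined undefined] by linarith
  show "integrable P (\<lambda>x. (\<Sum>t\<in>Tr. TG w t x)\<^sup>2)"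
    by (rule PP.expectation_square_sum(2)) (auto intro: integrable_TG)
  have "(\<integral>x. (\<Sum>t\<in>Tr. TG w t x)\<^sup>2 \<partial>P) = (\<Sum>s\<in>Tr. \<Sum>t\<in>Tr. \<integral>x. TG w s x * TG w t x \<partial>P)"
    by (rule PP.expectation_square_sum(1)) (auto intro: integrable_TG)
  also have "\<dots> \<le> (\<Sum>s\<in>Tr. \<kappa> ^ 4 * (2 * real (card I) * \<bar>C4\<bar> + 27 * B4))"
  proof (rule sum_mono)
    fix s assume s: "s \<in> Tr"
    obtain i j k where e: "s = (i, j, k)" by (cases s)
    have "(\<Sum>t\<in>Tr. \<integral>x. TG w s x * TG w t x \<partial>P) \<le>
      (\<Sum>t\<in>Tr. \<kappa> ^ 4 * ((if fst t \<noteq> i \<and> (snd t = (j, k) \<or> snd t = (k, j)) then \<bar>C4\<bar> else 0) +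
      (if t \<in> {i, j, k} \<times> {i, j, k} \<times> {i, j, k} then B4 else 0)))"
      using E_TG_le[OF w] s by (intro sum_mono) (simp add: e)
    also have "\<dots> = \<kappa> ^ 4 * ((\<Sum>t\<in>Tr. if fst t \<noteq> i \<and> (snd t = (j, k) \<or> snd t = (k, j)) then \<bar>C4\<bar> else 0) +
      (\<Sum>t\<in>Tr. if t \<in> {i, j, k} \<times> {i, j, k} \<times> {i, j, k} then B4 else 0))"
      by (simp only: sum_distrib_left[symmetric] sum.distrib)
    also have "\<dots> \<le> \<kappa> ^ 4 * (real (2 * card I) * \<bar>C4\<bar> + real 27 * B4)"
    proof (intro mult_left_mono add_mono)
      show "(\<Sum>t\<in>Tr. if fst t \<noteq> i \<and> (snd t = (j, k) \<or> snd t = (k, j)) then \<bar>C4\<bar> else 0) \<le> real (2 * card I) * \<bar>C4\<bar>"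
      proof (rule sum_if_le[OF finTr])
        show "card (I \<times> {(j, k), (k, j)}) \<le> 2 * card I"
          using card_pair_le[of "(j, k)" "(k, j)"] unfolding card_cartesian_product
          by (subst mult.commute) (rule mult_le_mono1)
      qed (use fin in \<open>auto simp: Tr_def\<close>)
      have "card ({i, j, k} \<times> {i, j, k} \<times> {i, j, k}) \<le> 3 * (3 * 3)"
        unfolding card_cartesian_product by (intro mult_le_mono card_triple_le)
      then show "(\<Sum>t\<in>Tr. if t \<in> {i, j, k} \<times> {i, j, k} \<times> {i, j, k} then B4 else 0) \<le> real 27 * B4"
        using B4_nonneg by (intro sum_if_le[of Tr "{i, j, k} \<times> {i, j, k} \<times> {i, j, k}"]) auto
    qed (use \<kappa> in auto)
    finally show "(\<Sum>t\<in>Tr. \<integral>x. TG w s x * TG w t x \<partial>P) \<le> \<kappa> ^ 4 * (2 * real (card I) * \<bar>C4\<bar> + 27 * B4)"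
      by simp
  qed
  also have "\<dots> = real (card Tr) * (\<kappa> ^ 4 * (2 * real (card I) * \<bar>C4\<bar> + 27 * B4))" by simp
  also have "\<dots> \<le> (real (card I)) ^ 3 * (\<kappa> ^ 4 * (2 * real (card I) * \<bar>C4\<bar> + 27 * B4))"
    using card_Tr_le B4_nonneg \<kappa> by (intro mult_right_mono) (simp_all flip: of_nat_power)
  finally show "(\<integral>x. (\<Sum>t\<in>Tr. TG w t x)\<^sup>2 \<partial>P) \<le>
      \<kappa> ^ 4 * (real (card I)) ^ 3 * (2 * real (card I) * \<bar>C4\<bar> + 27 * B4)" by (simp add: mult_ac)
qed

definition Yw :: "('i \<Rightarrow> 'i \<Rightarrow> real) \<Rightarrow> 'i \<Rightarrow> ('i \<Rightarrow> 'a) \<Rightarrow> real" where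
  "Yw w i x = (\<Sum>j\<in>I - {i}. w i j * G i j x)"

definition pairs :: "'i \<Rightarrow> ('i \<times> 'i) set" where
  "pairs i = {(j, k). (i, j, k) \<in> Tr}"

lemma finpairs[simp]: "finite (pairs i)"
  by (rule finite_subset[of _ "I \<times> I"]) (use fin in \<open>auto simp: Tr_def pairs_def\<close>)

lemma card_pairs_le: "card (pairs i) \<le> card I ^ 2"
proof -
  have "card (pairs i) \<le> card (I \<times> I)" using fin by (intro card_mono) (auto simp: Tr_def pairs_def)
  then show ?thesis by (simp only: card_cartesian_product power2_eq_square)
qed

lemma Yw_square:
  assumes "i \<in> I"
  shows "(Yw w i x)\<^sup>2 = (\<Sum>j\<in>I - {i}. (w i j)\<^sup>2 * (G i j x)\<^sup>2) + (\<Sum>q\<in>pairs i. TG w (i, q) x)"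
proof -
  have "(Yw w i x)\<^sup>2 = (\<Sum>j\<in>I - {i}. \<Sum>k\<in>I - {i}. w i j * G i j x * (w i k * G i k x))"
    by (simp add: Yw_def power2_eq_square sum_product)
  also have "\<dots> = (\<Sum>j\<in>I - {i}. (w i j * G i j x)\<^sup>2 + (\<Sum>k\<in>I - {i} - {j}. w i j * G i j x * (w i k * G i k x)))"
    using fin by (intro sum.cong refl) (simp add: sum.remove power2_eq_square)
  also have "\<dots> = (\<Sum>j\<in>I - {i}. (w i j)\<^sup>2 * (G i j x)\<^sup>2) +
      (\<Sum>j\<in>I - {i}. \<Sum>k\<in>I - {i} - {j}. w i j * G i j x * (w i k * G i k x))"
    by (simp add: sum.distrib power_mult_distrib)
  also have "(\<Sum>j\<in>I - {i}. \<Sum>k\<in>I - {i} - {j}. w i j * G i j x * (w i k * G i k x)) =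
      (\<Sum>q\<in>(SIGMA j:I - {i}. I - {i} - {j}). TG w (i, q) x)"
    using fin by (simp add: sum.Sigma TG_def case_prod_unfold mult_ac)
  also have "(SIGMA j:I - {i}. I - {i} - {j}) = pairs i"
    using assms by (auto simp: pairs_def Tr_def)
  finally show ?thesis .
qed

lemma sum_D: "(\<Sum>p\<in>D. f p) = (\<Sum>i\<in>I. \<Sum>j\<in>I - {i}. f (i, j))"
proof -
  have "D = (SIGMA i:I. I - {i})" by (auto simp: D_def)
  then show ?thesis using fin by (simp add: sum.Sigma)
qed

lemma sum_Tr: "(\<Sum>t\<in>Tr. f t) = (\<Sum>i\<in>I. \<Sum>q\<in>pairs i. f (i, q))"
proof -
  have "Tr = (SIGMA i:I. pairs i)" by (auto simp: Tr_def pairs_def)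
  then show ?thesis using fin by (simp add: sum.Sigma)
qed

text \<open>Expanding the squares leaves a diagonal part and products at two different partners of
  the same index. The normalisation of \<open>w\<close> is exactly what centres the diagonal part,
  so each part has its own second-moment bound above.\<close>

lemma sum_Yw_square:
  assumes w: "(\<Sum>(i, j)\<in>D. (w i j)\<^sup>2) = 2"
  shows "(\<Sum>i\<in>I. (Yw w i x)\<^sup>2) - 2 =
    (\<Sum>(i, j)\<in>D. (w i j)\<^sup>2 * ((G i j x)\<^sup>2 - 1)) + (\<Sum>t\<in>Tr. TG w t x)"
proof -
  have 1: "(\<Sum>i\<in>I. (Yw w i x)\<^sup>2) = (\<Sum>(i, j)\<in>D. (w i j)\<^sup>2 * (G i j x)\<^sup>2) + (\<Sum>t\<in>Tr. TG w t x)"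
    by (simp add: Yw_square sum.distrib sum_D sum_Tr)
  have 2: "(\<Sum>(i, j)\<in>D. (w i j)\<^sup>2 * (G i j x)\<^sup>2) - 2 = (\<Sum>(i, j)\<in>D. (w i j)\<^sup>2 * ((G i j x)\<^sup>2 - 1))"
    unfolding w[symmetric] by (simp add: case_prod_unfold right_diff_distrib sum_subtractf)
  show ?thesis unfolding 1 2[symmetric] by simp
qed

lemma Yw_measurable[measurable]: "i \<in> I \<Longrightarrow> Yw w i \<in> borel_measurable P"
  unfolding Yw_def[abs_def] by (intro borel_measurable_sum borel_measurable_times G_measurable) auto

text \<open>\<open>(Yw w i x)^2\<close> is a sum of squares plus cross products. Up to
  \<open>\<kappa> ^ 4\<close> their second moments are at most \<open>N * (A4 + N * B4)\<close> and
  \<open>27 * N^2 * B4\<close> with \<open>N = card I\<close>. Doubling both, from the square of a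
  sum, gives the constants 2 and \<open>2 + 54 = 56\<close>.\<close>

lemma fourth_moment_Yw:
  assumes w: "\<And>i j. \<bar>w i j\<bar> \<le> \<kappa>" and i: "i \<in> I"
  shows "(\<integral>x. (Yw w i x) ^ 4 \<partial>P) \<le> \<kappa> ^ 4 * (2 * real (card I) * A4 + 56 * (real (card I))\<^sup>2 * B4)"
    and "integrable P (\<lambda>x. (Yw w i x) ^ 4)"
proof -
  let ?N = "real (card I)"
  have \<kappa>: "0 \<le> \<kappa>" using w[of undefined undefined] by linarith
  let ?A = "\<lambda>x. \<Sum>j\<in>I - {i}. (w i j)\<^sup>2 * (G i j x)\<^sup>2" and ?C = "\<lambda>x. \<Sum>q\<in>pairs i. TG w (i, q) x"
  have iA: "integrable P (\<lambda>x. (?A x)\<^sup>2)"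
    and eA: "(\<integral>x. (?A x)\<^sup>2 \<partial>P) =
      (\<Sum>j\<in>I - {i}. \<Sum>k\<in>I - {i}. \<integral>x. ((w i j)\<^sup>2 * (G i j x)\<^sup>2) * ((w i k)\<^sup>2 * (G i k x)\<^sup>2) \<partial>P)"
  proof -
    have "integrable P (\<lambda>x. ((w i j)\<^sup>2 * (G i j x)\<^sup>2) * ((w i k)\<^sup>2 * (G i k x)\<^sup>2))"
      if "j \<in> I - {i}" "k \<in> I - {i}" for j k
    proof -
      have "(i, j) \<in> D" "(i, k) \<in> D" using that i by (auto simp: D_iff)
      from integrable_mult_right[OF integrable_sq_sq[OF this], of "(w i j)\<^sup>2 * (w i k)\<^sup>2"]
      show ?thesis by (simp only: mult_ac)
    qed
    note a = PP.expectation_square_sum[where f="\<lambda>j x. (w i j)\<^sup>2 * (G i j x)\<^sup>2", OF finite_Diff[OF fin] this]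
    show "integrable P (\<lambda>x. (?A x)\<^sup>2)" by (rule a(2))
    show "(\<integral>x. (?A x)\<^sup>2 \<partial>P) =
      (\<Sum>j\<in>I - {i}. \<Sum>k\<in>I - {i}. \<integral>x. ((w i j)\<^sup>2 * (G i j x)\<^sup>2) * ((w i k)\<^sup>2 * (G i k x)\<^sup>2) \<partial>P)"
      by (rule a(1))
  qed
  have pT: "q \<in> pairs i \<Longrightarrow> (i, q) \<in> Tr" for q by (auto simp: pairs_def)
  have iC: "integrable P (\<lambda>x. (?C x)\<^sup>2)"
    by (rule PP.expectation_square_sum(2)) (auto intro!: integrable_TG pT)
  have eC: "(\<integral>x. (?C x)\<^sup>2 \<partial>P) = (\<Sum>q\<in>pairs i. \<Sum>r\<in>pairs i. \<integral>x. TG w (i, q) x * TG w (i, r) x \<partial>P)"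
    by (rule PP.expectation_square_sum(1)) (auto intro!: integrable_TG pT)
  have y4: "(Yw w i x) ^ 4 = (?A x + ?C x)\<^sup>2" for x
    unfolding Yw_square[OF i, of w x, symmetric] by (simp flip: power_mult)
  have y4': "(Yw w i x) ^ 4 \<le> 2 * (?A x)\<^sup>2 + 2 * (?C x)\<^sup>2" for x
    unfolding y4 using sum_squares_bound[of "?A x" "?C x"] by (simp add: power2_sum)
  have ib: "integrable P (\<lambda>x. 2 * (?A x)\<^sup>2 + 2 * (?C x)\<^sup>2)"
    using iA iC by auto
  show iY: "integrable P (\<lambda>x. (Yw w i x) ^ 4)"
    by (rule Bochner_Integration.integrable_bound[OF ib]) (use i y4' in \<open>auto intro!: AE_I2\<close>)
  have "(\<integral>x. (?A x)\<^sup>2 \<partial>P) \<le> (\<Sum>j\<in>I - {i}. \<kappa> ^ 4 * (A4 + ?N * B4))"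
    unfolding eA
  proof (rule sum_mono)
    fix j assume j: "j \<in> I - {i}"
    have "(\<Sum>k\<in>I - {i}. \<integral>x. ((w i j)\<^sup>2 * (G i j x)\<^sup>2) * ((w i k)\<^sup>2 * (G i k x)\<^sup>2) \<partial>P) \<le>
        (\<Sum>k\<in>I - {i}. \<kappa> ^ 4 * ((if k = j then A4 else 0) + B4))"
    proof (rule sum_mono)
      fix k assume k: "k \<in> I - {i}"
      have "(\<integral>x. ((w i j)\<^sup>2 * (G i j x)\<^sup>2) * ((w i k)\<^sup>2 * (G i k x)\<^sup>2) \<partial>P) =
          (\<integral>x. ((w i j)\<^sup>2 * (w i k)\<^sup>2) * ((G i j x)\<^sup>2 * (G i k x)\<^sup>2) \<partial>P)" by (simp add: mult_ac)
      also have "\<dots> = (w i j)\<^sup>2 * (w i k)\<^sup>2 * (\<integral>x. (G i j x)\<^sup>2 * (G i k x)\<^sup>2 \<partial>P)"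
        by (rule integral_mult_right_zero)
      also have "\<dots> \<le> \<kappa> ^ 4 * ((if k = j then A4 else 0) + B4)"
      proof (rule mult_mono)
        have "(w i j)\<^sup>2 \<le> \<kappa>\<^sup>2" for j using w[of i j] \<kappa> by (metis abs_of_nonneg abs_le_square_iff)
        then have "(w i j)\<^sup>2 * (w i k)\<^sup>2 \<le> \<kappa>\<^sup>2 * \<kappa>\<^sup>2" by (intro mult_mono) auto
        then show "(w i j)\<^sup>2 * (w i k)\<^sup>2 \<le> \<kappa> ^ 4" by (simp flip: power_add)
        show "(\<integral>x. (G i j x)\<^sup>2 * (G i k x)\<^sup>2 \<partial>P) \<le> (if k = j then A4 else 0) + B4"
          using E_sq_sq[of i j i k] j k i A4_nonneg B4_nonneg by (auto simp: D_iff split: if_splits)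
      qed (use \<kappa> in \<open>auto intro!: Bochner_Integration.integral_nonneg\<close>)
      finally show "(\<integral>x. ((w i j)\<^sup>2 * (G i j x)\<^sup>2) * ((w i k)\<^sup>2 * (G i k x)\<^sup>2) \<partial>P) \<le>
          \<kappa> ^ 4 * ((if k = j then A4 else 0) + B4)" .
    qed
    also have "\<dots> = \<kappa> ^ 4 * (A4 + real (card (I - {i})) * B4)"
      unfolding sum_distrib_left[symmetric] using j fin by (simp add: sum.distrib)
    also have "\<dots> \<le> \<kappa> ^ 4 * (A4 + ?N * B4)"
      using \<kappa> B4_nonneg fin by (intro mult_left_mono add_left_mono mult_right_mono) (auto intro: card_mono)
    finally show "(\<Sum>k\<in>I - {i}. \<integral>x. ((w i j)\<^sup>2 * (G i j x)\<^sup>2) * ((w i k)\<^sup>2 * (G i k x)\<^sup>2) \<partial>P) \<le>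
        \<kappa> ^ 4 * (A4 + ?N * B4)" .
  qed
  also have "\<dots> = real (card (I - {i})) * (\<kappa> ^ 4 * (A4 + ?N * B4))" by simp
  also have "\<dots> \<le> ?N * (\<kappa> ^ 4 * (A4 + ?N * B4))"
    using \<kappa> A4_nonneg B4_nonneg fin by (intro mult_right_mono) (auto intro: card_mono)
  finally have A: "(\<integral>x. (?A x)\<^sup>2 \<partial>P) \<le> ?N * (\<kappa> ^ 4 * (A4 + ?N * B4))" .
  have "(\<integral>x. (?C x)\<^sup>2 \<partial>P) \<le> (\<Sum>q\<in>pairs i. \<kappa> ^ 4 * (27 * B4))"
    unfolding eC
  proof (rule sum_mono)
    fix q assume q: "q \<in> pairs i"
    obtain j k where jk: "q = (j, k)" by (cases q)
    have "(\<Sum>r\<in>pairs i. \<integral>x. TG w (i, q) x * TG w (i, r) x \<partial>P) \<le>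
        (\<Sum>r\<in>pairs i. \<kappa> ^ 4 * (if (i, r) \<in> {i, j, k} \<times> {i, j, k} \<times> {i, j, k} then B4 else 0))"
    proof (rule sum_mono)
      fix r assume r: "r \<in> pairs i"
      \<comment> \<open>Both triples have the same centre \<open>i\<close>, so a four-cycle is
        impossible and the \<open>C4\<close> term of the bound is absent.\<close>
      from E_TG_le[OF w pT[OF q, unfolded jk] pT[OF r]]
      show "(\<integral>x. TG w (i, q) x * TG w (i, r) x \<partial>P) \<le>
          \<kappa> ^ 4 * (if (i, r) \<in> {i, j, k} \<times> {i, j, k} \<times> {i, j, k} then B4 else 0)"
        by (simp only: jk fst_conv simp_thms if_False add_0)
    qed
    also have "\<dots> = \<kappa> ^ 4 * (\<Sum>r\<in>pairs i. if (i, r) \<in> {i, j, k} \<times> {i, j, k} \<times> {i, j, k} then B4 else 0)"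
      by (simp only: sum_distrib_left[symmetric])
    also have "\<dots> \<le> \<kappa> ^ 4 * (real 27 * B4)"
    proof (rule mult_left_mono[OF sum_if_le[of _ "{i, j, k} \<times> {i, j, k}"]])
      have "card ({i, j, k} \<times> {i, j, k}) \<le> 3 * 3"
        unfolding card_cartesian_product by (intro mult_le_mono card_triple_le)
      then show "card ({i, j, k} \<times> {i, j, k}) \<le> 27" by linarith
      show "{r \<in> pairs i. (i, r) \<in> {i, j, k} \<times> {i, j, k} \<times> {i, j, k}} \<subseteq> {i, j, k} \<times> {i, j, k}"
        by blast
      show "0 \<le> \<kappa> ^ 4" using \<kappa> by (rule zero_le_power)
    qed (use B4_nonneg in simp_all)
    finally show "(\<Sum>r\<in>pairs i. \<integral>x. TG w (i, q) x * TG w (i, r) x \<partial>P) \<le> \<kappa> ^ 4 * (27 * B4)" by simp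
  qed
  also have "\<dots> = real (card (pairs i)) * (\<kappa> ^ 4 * (27 * B4))" by simp
  also have "\<dots> \<le> ?N\<^sup>2 * (\<kappa> ^ 4 * (27 * B4))"
    using \<kappa> B4_nonneg card_pairs_le by (intro mult_right_mono) (simp_all flip: of_nat_power)
  finally have C: "(\<integral>x. (?C x)\<^sup>2 \<partial>P) \<le> ?N\<^sup>2 * (\<kappa> ^ 4 * (27 * B4))" .
  have "(\<integral>x. (Yw w i x) ^ 4 \<partial>P) \<le> (\<integral>x. 2 * (?A x)\<^sup>2 + 2 * (?C x)\<^sup>2 \<partial>P)"
    using iY ib y4' by (intro integral_mono) auto
  also have "\<dots> = 2 * (\<integral>x. (?A x)\<^sup>2 \<partial>P) + 2 * (\<integral>x. (?C x)\<^sup>2 \<partial>P)"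
    using iA iC by simp
  also have "\<dots> \<le> 2 * (?N * (\<kappa> ^ 4 * (A4 + ?N * B4))) + 2 * (?N\<^sup>2 * (\<kappa> ^ 4 * (27 * B4)))"
    using A C by (intro add_mono mult_left_mono) auto
  also have "\<dots> = \<kappa> ^ 4 * (2 * ?N * A4 + 56 * ?N\<^sup>2 * B4)"
    by (simp add: algebra_simps power2_eq_square)
  finally show "(\<integral>x. (Yw w i x) ^ 4 \<partial>P) \<le> \<kappa> ^ 4 * (2 * ?N * A4 + 56 * ?N\<^sup>2 * B4)" .
qed

end

section \<open>The degenerate quadratic form is asymptotically normal\<close>

text \<open>AM-GM between second and fourth powers, used to bound third moments. For
  \<open>\<eta>\<close> of the size of the error, the second moments with sum about 2 and the fourth
  moments with sum of order \<open>\<eta>^2\<close> both contribute order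
  \<open>\<eta>\<close>.\<close>

lemma abs_cube_le: "0 < \<eta> \<Longrightarrow> \<bar>y\<bar> ^ 3 \<le> (\<eta> * y\<^sup>2 + y ^ 4 / \<eta>) / 2" for y \<eta> :: real
proof -
  assume \<eta>: "0 < \<eta>"
  have "2 * (\<eta> * \<bar>y\<bar>) \<le> \<eta>\<^sup>2 + y\<^sup>2"
    using sum_squares_bound[of \<eta> "\<bar>y\<bar>"] by simp
  then have "y\<^sup>2 * (2 * (\<eta> * \<bar>y\<bar>)) \<le> y\<^sup>2 * (\<eta>\<^sup>2 + y\<^sup>2)" by (intro mult_left_mono) auto
  moreover have "\<bar>y\<bar> ^ 3 = y\<^sup>2 * \<bar>y\<bar>" by (simp add: power3_eq_cube power2_eq_square abs_mult_self_eq)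
  ultimately have "2 * \<eta> * \<bar>y\<bar> ^ 3 \<le> \<eta>\<^sup>2 * y\<^sup>2 + y ^ 4"
    by (simp add: algebra_simps power4_eq_xxxx power2_eq_square)
  then show ?thesis using \<eta> by (simp add: field_simps power2_eq_square)
qed

context degenerate_kernel
begin

definition Ww :: "('i \<Rightarrow> 'i \<Rightarrow> real) \<Rightarrow> ('i \<Rightarrow> 'a) \<Rightarrow> real" where
  "Ww w x = (\<Sum>(i, j)\<in>D. w i j * G i j x) / 2"

lemma Ww_eq: "Ww w x = (\<Sum>i\<in>I. Yw w i x) / 2"
  by (simp add: Ww_def Yw_def sum_D)

lemma G_D_measurable: "p \<in> D \<Longrightarrow> G (fst p) (snd p) \<in> borel_measurable P"
  by (auto simp: D_def)

lemma Ww_measurable[measurable]: "Ww w \<in> borel_measurable P"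
  unfolding Ww_eq[abs_def]
  by (intro borel_measurable_divide borel_measurable_sum borel_measurable_const Yw_measurable)

lemma Ww_second_moment:
  assumes w: "(\<Sum>(i, j)\<in>D. (w i j)\<^sup>2) = 2"
  shows "(\<integral>x. (Ww w x)\<^sup>2 \<partial>P) \<le> 1" "integrable P (\<lambda>x. (Ww w x)\<^sup>2)"
proof -
  have eq: "Ww w x = (\<Sum>(i, j)\<in>D. w i j / 2 * G i j x)" for x
    by (simp add: Ww_def sum_divide_distrib case_prod_unfold)
  have s: "2 * (\<Sum>(i, j)\<in>D. (w i j / 2)\<^sup>2) = 1"
    using w by (simp add: case_prod_unfold power_divide flip: sum_divide_distrib)
  show "(\<integral>x. (Ww w x)\<^sup>2 \<partial>P) \<le> 1" "integrable P (\<lambda>x. (Ww w x)\<^sup>2)"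
    unfolding eq using linear_second_moment[of "\<lambda>i j. w i j / 2"] unfolding s by simp_all
qed

text \<open>Every unordered pair containing \<open>i\<close> occurs twice in \<open>D\<close> and
  the sum is halved, so subtracting \<open>Yw w i\<close> once removes all of them. This is what
  makes the difference independent of coordinate \<open>i\<close>.\<close>

lemma Ww_minus_Yw:
  assumes i: "i \<in> I" and wsym: "\<And>i j. w i j = w j i"
  shows "Ww w x - Yw w i x = (\<Sum>(j, k)\<in>{p\<in>D. fst p \<noteq> i \<and> snd p \<noteq> i}. w j k * G j k x) / 2"
proof -
  let ?D' = "{p\<in>D. fst p \<noteq> i \<and> snd p \<noteq> i}" and ?A = "Pair i ` (I - {i})" and ?B = "(\<lambda>j. (j, i)) ` (I - {i})"
  let ?f = "\<lambda>p. w (fst p) (snd p) * G (fst p) (snd p) x"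
  have D: "D = ?D' \<union> (?A \<union> ?B)" using i by (auto simp: D_def)
  have "sum ?f D = sum ?f ?D' + sum ?f (?A \<union> ?B)"
    by (subst D, rule sum.union_disjoint) (use fin in auto)
  also have "sum ?f (?A \<union> ?B) = sum ?f ?A + sum ?f ?B"
    by (rule sum.union_disjoint) (use fin in auto)
  also have "sum ?f ?A = Yw w i x"
    unfolding Yw_def by (subst sum.reindex) (auto simp: inj_on_def)
  also have "sum ?f ?B = Yw w i x"
    unfolding Yw_def by (subst sum.reindex) (auto simp: inj_on_def wsym[of _ i] G_sym[of _ i])
  finally have "sum ?f D = sum ?f ?D' + (Yw w i x + Yw w i x)" .
  then show ?thesis unfolding Ww_def case_prod_unfold by linarith
qed

lemma E_iexp_Yw_zero:
  assumes i: "i \<in> I" and wsym: "\<And>i j. w i j = w j i"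
  shows "(\<integral>x. iexp (s * (Ww w x - Yw w i x)) * Yw w i x \<partial>P) = 0"
proof -
  define V where "V x = (\<Sum>(j, k)\<in>{p\<in>D. fst p \<noteq> i \<and> snd p \<noteq> i}. w j k * G j k x) / 2" for x
  have V: "Ww w x - Yw w i x = V x" for x
    unfolding V_def by (rule Ww_minus_Yw[OF assms])
  have Vm[measurable]: "V \<in> borel_measurable P"
    using i unfolding V[abs_def, symmetric] by measurable
  have upd: "V (x(i := y)) = V x" for x y
    unfolding V_def by (intro arg_cong[of _ _ "\<lambda>u. u / 2"] sum.cong refl) (auto simp: G_upd)
  have int: "integrable P (\<lambda>x. G i j x *\<^sub>R (w i j * iexp (s * V x)))"
    and z: "(\<integral>x. G i j x *\<^sub>R (w i j * iexp (s * V x)) \<partial>P) = 0" if j: "j \<in> I - {i}" for j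
  proof -
    have "integrable P (\<lambda>x. iexp (s * V x) * complex_of_real (w i j * G i j x))"
      by (intro PP.integrable_iexp_mult integrable_of_real integrable_mult_right integrable_G)
         (use i j in \<open>auto simp: D_iff\<close>)
    then show int: "integrable P (\<lambda>x. G i j x *\<^sub>R (w i j * iexp (s * V x)))"
      by (simp add: scaleR_conv_of_real mult_ac)
    show "(\<integral>x. G i j x *\<^sub>R (w i j * iexp (s * V x)) \<partial>P) = 0"
      using i j by (intro degenerate_integral_zero int) (auto simp: upd)
  qed
  have "(\<integral>x. iexp (s * (Ww w x - Yw w i x)) * Yw w i x \<partial>P) =
      (\<integral>x. (\<Sum>j\<in>I - {i}. G i j x *\<^sub>R (w i j * iexp (s * V x))) \<partial>P)"
    unfolding V by (intro Bochner_Integration.integral_cong)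
      (simp_all add: Yw_def sum_distrib_left scaleR_conv_of_real mult_ac)
  also have "\<dots> = (\<Sum>j\<in>I - {i}. \<integral>x. G i j x *\<^sub>R (w i j * iexp (s * V x)) \<partial>P)"
    by (rule Bochner_Integration.integral_sum) (rule int)
  also have "\<dots> = 0" using z by simp
  finally show ?thesis .
qed

text \<open>The weights are at most \<open>\<kappa>\<close>, of order \<open>1 / card I\<close>, so
  \<open>\<kappa> ^ 4 * card I ^ 4 \<le> c ^ 4\<close> absorbs all powers of the sample size and the
  three moment bounds leave a multiple of \<open>\<epsilon>\<close>. The constants are
  \<open>6 = 2 + 4\<close> for the centred squares, \<open>29 = 2 + 27\<close> for the triples and
  \<open>58 = 2 + 56\<close> for the fourth moments; the 9 comes from
  \<open>2 * (6 + 29) = 70 \<le> 9^2\<close>.\<close>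

lemma
  assumes A: "A4 \<le> \<epsilon> * (real (card I))\<^sup>2" and B: "B4 \<le> \<epsilon> * real (card I)" and C: "\<bar>C4\<bar> \<le> \<epsilon>"
    and w: "\<And>i j. \<bar>w i j\<bar> \<le> \<kappa>" and w2: "(\<Sum>(i, j)\<in>D. (w i j)\<^sup>2) = 2"
    and c: "real (card I) * \<kappa> \<le> c"
  shows sum_Yw_square_L1: "(\<integral>x. \<bar>(\<Sum>i\<in>I. (Yw w i x)\<^sup>2) - 2\<bar> \<partial>P) \<le> 9 * (c\<^sup>2 * sqrt \<epsilon>)"
    and sum_Yw_fourth: "(\<Sum>i\<in>I. \<integral>x. (Yw w i x) ^ 4 \<partial>P) \<le> 58 * (c\<^sup>2 * sqrt \<epsilon>)\<^sup>2"
proof -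
  let ?N = "real (card I)"
  have \<kappa>: "0 \<le> \<kappa>" using w[of undefined undefined] by linarith
  have \<epsilon>: "0 \<le> \<epsilon>" using C by linarith
  have "(?N * \<kappa>) ^ 4 \<le> c ^ 4" using c \<kappa> by (intro power_mono) auto
  then have c4: "\<kappa> ^ 4 * ?N ^ 4 \<le> c ^ 4" by (simp add: power_mult_distrib mult_ac)
  have \<eta>2: "(c\<^sup>2 * sqrt \<epsilon>)\<^sup>2 = c ^ 4 * \<epsilon>"
    using \<epsilon> by (simp add: power_mult_distrib flip: power_mult)
  have up: "k * \<epsilon> * (\<kappa> ^ 4 * ?N ^ 4) \<le> k * (c\<^sup>2 * sqrt \<epsilon>)\<^sup>2" if "0 \<le> k" for k
    unfolding \<eta>2 using mult_left_mono[OF c4, of "k * \<epsilon>"] that \<epsilon> by (simp add: mult_ac)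
  let ?Q1 = "\<lambda>x. \<Sum>(i, j)\<in>D. (w i j)\<^sup>2 * ((G i j x)\<^sup>2 - 1)" and ?Q2 = "\<lambda>x. \<Sum>t\<in>Tr. TG w t x"
  have w': "(w i j)\<^sup>2 \<le> \<kappa>\<^sup>2" for i j using w[of i j] \<kappa> by (metis abs_of_nonneg abs_le_square_iff)
  have "(\<integral>x. (?Q1 x)\<^sup>2 \<partial>P) \<le> (\<kappa>\<^sup>2)\<^sup>2 * ?N\<^sup>2 * (2 * A4 + 4 * ?N * B4)"
    by (rule square_second_moment(1)) (auto intro: w')
  moreover have "(\<kappa>\<^sup>2)\<^sup>2 * ?N\<^sup>2 * (2 * A4 + 4 * ?N * B4) \<le>
      (\<kappa>\<^sup>2)\<^sup>2 * ?N\<^sup>2 * (2 * (\<epsilon> * ?N\<^sup>2) + 4 * ?N * (\<epsilon> * ?N))"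
    using A B by (intro mult_left_mono add_mono) auto
  moreover have "(\<kappa>\<^sup>2)\<^sup>2 * ?N\<^sup>2 * (2 * (\<epsilon> * ?N\<^sup>2) + 4 * ?N * (\<epsilon> * ?N)) = 6 * \<epsilon> * (\<kappa> ^ 4 * ?N ^ 4)"
    by (simp add: algebra_simps power4_eq_xxxx power2_eq_square)
  ultimately have E1: "(\<integral>x. (?Q1 x)\<^sup>2 \<partial>P) \<le> 6 * (c\<^sup>2 * sqrt \<epsilon>)\<^sup>2" using up[of 6] by linarith
  have i1: "integrable P (\<lambda>x. (?Q1 x)\<^sup>2)"
    by (rule square_second_moment(2)) (auto intro: w')
  have "(\<integral>x. (?Q2 x)\<^sup>2 \<partial>P) \<le> \<kappa> ^ 4 * ?N ^ 3 * (2 * ?N * \<bar>C4\<bar> + 27 * B4)"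
    by (rule triple_second_moment(1)[OF w])
  moreover have "\<kappa> ^ 4 * ?N ^ 3 * (2 * ?N * \<bar>C4\<bar> + 27 * B4) \<le> \<kappa> ^ 4 * ?N ^ 3 * (2 * ?N * \<epsilon> + 27 * (\<epsilon> * ?N))"
    using B C \<kappa> by (intro mult_left_mono add_mono) auto
  moreover have "\<kappa> ^ 4 * ?N ^ 3 * (2 * ?N * \<epsilon> + 27 * (\<epsilon> * ?N)) = 29 * \<epsilon> * (\<kappa> ^ 4 * ?N ^ 4)"
    by (simp add: algebra_simps power4_eq_xxxx power3_eq_cube)
  ultimately have E2: "(\<integral>x. (?Q2 x)\<^sup>2 \<partial>P) \<le> 29 * (c\<^sup>2 * sqrt \<epsilon>)\<^sup>2" using up[of 29] by linarith
  have i2: "integrable P (\<lambda>x. (?Q2 x)\<^sup>2)"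
    by (rule triple_second_moment(2)[OF w])
  have eq: "(\<Sum>i\<in>I. (Yw w i x)\<^sup>2) - 2 = ?Q1 x + ?Q2 x" for x
    by (rule sum_Yw_square[OF w2])
  have m: "(\<lambda>x. (\<Sum>i\<in>I. (Yw w i x)\<^sup>2) - 2) \<in> borel_measurable P"
    by (intro borel_measurable_diff borel_measurable_sum borel_measurable_power Yw_measurable borel_measurable_const)
  have le: "((\<Sum>i\<in>I. (Yw w i x)\<^sup>2) - 2)\<^sup>2 \<le> 2 * (?Q1 x)\<^sup>2 + 2 * (?Q2 x)\<^sup>2" for x
    unfolding eq using sum_squares_bound[of "?Q1 x" "?Q2 x"] by (simp add: power2_sum)
  have ib: "integrable P (\<lambda>x. 2 * (?Q1 x)\<^sup>2 + 2 * (?Q2 x)\<^sup>2)"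
    by (intro Bochner_Integration.integrable_add integrable_mult_right i1 i2)
  have i: "integrable P (\<lambda>x. ((\<Sum>i\<in>I. (Yw w i x)\<^sup>2) - 2)\<^sup>2)"
  proof (rule Bochner_Integration.integrable_bound[OF ib])
    show "(\<lambda>x. ((\<Sum>i\<in>I. (Yw w i x)\<^sup>2) - 2)\<^sup>2) \<in> borel_measurable P"
      using m by (rule borel_measurable_power)
    show "AE x in P. norm (((\<Sum>i\<in>I. (Yw w i x)\<^sup>2) - 2)\<^sup>2) \<le> norm (2 * (?Q1 x)\<^sup>2 + 2 * (?Q2 x)\<^sup>2)"
      using le by (intro AE_I2) (simp only: real_norm_def abs_of_nonneg[OF zero_le_power2] abs_ge_self[THEN order_trans[OF le]])
  qed
  have le1: "(\<integral>x. ((\<Sum>i\<in>I. (Yw w i x)\<^sup>2) - 2)\<^sup>2 \<partial>P) \<le> (\<integral>x. 2 * (?Q1 x)\<^sup>2 + 2 * (?Q2 x)\<^sup>2 \<partial>P)"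
    by (rule integral_mono[OF i ib]) (rule le)
  have eq1: "(\<integral>x. 2 * (?Q1 x)\<^sup>2 + 2 * (?Q2 x)\<^sup>2 \<partial>P) = 2 * (\<integral>x. (?Q1 x)\<^sup>2 \<partial>P) + 2 * (\<integral>x. (?Q2 x)\<^sup>2 \<partial>P)"
    using i1 i2 by (subst Bochner_Integration.integral_add) (auto intro: integrable_mult_right)
  have E: "(\<integral>x. ((\<Sum>i\<in>I. (Yw w i x)\<^sup>2) - 2)\<^sup>2 \<partial>P) \<le> (9 * (c\<^sup>2 * sqrt \<epsilon>))\<^sup>2"
  proof -
    have "(9 * (c\<^sup>2 * sqrt \<epsilon>))\<^sup>2 = 81 * (c\<^sup>2 * sqrt \<epsilon>)\<^sup>2" by (subst power_mult_distrib) simp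
    moreover have "0 \<le> (c\<^sup>2 * sqrt \<epsilon>)\<^sup>2" by (rule zero_le_power2)
    ultimately show ?thesis using E1 E2 le1 eq1 by linarith
  qed
  from PP.expectation_le_sqrt[OF m i E]
  show "(\<integral>x. \<bar>(\<Sum>i\<in>I. (Yw w i x)\<^sup>2) - 2\<bar> \<partial>P) \<le> 9 * (c\<^sup>2 * sqrt \<epsilon>)"
    using \<epsilon> by (simp only: real_sqrt_abs) simp
  have "(\<Sum>i\<in>I. \<integral>x. (Yw w i x) ^ 4 \<partial>P) \<le> (\<Sum>i\<in>I. \<kappa> ^ 4 * (2 * ?N * A4 + 56 * ?N\<^sup>2 * B4))"
    by (intro sum_mono fourth_moment_Yw w)
  moreover have "(\<Sum>i\<in>I. \<kappa> ^ 4 * (2 * ?N * A4 + 56 * ?N\<^sup>2 * B4)) \<le>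
      ?N * (\<kappa> ^ 4 * (2 * ?N * (\<epsilon> * ?N\<^sup>2) + 56 * ?N\<^sup>2 * (\<epsilon> * ?N)))"
    unfolding sum_constant using A B \<kappa> by (intro mult_left_mono add_mono) auto
  moreover have "?N * (\<kappa> ^ 4 * (2 * ?N * (\<epsilon> * ?N\<^sup>2) + 56 * ?N\<^sup>2 * (\<epsilon> * ?N))) = 58 * \<epsilon> * (\<kappa> ^ 4 * ?N ^ 4)"
    by (simp add: algebra_simps power4_eq_xxxx power2_eq_square)
  ultimately show "(\<Sum>i\<in>I. \<integral>x. (Yw w i x) ^ 4 \<partial>P) \<le> 58 * (c\<^sup>2 * sqrt \<epsilon>)\<^sup>2"
    using up[of 58] by linarith
qed

lemma normal_approximation:
  assumes \<epsilon>: "0 < \<epsilon>"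
    and A: "A4 \<le> \<epsilon> * (real (card I))\<^sup>2" and B: "B4 \<le> \<epsilon> * real (card I)" and C: "\<bar>C4\<bar> \<le> \<epsilon>"
    and wsym: "\<And>i j. w i j = w j i"
    and w: "\<And>i j. \<bar>w i j\<bar> \<le> \<kappa>" and w2: "(\<Sum>(i, j)\<in>D. (w i j)\<^sup>2) = 2"
    and c: "real (card I) * \<kappa> \<le> c" "0 < c"
  defines "\<eta> \<equiv> c\<^sup>2 * sqrt \<epsilon>"
  shows "cmod ((\<integral>x. iexp (t * Ww w x) \<partial>P) - of_real (exp (- (t\<^sup>2) / 2))) \<le>
    \<bar>t\<bar> * (\<bar>t\<bar> / 2 * (9 * \<eta>) + t\<^sup>2 / 4 * (30 * \<eta> + 5 * \<eta>\<^sup>2))"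
proof (rule PP.stein_tikhomirov[OF fin])
  have \<eta>: "0 < \<eta>" using \<epsilon> c by (simp add: \<eta>_def)
  note L1 = sum_Yw_square_L1[OF A B C w w2 c(1), folded \<eta>_def]
  note Y4 = sum_Yw_fourth[OF A B C w w2 c(1), folded \<eta>_def]
  show Ym: "Yw w i \<in> borel_measurable P" if "i \<in> I" for i using that by (rule Yw_measurable)
  show iY4: "integrable P (\<lambda>x. (Yw w i x) ^ 4)" if "i \<in> I" for i
    using w that by (rule fourth_moment_Yw(2))
  have iY2: "integrable P (\<lambda>x. (Yw w i x)\<^sup>2)" if "i \<in> I" for i
    using PP.integrable_if_square[of "\<lambda>x. (Yw w i x)\<^sup>2"] iY4[OF that] Ym[OF that] by (simp flip: power_mult)
  show "Ww w x = (\<Sum>i\<in>I. Yw w i x) / 2" for x by (rule Ww_eq)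
  show "Ww w \<in> borel_measurable P" by (rule Ww_measurable)
  show "integrable P (\<lambda>x. (Ww w x)\<^sup>2)" by (rule Ww_second_moment(2)[OF w2])
  show "(\<integral>x. iexp (s * (Ww w x - Yw w i x)) * Yw w i x \<partial>P) = 0" if "i \<in> I" for i s
    using that wsym by (rule E_iexp_Yw_zero)
  show "(\<integral>x. \<bar>(\<Sum>i\<in>I. (Yw w i x)\<^sup>2) - 2\<bar> \<partial>P) \<le> 9 * \<eta>" by (rule L1)
  have iQ: "integrable P (\<lambda>x. \<Sum>i\<in>I. (Yw w i x)\<^sup>2)"
    using iY2 by (rule Bochner_Integration.integrable_sum)
  \<comment> \<open>The second moments are not computed but read off from the \<open>L^1\<close>
    bound just used: the expectation of the sum exceeds 2 by at most
    \<open>9 * \<eta>\<close>.\<close>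
  have "(\<integral>x. (\<Sum>i\<in>I. (Yw w i x)\<^sup>2) \<partial>P) - 2 = (\<integral>x. (\<Sum>i\<in>I. (Yw w i x)\<^sup>2) - 2 \<partial>P)"
    using iQ by (subst Bochner_Integration.integral_diff) (simp_all add: PP.prob_space)
  also have "\<dots> \<le> 9 * \<eta>"
    using L1 integral_abs_bound[of P "\<lambda>x. (\<Sum>i\<in>I. (Yw w i x)\<^sup>2) - 2"] by linarith
  finally have Y2: "(\<Sum>i\<in>I. \<integral>x. (Yw w i x)\<^sup>2 \<partial>P) \<le> 2 + 9 * \<eta>"
    using iY2 by (subst (asm) Bochner_Integration.integral_sum) auto
  have "(\<Sum>i\<in>I. \<integral>x. \<bar>Yw w i x\<bar> ^ 3 \<partial>P) \<le>
      (\<Sum>i\<in>I. (\<eta> * (\<integral>x. (Yw w i x)\<^sup>2 \<partial>P) + (\<integral>x. (Yw w i x) ^ 4 \<partial>P) / \<eta>) / 2)"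
  proof (rule sum_mono)
    fix i assume i: "i \<in> I"
    let ?b = "\<lambda>x. (\<eta> * (Yw w i x)\<^sup>2 + (Yw w i x) ^ 4 / \<eta>) / 2"
    have ib: "integrable P ?b" using iY2[OF i] iY4[OF i] by auto
    have [measurable]: "Yw w i \<in> borel_measurable P" by (rule Ym[OF i])
    have "integrable P (\<lambda>x. \<bar>Yw w i x\<bar> ^ 3)"
    proof (rule Bochner_Integration.integrable_bound[OF ib])
      show "AE x in P. norm (\<bar>Yw w i x\<bar> ^ 3) \<le> norm (?b x)"
        using abs_cube_le[OF \<eta>] by (intro AE_I2) (simp add: order_trans[OF _ abs_ge_self])
    qed measurable
    then have "(\<integral>x. \<bar>Yw w i x\<bar> ^ 3 \<partial>P) \<le> (\<integral>x. ?b x \<partial>P)"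
      using ib abs_cube_le[OF \<eta>] by (intro integral_mono)
    then show "(\<integral>x. \<bar>Yw w i x\<bar> ^ 3 \<partial>P) \<le> (\<eta> * (\<integral>x. (Yw w i x)\<^sup>2 \<partial>P) + (\<integral>x. (Yw w i x) ^ 4 \<partial>P) / \<eta>) / 2"
      using iY2[OF i] iY4[OF i] by simp
  qed
  also have "\<dots> = (\<eta> * (\<Sum>i\<in>I. \<integral>x. (Yw w i x)\<^sup>2 \<partial>P) + (\<Sum>i\<in>I. \<integral>x. (Yw w i x) ^ 4 \<partial>P) / \<eta>) / 2"
    by (simp only: sum_divide_distrib[symmetric] sum.distrib sum_distrib_left[symmetric])
  also have "\<dots> \<le> (\<eta> * (2 + 9 * \<eta>) + (58 * \<eta>\<^sup>2) / \<eta>) / 2"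
    using Y2 Y4 \<eta> by (intro divide_right_mono add_mono mult_left_mono) auto
  \<comment> \<open>The left side equals \<open>30 * \<eta> + 9 / 2 * \<eta>^2\<close>, where 30 is
    half of \<open>2 + 58\<close>.\<close>
  also have "\<dots> \<le> 30 * \<eta> + 5 * \<eta>\<^sup>2"
    using \<eta> by (simp add: field_simps power2_eq_square)
  finally show "(\<Sum>i\<in>I. \<integral>x. \<bar>Yw w i x\<bar> ^ 3 \<partial>P) \<le> 30 * \<eta> + 5 * \<eta>\<^sup>2" .
qed

text \<open>This is the law of large numbers behind the variance estimator: after division by the
  number of pairs, of order \<open>(card I)^2\<close>, the average of the squares is close to
  1.\<close>

lemma sum_G_square_L1:
  assumes \<epsilon>: "0 \<le> \<epsilon>"
    and A: "A4 \<le> \<epsilon> * (real (card I))\<^sup>2" and B: "B4 \<le> \<epsilon> * real (card I)"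
  shows "(\<integral>x. \<bar>\<Sum>(i, j)\<in>D. (G i j x)\<^sup>2 - 1\<bar> \<partial>P) \<le> 3 * ((real (card I))\<^sup>2 * sqrt \<epsilon>)"
    and "integrable P (\<lambda>x. \<bar>\<Sum>(i, j)\<in>D. (G i j x)\<^sup>2 - 1\<bar>)"
proof -
  let ?N = "real (card I)" and ?Q = "\<lambda>x. \<Sum>(i, j)\<in>D. (G i j x)\<^sup>2 - 1"
  have "(\<integral>x. (?Q x)\<^sup>2 \<partial>P) \<le> 1\<^sup>2 * ?N\<^sup>2 * (2 * A4 + 4 * ?N * B4)"
    using square_second_moment(1)[of "\<lambda>_ _. 1" 1] by simp
  moreover have "1\<^sup>2 * ?N\<^sup>2 * (2 * A4 + 4 * ?N * B4) \<le> 1\<^sup>2 * ?N\<^sup>2 * (2 * (\<epsilon> * ?N\<^sup>2) + 4 * ?N * (\<epsilon> * ?N))"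
    using A B by (intro mult_left_mono add_mono) auto
  moreover have "1\<^sup>2 * ?N\<^sup>2 * (2 * (\<epsilon> * ?N\<^sup>2) + 4 * ?N * (\<epsilon> * ?N)) = 6 * (?N\<^sup>2 * sqrt \<epsilon>)\<^sup>2"
    using \<epsilon> by (simp add: algebra_simps power_mult_distrib) (simp add: power2_eq_square power4_eq_xxxx)
  moreover have "6 * (?N\<^sup>2 * sqrt \<epsilon>)\<^sup>2 \<le> (3 * (?N\<^sup>2 * sqrt \<epsilon>))\<^sup>2"
    unfolding power_mult_distrib[of 3] by simp
  ultimately have E: "(\<integral>x. (?Q x)\<^sup>2 \<partial>P) \<le> (3 * (?N\<^sup>2 * sqrt \<epsilon>))\<^sup>2" by linarith
  have i: "integrable P (\<lambda>x. (?Q x)\<^sup>2)"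
    using square_second_moment(2)[of "\<lambda>_ _. 1" 1] by simp
  have m: "?Q \<in> borel_measurable P"
    unfolding case_prod_unfold
    by (intro borel_measurable_sum borel_measurable_diff borel_measurable_power G_D_measurable borel_measurable_const)
  show "(\<integral>x. \<bar>?Q x\<bar> \<partial>P) \<le> 3 * (?N\<^sup>2 * sqrt \<epsilon>)"
    using PP.expectation_le_sqrt[OF m i E] \<epsilon> by (simp only: real_sqrt_abs) simp
  show "integrable P (\<lambda>x. \<bar>?Q x\<bar>)"
    by (rule integrable_abs[OF PP.integrable_if_square[OF m i]])
qed

end

section \<open>Additive kernels\<close>

lemma sum_add_offdiag:
  fixes B :: "nat \<Rightarrow> nat \<Rightarrow> real"
  shows "(\<Sum>k=1..n. \<Sum>l\<in>{1..n}-{k}. B k l + u k + u l) =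
    (\<Sum>k=1..n. \<Sum>l\<in>{1..n}-{k}. B k l) + 2 * (real n - 1) * (\<Sum>k=1..n. u k)"
proof -
  have "(\<Sum>l\<in>{1..n}-{k}. B k l + u k + u l) =
      (\<Sum>l\<in>{1..n}-{k}. B k l) + (real n - 2) * u k + (\<Sum>l=1..n. u l)" if "k \<in> {1..n}" for k
  proof -
    have "(\<Sum>l\<in>{1..n}-{k}. B k l + u k + u l) =
        (\<Sum>l\<in>{1..n}-{k}. B k l) + real (card ({1..n} - {k})) * u k + (\<Sum>l\<in>{1..n}-{k}. u l)"
      by (simp add: sum.distrib)
    also have "(\<Sum>l\<in>{1..n}-{k}. u l) = (\<Sum>l=1..n. u l) - u k"
      using that by (simp add: sum_diff1)
    also have "real (card ({1..n} - {k})) = real n - 1"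
      using that by (simp add: of_nat_diff)
    finally show ?thesis by (simp add: algebra_simps)
  qed
  then have "(\<Sum>k=1..n. \<Sum>l\<in>{1..n}-{k}. B k l + u k + u l) =
      (\<Sum>k=1..n. (\<Sum>l\<in>{1..n}-{k}. B k l) + (real n - 2) * u k + (\<Sum>l=1..n. u l))"
    by (intro sum.cong refl)
  also have "\<dots> = (\<Sum>k=1..n. \<Sum>l\<in>{1..n}-{k}. B k l) + (real n - 2) * (\<Sum>k=1..n. u k) + real n * (\<Sum>l=1..n. u l)"
    by (simp add: sum.distrib sum_distrib_left)
  finally show ?thesis by (simp add: algebra_simps)
qed

text \<open>A term \<open>u k\<close> enters the cross average with coefficient \<open>2 / n\<close>
  and the within average with \<open>2 * (n - 1) / (n * (n - 1))\<close>, which is the same, so it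
  cancels; likewise for \<open>v\<close>. The common factor \<open>s\<close> lets the array be
  normalised.\<close>

lemma energy_stat_additive:
  fixes A Bx By :: "nat \<Rightarrow> nat \<Rightarrow> real"
  assumes nm: "2 \<le> n" "2 \<le> m"
    and xy: "\<And>k l. k \<in> {1..n} \<Longrightarrow> l \<in> {1..m} \<Longrightarrow> K (x k) (y l) = s * (A k l + u k + v l)"
    and xx: "\<And>k l. k \<in> {1..n} \<Longrightarrow> l \<in> {1..n} \<Longrightarrow> k \<noteq> l \<Longrightarrow> K (x k) (x l) = s * (Bx k l + u k + u l)"
    and yy: "\<And>k l. k \<in> {1..m} \<Longrightarrow> l \<in> {1..m} \<Longrightarrow> k \<noteq> l \<Longrightarrow> K (y k) (y l) = s * (By k l + v k + v l)"
  shows "energy_stat K n m x y = s * (2 / (real n * real m) * (\<Sum>k=1..n. \<Sum>l=1..m. A k l)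
     - 1 / (real n * (real n - 1)) * (\<Sum>k=1..n. \<Sum>l\<in>{1..n}-{k}. Bx k l)
     - 1 / (real m * (real m - 1)) * (\<Sum>k=1..m. \<Sum>l\<in>{1..m}-{k}. By k l))"
proof -
  have 1: "(\<Sum>k=1..n. \<Sum>l=1..m. K (x k) (y l)) =
      s * ((\<Sum>k=1..n. \<Sum>l=1..m. A k l) + real m * (\<Sum>k=1..n. u k) + real n * (\<Sum>l=1..m. v l))"
  proof -
    have "(\<Sum>k=1..n. \<Sum>l=1..m. K (x k) (y l)) = (\<Sum>k=1..n. \<Sum>l=1..m. s * (A k l + u k + v l))"
      by (intro sum.cong refl xy)
    then show ?thesis by (simp add: sum_distrib_left[symmetric] sum.distrib)
  qed
  have 2: "(\<Sum>k=1..n. \<Sum>l\<in>{1..n}-{k}. K (x k) (x l)) =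
      s * ((\<Sum>k=1..n. \<Sum>l\<in>{1..n}-{k}. Bx k l) + 2 * (real n - 1) * (\<Sum>k=1..n. u k))"
  proof -
    have "(\<Sum>k=1..n. \<Sum>l\<in>{1..n}-{k}. K (x k) (x l)) = (\<Sum>k=1..n. \<Sum>l\<in>{1..n}-{k}. s * (Bx k l + u k + u l))"
      by (intro sum.cong refl xx) auto
    then show ?thesis unfolding sum_distrib_left[symmetric] sum_add_offdiag .
  qed
  have 3: "(\<Sum>k=1..m. \<Sum>l\<in>{1..m}-{k}. K (y k) (y l)) =
      s * ((\<Sum>k=1..m. \<Sum>l\<in>{1..m}-{k}. By k l) + 2 * (real m - 1) * (\<Sum>k=1..m. v k))"
  proof -
    have "(\<Sum>k=1..m. \<Sum>l\<in>{1..m}-{k}. K (y k) (y l)) = (\<Sum>k=1..m. \<Sum>l\<in>{1..m}-{k}. s * (By k l + v k + v l))"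
      by (intro sum.cong refl yy) auto
    then show ?thesis unfolding sum_distrib_left[symmetric] sum_add_offdiag .
  qed
  have id: "2 / (N * M) * (s * (a + M * U + N * V)) - 1 / (N * (N - 1)) * (s * (b + 2 * (N - 1) * U))
       - 1 / (M * (M - 1)) * (s * (c + 2 * (M - 1) * V)) =
     s * (2 / (N * M) * a - 1 / (N * (N - 1)) * b - 1 / (M * (M - 1)) * c)"
    if "N \<noteq> 0" "M \<noteq> 0" "N - 1 \<noteq> 0" "M - 1 \<noteq> 0" for N M a b c U V :: real
  proof -
    have cancel: "1 / (a * q) * (s * (b + 2 * q * c)) = s * (1 / (a * q) * b + 2 * c / a)"
      if "a \<noteq> 0" "q \<noteq> 0" for a q b c :: real
      using that by (simp add: field_simps)
    have "1 / (N * (N - 1)) * (s * (b + 2 * (N - 1) * U)) = s * (1 / (N * (N - 1)) * b + 2 * U / N)"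
      using that by (intro cancel)
    moreover have "1 / (M * (M - 1)) * (s * (c + 2 * (M - 1) * V)) = s * (1 / (M * (M - 1)) * c + 2 * V / M)"
      using that by (intro cancel)
    moreover have "2 / (N * M) * (s * (a + M * U + N * V)) = s * (2 / (N * M) * a + 2 * U / N + 2 * V / M)"
      using that by (simp add: add_divide_distrib algebra_simps)
    ultimately show ?thesis by (simp add: algebra_simps)
  qed
  show ?thesis
    unfolding energy_stat_def 1 2 3 using nm by (intro id) auto
qed

lemma K_hat_additive:
  fixes A :: "nat \<Rightarrow> nat \<Rightarrow> real"
  assumes nm: "k \<in> {1..n}" "l \<in> {1..m}"
    and xy: "\<And>k l. k \<in> {1..n} \<Longrightarrow> l \<in> {1..m} \<Longrightarrow> K (x k) (y l) = s * (A k l + u k + v l)"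
  shows "K_hat K n m x y k l = s * (A k l - 1 / real n * (\<Sum>i=1..n. A i l)
     - 1 / real m * (\<Sum>j=1..m. A k j) + 1 / (real n * real m) * (\<Sum>i=1..n. \<Sum>j=1..m. A i j))"
proof -
  have 1: "(\<Sum>i=1..n. \<Sum>j=1..m. K (x i) (y j)) =
      s * ((\<Sum>i=1..n. \<Sum>j=1..m. A i j) + real m * (\<Sum>k=1..n. u k) + real n * (\<Sum>l=1..m. v l))"
  proof -
    have "(\<Sum>k=1..n. \<Sum>l=1..m. K (x k) (y l)) = (\<Sum>k=1..n. \<Sum>l=1..m. s * (A k l + u k + v l))"
      by (intro sum.cong refl xy)
    then show ?thesis by (simp add: sum_distrib_left[symmetric] sum.distrib)
  qed
  have 2: "(\<Sum>i=1..n. K (x i) (y l)) = s * ((\<Sum>i=1..n. A i l) + (\<Sum>k=1..n. u k) + real n * v l)"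
  proof -
    have "(\<Sum>i=1..n. K (x i) (y l)) = (\<Sum>i=1..n. s * (A i l + u i + v l))"
      using nm by (intro sum.cong refl xy)
    then show ?thesis by (simp add: sum_distrib_left[symmetric] sum.distrib)
  qed
  have 3: "(\<Sum>j=1..m. K (x k) (y j)) = s * ((\<Sum>j=1..m. A k j) + real m * u k + (\<Sum>l=1..m. v l))"
  proof -
    have "(\<Sum>j=1..m. K (x k) (y j)) = (\<Sum>j=1..m. s * (A k j + u k + v j))"
      using nm by (intro sum.cong refl xy)
    then show ?thesis by (simp add: sum_distrib_left[symmetric] sum.distrib)
  qed
  have id: "s * (a + uk + vl) - 1 / N * (s * (b + U + N * vl)) - 1 / M * (s * (c + M * uk + V))
       + 1 / (N * M) * (s * (d + M * U + N * V)) =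
     s * (a - 1 / N * b - 1 / M * c + 1 / (N * M) * d)"
    if "N \<noteq> 0" "M \<noteq> 0" for N M a b c d uk vl U V :: real
    using that by (simp add: field_simps)
  show ?thesis
    unfolding K_hat_def 1 2 3 xy[OF nm] using nm by (intro id) auto
qed

text \<open>\<open>U_center\<close> with the diagonal entries left out of the sums. On the diagonal
  the array would contain kernel values at a repeated point, for which no moment is available; the
  distance itself is zero there, so nothing is lost.\<close>

definition U_off :: "nat \<Rightarrow> (nat \<Rightarrow> nat \<Rightarrow> real) \<Rightarrow> nat \<Rightarrow> nat \<Rightarrow> real" where
  "U_off n B k l = B k l - 1 / (real n - 2) * (\<Sum>j\<in>{1..n}-{k}. B k j)
     - 1 / (real n - 2) * (\<Sum>i\<in>{1..n}-{l}. B i l)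
     + 1 / ((real n - 1) * (real n - 2)) * (\<Sum>i=1..n. \<Sum>j\<in>{1..n}-{i}. B i j)"

text \<open>The off-diagonal row sum of \<open>u k + u l\<close> is \<open>(n - 2) * u k\<close>
  plus the total of \<open>u\<close>, which explains the divisor \<open>n - 2\<close> in U-centring.
  The totals left over from row and column cancel against the last term.\<close>

lemma U_center_additive:
  fixes B :: "nat \<Rightarrow> nat \<Rightarrow> real"
  assumes n: "3 \<le> n" and kl: "k \<in> {1..n}" "l \<in> {1..n}" "k \<noteq> l"
    and diag: "\<And>k. k \<in> {1..n} \<Longrightarrow> M k k = 0"
    and off: "\<And>k l. k \<in> {1..n} \<Longrightarrow> l \<in> {1..n} \<Longrightarrow> k \<noteq> l \<Longrightarrow> M k l = s * (B k l + u k + u l)"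
  shows "U_center n M k l = s * U_off n B k l"
proof -
  let ?U = "\<Sum>k=1..n. u k"
  have row: "(\<Sum>j=1..n. M k j) = s * ((\<Sum>j\<in>{1..n}-{k}. B k j) + (real n - 2) * u k + ?U)" if k: "k \<in> {1..n}" for k
  proof -
    have "(\<Sum>j=1..n. M k j) = (\<Sum>j\<in>{1..n}-{k}. M k j)"
      using k diag[of k] sum.remove[of "{1..n}" k "M k"] by (simp del: One_nat_def)
    also have "\<dots> = (\<Sum>j\<in>{1..n}-{k}. s * (B k j + u k + u j))"
      using k by (intro sum.cong refl off) auto
    also have "\<dots> = s * ((\<Sum>j\<in>{1..n}-{k}. B k j) + real (card ({1..n}-{k})) * u k + (\<Sum>j\<in>{1..n}-{k}. u j))"
      by (simp add: sum_distrib_left[symmetric] sum.distrib)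
    also have "(\<Sum>j\<in>{1..n}-{k}. u j) = ?U - u k" using k by (simp add: sum_diff1)
    also have "real (card ({1..n}-{k})) = real n - 1" using k by (simp add: of_nat_diff)
    finally show ?thesis by (simp add: algebra_simps)
  qed
  have col: "(\<Sum>i=1..n. M i l) = s * ((\<Sum>i\<in>{1..n}-{l}. B i l) + (real n - 2) * u l + ?U)"
  proof -
    have "(\<Sum>i=1..n. M i l) = (\<Sum>i\<in>{1..n}-{l}. M i l)"
      using kl diag[of l] sum.remove[of "{1..n}" l "\<lambda>i. M i l"] by (simp del: One_nat_def)
    also have "\<dots> = (\<Sum>i\<in>{1..n}-{l}. s * (B i l + u i + u l))"
      using kl by (intro sum.cong refl off) auto
    also have "\<dots> = s * ((\<Sum>i\<in>{1..n}-{l}. B i l) + (\<Sum>i\<in>{1..n}-{l}. u i) + real (card ({1..n}-{l})) * u l)"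
      by (simp add: sum_distrib_left[symmetric] sum.distrib)
    also have "(\<Sum>i\<in>{1..n}-{l}. u i) = ?U - u l" using kl by (simp add: sum_diff1)
    also have "real (card ({1..n}-{l})) = real n - 1" using kl by (simp add: of_nat_diff)
    finally show ?thesis by (simp add: algebra_simps)
  qed
  have tot: "(\<Sum>i=1..n. \<Sum>j=1..n. M i j) =
      s * ((\<Sum>i=1..n. \<Sum>j\<in>{1..n}-{i}. B i j) + 2 * (real n - 1) * ?U)"
  proof -
    have "(\<Sum>i=1..n. \<Sum>j=1..n. M i j) =
        (\<Sum>i=1..n. s * ((\<Sum>j\<in>{1..n}-{i}. B i j) + (real n - 2) * u i + ?U))"
      by (intro sum.cong refl row)
    also have "\<dots> = s * ((\<Sum>i=1..n. \<Sum>j\<in>{1..n}-{i}. B i j) + (real n - 2) * ?U + real n * ?U)"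
      by (simp add: sum_distrib_left[symmetric] sum.distrib)
    finally show ?thesis by (simp add: algebra_simps)
  qed
  have id: "s * (a + uk + ul) - 1 / N2 * (s * (b + N2 * uk + U)) - 1 / N2 * (s * (c + N2 * ul + U))
       + 1 / (N1 * N2) * (s * (d + 2 * N1 * U)) =
     s * (a - 1 / N2 * b - 1 / N2 * c + 1 / (N1 * N2) * d)"
    if "N1 \<noteq> 0" "N2 \<noteq> 0" for N1 N2 a b c d uk ul U :: real
    using that by (simp add: field_simps)
  show ?thesis
    unfolding U_center_def U_off_def row[OF kl(1)] col tot off[OF kl] using kl(3) n
    by (simp only: if_False) (intro id; simp)
qed

definition H_off :: "nat \<Rightarrow> nat \<Rightarrow> (nat \<Rightarrow> nat \<Rightarrow> real) \<Rightarrow> nat \<Rightarrow> nat \<Rightarrow> real" where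
  "H_off n m A k l = A k l - 1 / real n * (\<Sum>i=1..n. A i l)
     - 1 / real m * (\<Sum>j=1..m. A k j) + 1 / (real n * real m) * (\<Sum>i=1..n. \<Sum>j=1..m. A i j)"

definition S_den :: "nat \<Rightarrow> nat \<Rightarrow> real" where
  "S_den n m = (real n - 1) * (real m - 1) + v_const n + v_const m"

text \<open>The factors in front of \<open>cdCov2\<close> and \<open>dCov2\<close> undo their own
  normalisations, so the numerator becomes a plain sum of squared centred entries; in particular
  \<open>4 * v_const q / (q * (q - 3)) = 2\<close>. Four points per sample keep \<open>q - 3\<close>
  away from zero.\<close>

lemma S_stat_additive:
  fixes A Bx By :: "nat \<Rightarrow> nat \<Rightarrow> real"
  assumes nm: "4 \<le> n" "4 \<le> m"
    and xy: "\<And>k l. k \<in> {1..n} \<Longrightarrow> l \<in> {1..m} \<Longrightarrow> K (x k) (y l) = s * (A k l + u k + v l)"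
    and xx: "\<And>k l. k \<in> {1..n} \<Longrightarrow> l \<in> {1..n} \<Longrightarrow> k \<noteq> l \<Longrightarrow> K (x k) (x l) = s * (Bx k l + u k + u l)"
    and yy: "\<And>k l. k \<in> {1..m} \<Longrightarrow> l \<in> {1..m} \<Longrightarrow> k \<noteq> l \<Longrightarrow> K (y k) (y l) = s * (By k l + v k + v l)"
    and diag: "\<And>k. k \<in> {1..n} \<Longrightarrow> K (x k) (x k) = 0" "\<And>k. k \<in> {1..m} \<Longrightarrow> K (y k) (y k) = 0"
  shows "S_stat K n m x y = s\<^sup>2 * ((4 * (\<Sum>k=1..n. \<Sum>l=1..m. (H_off n m A k l)\<^sup>2)
     + 2 * (\<Sum>k=1..n. \<Sum>l\<in>{1..n}-{k}. (U_off n Bx k l)\<^sup>2)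
     + 2 * (\<Sum>k=1..m. \<Sum>l\<in>{1..m}-{k}. (U_off m By k l)\<^sup>2)) / S_den n m)"
proof -
  have d: "4 * v_const q * (1 / (real q * (real q - 3)) * z) = 2 * z" if "4 \<le> q" for q z
    using that by (simp add: v_const_def)
  have 1: "4 * (real n - 1) * (real m - 1) * cdCov2 K n m x y = 4 * (s\<^sup>2 * (\<Sum>k=1..n. \<Sum>l=1..m. (H_off n m A k l)\<^sup>2))"
  proof -
    have "(\<Sum>k=1..n. \<Sum>l=1..m. (K_hat K n m x y k l)\<^sup>2) = (\<Sum>k=1..n. \<Sum>l=1..m. s\<^sup>2 * (H_off n m A k l)\<^sup>2)"
    proof (intro sum.cong refl)
      fix k l assume kl: "k \<in> {1..n}" "l \<in> {1..m}"
      have "K_hat K n m x y k l = s * H_off n m A k l"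
        unfolding H_off_def by (rule K_hat_additive[OF kl]) (rule xy)
      then show "(K_hat K n m x y k l)\<^sup>2 = s\<^sup>2 * (H_off n m A k l)\<^sup>2" by (simp add: power_mult_distrib)
    qed
    moreover have "4 * a * b * (1 / (a * b) * z) = 4 * z" if "a \<noteq> 0" "b \<noteq> 0" for a b z :: real
      using that by simp
    moreover have "real n - 1 \<noteq> 0" "real m - 1 \<noteq> 0" using nm by auto
    ultimately show ?thesis unfolding cdCov2_def by (simp only: sum_distrib_left not_False_eq_True)
  qed
  have 2: "4 * v_const n * dCov2 K n x = 2 * (s\<^sup>2 * (\<Sum>k=1..n. \<Sum>l\<in>{1..n}-{k}. (U_off n Bx k l)\<^sup>2))"
  proof -
    have "(\<Sum>k=1..n. \<Sum>l\<in>{1..n}-{k}. (U_center n (\<lambda>k l. K (x k) (x l)) k l)\<^sup>2) =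
        (\<Sum>k=1..n. \<Sum>l\<in>{1..n}-{k}. s\<^sup>2 * (U_off n Bx k l)\<^sup>2)"
    proof (intro sum.cong refl)
      fix k l assume kl: "k \<in> {1..n}" "l \<in> {1..n} - {k}"
      have "U_center n (\<lambda>k l. K (x k) (x l)) k l = s * U_off n Bx k l"
        using nm kl by (intro U_center_additive[where u=u] diag xx) auto
      then show "(U_center n (\<lambda>k l. K (x k) (x l)) k l)\<^sup>2 = s\<^sup>2 * (U_off n Bx k l)\<^sup>2" by (simp add: power_mult_distrib)
    qed
    then show ?thesis unfolding dCov2_def d[OF nm(1)] by (simp only: sum_distrib_left)
  qed
  have 3: "4 * v_const m * dCov2 K m y = 2 * (s\<^sup>2 * (\<Sum>k=1..m. \<Sum>l\<in>{1..m}-{k}. (U_off m By k l)\<^sup>2))"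
  proof -
    have "(\<Sum>k=1..m. \<Sum>l\<in>{1..m}-{k}. (U_center m (\<lambda>k l. K (y k) (y l)) k l)\<^sup>2) =
        (\<Sum>k=1..m. \<Sum>l\<in>{1..m}-{k}. s\<^sup>2 * (U_off m By k l)\<^sup>2)"
    proof (intro sum.cong refl)
      fix k l assume kl: "k \<in> {1..m}" "l \<in> {1..m} - {k}"
      have "U_center m (\<lambda>k l. K (y k) (y l)) k l = s * U_off m By k l"
        using nm kl by (intro U_center_additive[where u=v] diag yy) auto
      then show "(U_center m (\<lambda>k l. K (y k) (y l)) k l)\<^sup>2 = s\<^sup>2 * (U_off m By k l)\<^sup>2" by (simp add: power_mult_distrib)
    qed
    then show ?thesis unfolding dCov2_def d[OF nm(2)] by (simp only: sum_distrib_left)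
  qed
  show ?thesis
    unfolding S_stat_def 1 2 3 S_den_def by (simp add: algebra_simps)
qed

lemma T_stat_additive:
  assumes s: "0 < s"
    and "energy_stat K n m x y = s * E" "S_stat K n m x y = s\<^sup>2 * S"
  shows "T_stat K n m x y = (E / a_const n m) / sqrt S"
  unfolding T_stat_def assms(2,3) using s by (simp add: real_sqrt_mult)

section \<open>The pooled sample\<close>

context prob_space
begin

definition sq_int :: "('a \<Rightarrow> real) \<Rightarrow> bool" where
  "sq_int f \<longleftrightarrow> f \<in> borel_measurable M \<and> integrable M (\<lambda>x. (f x)\<^sup>2)"

lemma sq_int_measurable: "sq_int f \<Longrightarrow> f \<in> borel_measurable M"
  and sq_int_integrable: "sq_int f \<Longrightarrow> integrable M (\<lambda>x. (f x)\<^sup>2)"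
  by (auto simp: sq_int_def)

lemma sq_int_mult: assumes "sq_int f" shows "sq_int (\<lambda>x. c * f x)"
  using assms by (auto simp: sq_int_def power_mult_distrib)

lemma sq_int_add: assumes f: "sq_int f" and g: "sq_int g" shows "sq_int (\<lambda>x. f x + g x)"
  unfolding sq_int_def
proof
  show m: "(\<lambda>x. f x + g x) \<in> borel_measurable M" using f g by (auto simp: sq_int_def)
  show "integrable M (\<lambda>x. (f x + g x)\<^sup>2)"
  proof (rule Bochner_Integration.integrable_bound)
    show "integrable M (\<lambda>x. 2 * (f x)\<^sup>2 + 2 * (g x)\<^sup>2)" using f g by (auto simp: sq_int_def)
    show "(\<lambda>x. (f x + g x)\<^sup>2) \<in> borel_measurable M" using m by measurable
    have "(f x + g x)\<^sup>2 \<le> 2 * (f x)\<^sup>2 + 2 * (g x)\<^sup>2" for x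
      using sum_squares_bound[of "f x" "g x"] by (simp add: power2_sum)
    then show "AE x in M. norm ((f x + g x)\<^sup>2) \<le> norm (2 * (f x)\<^sup>2 + 2 * (g x)\<^sup>2)"
      by (intro AE_I2) (simp add: abs_of_nonneg)
  qed
qed

lemma sq_int_diff: assumes "sq_int f" "sq_int g" shows "sq_int (\<lambda>x. f x - g x)"
  using sq_int_add[OF assms(1) sq_int_mult[OF assms(2), of "-1"]] by simp

lemma sq_int_zero: "sq_int (\<lambda>x. 0)" by (simp add: sq_int_def)

lemma sq_int_sum: assumes "finite S" "\<And>s. s \<in> S \<Longrightarrow> sq_int (f s)" shows "sq_int (\<lambda>x. \<Sum>s\<in>S. f s x)"
  using assms by (induction S rule: finite_induct) (auto intro: sq_int_add sq_int_zero)

lemma expectation_square_4: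
  assumes "sq_int a" "sq_int b" "sq_int c" "sq_int d"
  shows "expectation (\<lambda>x. (a x - b x - c x + d x)\<^sup>2) \<le>
    4 * (expectation (\<lambda>x. (a x)\<^sup>2) + expectation (\<lambda>x. (b x)\<^sup>2) + expectation (\<lambda>x. (c x)\<^sup>2) + expectation (\<lambda>x. (d x)\<^sup>2))"
proof -
  have le: "(u - v - w + z)\<^sup>2 \<le> 4 * (u\<^sup>2 + v\<^sup>2 + w\<^sup>2 + z\<^sup>2)" for u v w z :: real
  proof -
    have "0 \<le> (u + v)\<^sup>2 + (u + w)\<^sup>2 + (u - z)\<^sup>2 + (v - w)\<^sup>2 + (v + z)\<^sup>2 + (w + z)\<^sup>2" by simp
    then show ?thesis by (simp add: power2_eq_square algebra_simps)
  qed
  have i: "integrable M (\<lambda>x. (a x - b x - c x + d x)\<^sup>2)"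
    by (intro sq_int_integrable sq_int_add sq_int_diff assms)
  have j: "integrable M (\<lambda>x. (a x)\<^sup>2)" "integrable M (\<lambda>x. (b x)\<^sup>2)" "integrable M (\<lambda>x. (c x)\<^sup>2)" "integrable M (\<lambda>x. (d x)\<^sup>2)"
    using assms by (auto simp: sq_int_def)
  have "expectation (\<lambda>x. (a x - b x - c x + d x)\<^sup>2) \<le> expectation (\<lambda>x. 4 * ((a x)\<^sup>2 + (b x)\<^sup>2 + (c x)\<^sup>2 + (d x)\<^sup>2))"
    using i j le by (intro integral_mono) auto
  then show ?thesis using j by simp
qed

text \<open>With \<open>e = f - g / 2\<close> one has
  \<open>4 * f^2 - g^2 = 4 * g * e + 4 * e^2\<close>. The mixed term is split by AM-GM with weight
  \<open>sqrt \<beta>\<close>, which balances the second moments 1 of \<open>g\<close> and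
  \<open>\<beta>\<close> of \<open>e\<close>; this division is why \<open>\<beta>\<close> is
  strictly positive.\<close>

lemma perturbed_square_L1:
  assumes g: "sq_int g" "expectation (\<lambda>x. (g x)\<^sup>2) \<le> 1"
    and f: "sq_int f" "expectation (\<lambda>x. (f x - g x / 2)\<^sup>2) \<le> \<beta>" and \<beta>: "0 < \<beta>"
  shows "expectation (\<lambda>x. \<bar>4 * (f x)\<^sup>2 - (g x)\<^sup>2\<bar>) \<le> 4 * sqrt \<beta> + 4 * \<beta>"
    and "integrable M (\<lambda>x. \<bar>4 * (f x)\<^sup>2 - (g x)\<^sup>2\<bar>)"
proof -
  let ?e = "\<lambda>x. f x - g x / 2"
  have e: "sq_int ?e"
    using sq_int_diff[OF f(1) sq_int_mult[OF g(1), of "1/2"]] by simp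
  have i: "integrable M (\<lambda>x. (g x)\<^sup>2)" "integrable M (\<lambda>x. (?e x)\<^sup>2)" "integrable M (\<lambda>x. (f x)\<^sup>2)"
    using g f e by (auto simp: sq_int_def)
  show j: "integrable M (\<lambda>x. \<bar>4 * (f x)\<^sup>2 - (g x)\<^sup>2\<bar>)" using i by auto
  have b: "0 < sqrt \<beta>" using \<beta> by simp
  have le: "\<bar>4 * (f x)\<^sup>2 - (g x)\<^sup>2\<bar> \<le> 2 * sqrt \<beta> * (g x)\<^sup>2 + (2 / sqrt \<beta> + 4) * (?e x)\<^sup>2" for x
  proof -
    have am: "\<bar>u * v\<bar> \<le> (b * u\<^sup>2 + v\<^sup>2 / b) / 2" if "0 < b" for u v b :: real
    proof -
      have "2 * (b * \<bar>u\<bar>) * \<bar>v\<bar> \<le> (b * \<bar>u\<bar>)\<^sup>2 + \<bar>v\<bar>\<^sup>2" by (rule sum_squares_bound)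
      then show ?thesis using that by (simp add: field_simps power2_eq_square abs_mult)
    qed
    have "4 * (f x)\<^sup>2 - (g x)\<^sup>2 = 4 * (g x * ?e x) + 4 * (?e x)\<^sup>2"
      by (simp add: power2_eq_square algebra_simps)
    then have "\<bar>4 * (f x)\<^sup>2 - (g x)\<^sup>2\<bar> \<le> 4 * \<bar>g x * ?e x\<bar> + 4 * (?e x)\<^sup>2"
      by (metis abs_triangle_ineq abs_mult abs_numeral abs_power2)
    then show ?thesis using am[OF b, of "g x" "?e x"] by (simp add: algebra_simps)
  qed
  have "expectation (\<lambda>x. \<bar>4 * (f x)\<^sup>2 - (g x)\<^sup>2\<bar>) \<le>
      expectation (\<lambda>x. 2 * sqrt \<beta> * (g x)\<^sup>2 + (2 / sqrt \<beta> + 4) * (?e x)\<^sup>2)"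
    using i j by (intro integral_mono le) auto
  also have "\<dots> = 2 * sqrt \<beta> * expectation (\<lambda>x. (g x)\<^sup>2) + (2 / sqrt \<beta> + 4) * expectation (\<lambda>x. (?e x)\<^sup>2)"
    using i by simp
  also have "\<dots> \<le> 2 * sqrt \<beta> * 1 + (2 / sqrt \<beta> + 4) * \<beta>"
    using g(2) f(2) b by (intro add_mono mult_left_mono) auto
  also have "(2 / sqrt \<beta> + 4) * \<beta> = 2 * sqrt \<beta> + 4 * \<beta>"
  proof -
    have "\<beta> / sqrt \<beta> = sqrt \<beta>" using \<beta> by (intro real_div_sqrt) simp
    moreover have "(2 / sqrt \<beta> + 4) * \<beta> = 2 * (\<beta> / sqrt \<beta>) + 4 * \<beta>" by (simp add: algebra_simps)
    ultimately show ?thesis by simp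
  qed
  finally show "expectation (\<lambda>x. \<bar>4 * (f x)\<^sup>2 - (g x)\<^sup>2\<bar>) \<le> 4 * sqrt \<beta> + 4 * \<beta>" by simp
qed

end

text \<open>The pooled sample is indexed by \<open>{1..n} <+> {1..m}\<close>. The kernel under study is
  \<open>h / 2 + r\<close>, with \<open>h\<close> degenerate and \<open>r\<close> small in \<open>L\<^sup>2\<close>.\<close>

locale two_sample = degenerate_kernel \<mu> "{1..n} <+> {1..m}" h
  for \<mu> :: "'a measure" and n m :: nat and h :: "'a \<Rightarrow> 'a \<Rightarrow> real" +
  fixes r :: "'a \<Rightarrow> 'a \<Rightarrow> real" and \<delta> :: real
  assumes n4: "4 \<le> n" and m4: "4 \<le> m"
    and r_measurable: "(\<lambda>(x, y). r x y) \<in> borel_measurable (\<mu> \<Otimes>\<^sub>M \<mu>)"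
    and r_sym: "r x y = r y x"
    and r_int: "integrable (\<Pi>\<^sub>M _\<in>{..<4::nat}. \<mu>) (\<lambda>x. (r (x 0) (x 1))\<^sup>2)"
    and r_le: "(\<integral>x. (r (x 0) (x 1))\<^sup>2 \<partial>(\<Pi>\<^sub>M _\<in>{..<4::nat}. \<mu>)) \<le> \<delta>"
begin

declare One_nat_def [simp del]

definition R :: "nat + nat \<Rightarrow> nat + nat \<Rightarrow> (nat + nat \<Rightarrow> 'a) \<Rightarrow> real" where "R i j x = r (x i) (x j)"

definition A :: "nat + nat \<Rightarrow> nat + nat \<Rightarrow> (nat + nat \<Rightarrow> 'a) \<Rightarrow> real" where
  "A i j x = G i j x / 2 + R i j x"

lemma R_sym: "R i j = R j i" by (simp add: R_def fun_eq_iff r_sym)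
lemma A_sym: "A i j = A j i" by (simp add: A_def fun_eq_iff R_sym[of i] G_sym[of i])

lemma \<delta>_nonneg: "0 \<le> \<delta>"
  by (rule order_trans[OF _ r_le]) (rule Bochner_Integration.integral_nonneg, simp)

lemma r_measurable': "i \<in> J \<Longrightarrow> j \<in> J \<Longrightarrow> (\<lambda>x. r (x i) (x j)) \<in> borel_measurable (\<Pi>\<^sub>M _\<in>J. \<mu>)"
proof -
  assume [simp]: "i \<in> J" "j \<in> J"
  have "(\<lambda>x. (x i, x j)) \<in> measurable (\<Pi>\<^sub>M _\<in>J. \<mu>) (\<mu> \<Otimes>\<^sub>M \<mu>)"
    by (intro measurable_Pair measurable_component_singleton) auto
  from measurable_compose[OF this r_measurable] show ?thesis by simp
qed

lemma
  assumes ij: "(i, j) \<in> D"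
  shows R_sq_int: "PP.sq_int (R i j)" and R_le: "(\<integral>x. (R i j x)\<^sup>2 \<partial>P) \<le> \<delta>"
proof -
  have ij': "i \<in> {1..n} <+> {1..m}" "j \<in> {1..n} <+> {1..m}" "i \<noteq> j" using ij by (simp_all add: D_iff)
  obtain k where k: "k \<in> {1..n} <+> {1..m}" "k \<notin> set [i,j]" using ex_fresh[of "[i,j]"] by auto
  obtain l where l: "l \<in> {1..n} <+> {1..m}" "l \<notin> set [i,j,k]" using ex_fresh[of "[i,j,k]"] by auto
  have d: "distinct [i,j,k,l]" "{i,j,k,l} \<subseteq> {1..n} <+> {1..m}"
    using ij' k l by (fastforce, blast)
  have m: "(\<lambda>x. (r (x 0) (x 1))\<^sup>2) \<in> borel_measurable (\<Pi>\<^sub>M _\<in>{..<4::nat}. \<mu>)"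
    by (intro borel_measurable_power r_measurable') auto
  show "PP.sq_int (R i j)"
    using moment4(2)[OF d m] r_int r_measurable'[OF ij'(1,2)] by (simp add: R_def[abs_def] PP.sq_int_def)
  show "(\<integral>x. (R i j x)\<^sup>2 \<partial>P) \<le> \<delta>"
    using moment4(1)[OF d m] r_le by (simp add: R_def)
qed

lemma G_sq_int: "(i, j) \<in> D \<Longrightarrow> PP.sq_int (G i j)"
  unfolding PP.sq_int_def using integrable_sq[of i j] by (simp add: D_iff)

lemma A_sq_int: "(i, j) \<in> D \<Longrightarrow> PP.sq_int (A i j)"
  using PP.sq_int_add[OF PP.sq_int_mult[OF G_sq_int, of i j "1/2"] R_sq_int, of i j]
  by (simp add: A_def[abs_def])

text \<open>The degenerate part profits from orthogonality: its second moment is linear in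
  \<open>card S\<close>. The remainder has no such cancellation and is bounded by Cauchy-Schwarz,
  quadratic in \<open>card S\<close> but with the small factor \<open>\<delta>\<close>.\<close>

lemma average_second_moment:
  assumes S: "S \<subseteq> D"
  shows "(\<integral>x. (c * (\<Sum>(i, j)\<in>S. A i j x))\<^sup>2 \<partial>P) \<le> c\<^sup>2 * real (card S) + 2 * (c * real (card S))\<^sup>2 * \<delta>"
    and "PP.sq_int (\<lambda>x. c * (\<Sum>(i, j)\<in>S. A i j x))"
proof -
  have fS: "finite S" using S by (rule finite_subset) simp
  show si: "PP.sq_int (\<lambda>x. c * (\<Sum>(i, j)\<in>S. A i j x))"
    unfolding case_prod_unfold using S by (intro PP.sq_int_mult PP.sq_int_sum fS A_sq_int) auto
  \<comment> \<open>Coefficients extended by zero to all of \<open>D\<close>, where the bound for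
    linear forms applies.\<close>
  define c' where "c' i j = (if (i, j) \<in> S then c / 2 else 0)" for i j
  let ?g = "\<lambda>x. \<Sum>(i, j)\<in>D. c' i j * G i j x" and ?r = "\<lambda>x. \<Sum>(i, j)\<in>S. (R i j x)\<^sup>2"
  have g: "?g x = c / 2 * (\<Sum>(i, j)\<in>S. G i j x)" for x
  proof -
    have "?g x = (\<Sum>(i, j)\<in>S. c / 2 * G i j x)"
      using S by (intro sum.mono_neutral_cong_right) (auto simp: c'_def)
    then show ?thesis by (simp add: sum_distrib_left case_prod_unfold)
  qed
  have c'2: "(\<Sum>(i, j)\<in>D. (c' i j)\<^sup>2) = real (card S) * (c / 2)\<^sup>2"
  proof -
    have "(\<Sum>(i, j)\<in>D. (c' i j)\<^sup>2) = (\<Sum>(i, j)\<in>S. (c / 2)\<^sup>2)"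
      using S by (intro sum.mono_neutral_cong_right) (auto simp: c'_def)
    then show ?thesis by simp
  qed
  have ig: "integrable P (\<lambda>x. (?g x)\<^sup>2)" by (rule linear_second_moment(2))
  have ir: "integrable P ?r"
    unfolding case_prod_unfold using S by (intro Bochner_Integration.integrable_sum PP.sq_int_integrable R_sq_int) auto
  have le: "(c * (\<Sum>(i, j)\<in>S. A i j x))\<^sup>2 \<le> 2 * (?g x)\<^sup>2 + 2 * c\<^sup>2 * real (card S) * ?r x" for x
  proof -
    let ?R = "\<Sum>(i, j)\<in>S. R i j x"
    have eq: "c * (\<Sum>(i, j)\<in>S. A i j x) = ?g x + c * ?R"
      unfolding g by (simp add: A_def case_prod_unfold sum.distrib sum_divide_distrib[symmetric] algebra_simps)
    have "(?g x + c * ?R)\<^sup>2 \<le> 2 * (?g x)\<^sup>2 + 2 * (c * ?R)\<^sup>2"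
      using sum_squares_bound[of "?g x" "c * ?R"] by (simp add: power2_sum)
    moreover have "?R\<^sup>2 \<le> real (card S) * ?r x"
      using sum_squared_le_sum_of_squares[of "\<lambda>p. R (fst p) (snd p) x" S]
      by (simp add: case_prod_unfold mult.commute)
    then have "2 * (c * ?R)\<^sup>2 \<le> 2 * c\<^sup>2 * real (card S) * ?r x"
      unfolding power_mult_distrib by (simp add: mult.assoc mult_left_mono)
    ultimately show ?thesis unfolding eq by linarith
  qed
  have "(\<integral>x. (c * (\<Sum>(i, j)\<in>S. A i j x))\<^sup>2 \<partial>P) \<le> (\<integral>x. 2 * (?g x)\<^sup>2 + 2 * c\<^sup>2 * real (card S) * ?r x \<partial>P)"
    by (rule integral_mono[OF PP.sq_int_integrable[OF si] _ le])
       (intro Bochner_Integration.integrable_add integrable_mult_right ig ir)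
  moreover have "(\<integral>x. 2 * (?g x)\<^sup>2 + 2 * c\<^sup>2 * real (card S) * ?r x \<partial>P) =
      2 * (\<integral>x. (?g x)\<^sup>2 \<partial>P) + 2 * c\<^sup>2 * real (card S) * (\<integral>x. ?r x \<partial>P)"
    using ig ir by (subst Bochner_Integration.integral_add) (auto intro!: integrable_mult_right)
  moreover have "(\<integral>x. (?g x)\<^sup>2 \<partial>P) \<le> 2 * (real (card S) * (c / 2)\<^sup>2)"
    using linear_second_moment(1)[of c'] unfolding c'2 .
  moreover have "(\<integral>x. ?r x \<partial>P) \<le> real (card S) * \<delta>"
  proof -
    have "(\<integral>x. ?r x \<partial>P) = (\<Sum>p\<in>S. \<integral>x. (R (fst p) (snd p) x)\<^sup>2 \<partial>P)"
      unfolding case_prod_unfold using S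
      by (intro Bochner_Integration.integral_sum PP.sq_int_integrable R_sq_int) auto
    also have "\<dots> \<le> (\<Sum>p\<in>S. \<delta>)" using S by (intro sum_mono R_le) auto
    finally show ?thesis by simp
  qed
  then have "2 * c\<^sup>2 * real (card S) * (\<integral>x. ?r x \<partial>P) \<le> 2 * c\<^sup>2 * real (card S) * (real (card S) * \<delta>)"
    by (intro mult_left_mono) auto
  moreover have "2 * c\<^sup>2 * real (card S) * (real (card S) * \<delta>) = 2 * (c * real (card S))\<^sup>2 * \<delta>"
    by (simp add: power2_eq_square)
  moreover have "2 * (2 * (real (card S) * (c / 2)\<^sup>2)) = c\<^sup>2 * real (card S)"
    by (simp add: power2_eq_square)
  ultimately show "(\<integral>x. (c * (\<Sum>(i, j)\<in>S. A i j x))\<^sup>2 \<partial>P) \<le> c\<^sup>2 * real (card S) + 2 * (c * real (card S))\<^sup>2 * \<delta>"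
    by linarith
qed

lemma average_second_moment_le:
  assumes "S \<subseteq> D" "c\<^sup>2 * real (card S) \<le> a" "\<bar>c * real (card S)\<bar> \<le> 2"
    and f: "\<And>x. f x = c * (\<Sum>(i, j)\<in>S. A i j x)"
  shows "(\<integral>x. (f x)\<^sup>2 \<partial>P) \<le> a + 8 * \<delta>" "PP.sq_int f"
proof -
  have "(c * real (card S))\<^sup>2 \<le> 2\<^sup>2" using assms(3) by (metis abs_ge_zero power2_abs power_mono)
  then have "2 * (c * real (card S))\<^sup>2 * \<delta> \<le> 8 * \<delta>"
    using \<delta>_nonneg by (intro mult_right_mono) auto
  then show "(\<integral>x. (f x)\<^sup>2 \<partial>P) \<le> a + 8 * \<delta>"
    using average_second_moment(1)[OF assms(1), of c] assms(2) unfolding f by linarith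
  show "PP.sq_int f" unfolding f[abs_def] by (rule average_second_moment(2)[OF assms(1)])
qed

text \<open>Subtracting half the kernel from a centred entry leaves the remainder \<open>R\<close>
  and three averages, and the four-term inequality gives \<open>4 * (\<delta> + 3 * (\<gamma> + 8 *
  \<delta>)) = 12 * \<gamma> + 100 * \<delta>\<close>.\<close>

lemma centered_le:
  assumes ij: "(i, j) \<in> D"
    and b: "(\<integral>x. (b x)\<^sup>2 \<partial>P) \<le> \<gamma> + 8 * \<delta>" "PP.sq_int b"
    and c: "(\<integral>x. (c x)\<^sup>2 \<partial>P) \<le> \<gamma> + 8 * \<delta>" "PP.sq_int c"
    and d: "(\<integral>x. (d x)\<^sup>2 \<partial>P) \<le> \<gamma> + 8 * \<delta>" "PP.sq_int d"
    and f: "\<And>x. f x = A i j x - b x - c x + d x"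
  shows "(\<integral>x. (f x - G i j x / 2)\<^sup>2 \<partial>P) \<le> 12 * \<gamma> + 100 * \<delta>" "PP.sq_int f"
proof -
  have "f x - G i j x / 2 = R i j x - b x - c x + d x" for x by (simp add: f A_def)
  then show "(\<integral>x. (f x - G i j x / 2)\<^sup>2 \<partial>P) \<le> 12 * \<gamma> + 100 * \<delta>"
    using PP.expectation_square_4[OF R_sq_int[OF ij] b(2) c(2) d(2)] b(1) c(1) d(1) R_le[OF ij]
    by simp
  show "PP.sq_int f"
    unfolding f[abs_def] by (intro PP.sq_int_add PP.sq_int_diff A_sq_int ij b c d)
qed

lemma sum_Pair_eq:
  assumes "inj_on F S" "\<And>s. f s = A (fst (F s)) (snd (F s)) x"
  shows "(\<Sum>s\<in>S. f s) = (\<Sum>(i, j)\<in>F ` S. A i j x)"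
  using assms by (simp add: sum.reindex case_prod_unfold)

text \<open>Row, column and overall averages of an orthogonal array have second moment of order
  \<open>1 / q\<close>, so centring barely changes an entry. The embedding \<open>F\<close> stands
  for \<open>Inl\<close> or \<open>Inr\<close>, and one proof serves both samples.\<close>

lemma U_off_le:
  assumes q: "4 \<le> q" and F: "inj F" "\<And>k. k \<in> {1..q} \<Longrightarrow> F k \<in> {1..n} <+> {1..m}"
    and kl: "k \<in> {1..q}" "l \<in> {1..q}" "k \<noteq> l"
  shows "(\<integral>x. (U_off q (\<lambda>i j. A (F i) (F j) x) k l - G (F k) (F l) x / 2)\<^sup>2 \<partial>P) \<le> 12 * (4 / real q) + 100 * \<delta>"
    and "PP.sq_int (\<lambda>x. U_off q (\<lambda>i j. A (F i) (F j) x) k l)"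
proof -
  have FD: "i \<in> {1..q} \<Longrightarrow> j \<in> {1..q} \<Longrightarrow> i \<noteq> j \<Longrightarrow> (F i, F j) \<in> D" for i j
    using F by (simp add: D_iff inj_eq)
  have iF: "F i = F j \<longleftrightarrow> i = j" for i j using F(1) by (rule inj_eq)
  define Q where "Q = real q"
  have Q: "4 \<le> Q" using q by (simp add: Q_def)
  have e1: "(Q - 1) * Q \<le> 4 * (Q - 2)\<^sup>2"
  proof -
    have "0 \<le> (Q - 4) * (Q - 4)" by simp
    then show ?thesis using Q unfolding power2_eq_square by (simp add: algebra_simps)
  qed
  have c1: "(1 / (Q - 2))\<^sup>2 * (Q - 1) \<le> 4 / Q"
    using e1 Q by (simp add: field_simps)
  have c2: "\<bar>1 / (Q - 2) * (Q - 1)\<bar> \<le> 2" using Q by (simp add: field_simps)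
  have c3: "(1 / ((Q - 1) * (Q - 2)))\<^sup>2 * (Q * (Q - 1)) \<le> 4 / Q"
  proof -
    have "(1 / ((Q - 1) * (Q - 2)))\<^sup>2 * (Q * (Q - 1)) = Q / ((Q - 1) * (Q - 2)\<^sup>2)"
    proof -
      have "(1 / (a * b))\<^sup>2 * (c * a) = c / (a * b\<^sup>2)" if "a \<noteq> 0" "b \<noteq> 0" for a b c :: real
        using that by (simp add: power2_eq_square field_simps)
      then show ?thesis using Q by simp
    qed
    also have "\<dots> \<le> 4 / Q"
    proof -
      have "Q \<le> (Q - 1) * (Q - 1)" using Q mult_mono[of 3 "Q - 1" "Q - 1" "Q - 1"] by auto
      then have "Q * Q \<le> (Q - 1) * (Q - 1) * Q" using Q by (intro mult_right_mono) auto
      also have "\<dots> = (Q - 1) * ((Q - 1) * Q)" by simp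
      also have "\<dots> \<le> (Q - 1) * (4 * (Q - 2)\<^sup>2)" using Q e1 by (intro mult_left_mono) auto
      finally have "Q * Q \<le> 4 * ((Q - 1) * (Q - 2)\<^sup>2)" by (simp add: mult_ac)
      then show ?thesis using Q by (simp add: pos_divide_le_eq pos_le_divide_eq)
    qed
    finally show ?thesis .
  qed
  have c4: "\<bar>1 / ((Q - 1) * (Q - 2)) * (Q * (Q - 1))\<bar> \<le> 2"
  proof -
    have "1 / ((Q - 1) * (Q - 2)) * (Q * (Q - 1)) = Q / (Q - 2)" using Q by simp
    also have "\<bar>\<dots>\<bar> \<le> 2" using Q by (simp add: field_simps)
    finally show ?thesis .
  qed
  have cq: "real (card ({1..q} - {k})) = Q - 1" if "k \<in> {1..q}" for k
    using that by (simp add: of_nat_diff Q_def)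
  let ?S1 = "(\<lambda>j. (F k, F j)) ` ({1..q} - {k})" and ?S2 = "(\<lambda>i. (F i, F l)) ` ({1..q} - {l})"
  let ?S3 = "(\<lambda>p. (F (fst p), F (snd p))) ` (SIGMA i:{1..q}. {1..q} - {i})"
  have i1: "inj_on (\<lambda>j. (F k, F j)) ({1..q} - {k})" and i2: "inj_on (\<lambda>i. (F i, F l)) ({1..q} - {l})"
    and i3: "inj_on (\<lambda>p. (F (fst p), F (snd p))) (SIGMA i:{1..q}. {1..q} - {i})"
    by (simp_all add: inj_on_def iF prod_eq_iff)
  have s: "?S1 \<subseteq> D" "?S2 \<subseteq> D" "?S3 \<subseteq> D" using kl by (auto intro!: FD)
  have k1: "real (card ?S1) = Q - 1" "real (card ?S2) = Q - 1"
    using kl cq by (simp_all only: card_image[OF i1] card_image[OF i2])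
  have k3: "real (card ?S3) = Q * (Q - 1)"
  proof -
    have "card ?S3 = (\<Sum>i\<in>{1..q}. card ({1..q} - {i}))" unfolding card_image[OF i3] by simp
    then have "real (card ?S3) = (\<Sum>i\<in>{1..q}. Q - 1)" by (simp only: of_nat_sum cq cong: sum.cong)
    then show ?thesis by (simp add: Q_def)
  qed
  note b = average_second_moment_le[OF s(1), of "1 / (Q - 2)" "4 / Q" "\<lambda>x. 1 / (real q - 2) * (\<Sum>j\<in>{1..q} - {k}. A (F k) (F j) x)",
      unfolded k1, OF c1 c2]
  note c = average_second_moment_le[OF s(2), of "1 / (Q - 2)" "4 / Q" "\<lambda>x. 1 / (real q - 2) * (\<Sum>i\<in>{1..q} - {l}. A (F i) (F l) x)",
      unfolded k1, OF c1 c2]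
  note d = average_second_moment_le[OF s(3), of "1 / ((Q - 1) * (Q - 2))" "4 / Q"
      "\<lambda>x. 1 / ((real q - 1) * (real q - 2)) * (\<Sum>i=1..q. \<Sum>j\<in>{1..q} - {i}. A (F i) (F j) x)",
      unfolded k3, OF c3 c4]
  have b': "1 / (real q - 2) * (\<Sum>j\<in>{1..q} - {k}. A (F k) (F j) x) = 1 / (Q - 2) * (\<Sum>(i, j)\<in>?S1. A i j x)" for x
    unfolding Q_def by (subst sum_Pair_eq[OF i1]) auto
  have c': "1 / (real q - 2) * (\<Sum>i\<in>{1..q} - {l}. A (F i) (F l) x) = 1 / (Q - 2) * (\<Sum>(i, j)\<in>?S2. A i j x)" for x
    unfolding Q_def by (subst sum_Pair_eq[OF i2]) auto
  have d': "1 / ((real q - 1) * (real q - 2)) * (\<Sum>i=1..q. \<Sum>j\<in>{1..q} - {i}. A (F i) (F j) x) =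
      1 / ((Q - 1) * (Q - 2)) * (\<Sum>(i, j)\<in>?S3. A i j x)" for x
  proof -
    have "(\<Sum>i=1..q. \<Sum>j\<in>{1..q} - {i}. A (F i) (F j) x) =
        (\<Sum>p\<in>(SIGMA i:{1..q}. {1..q} - {i}). A (F (fst p)) (F (snd p)) x)"
      by (subst sum.Sigma) (auto simp: case_prod_unfold)
    also have "\<dots> = (\<Sum>(i, j)\<in>?S3. A i j x)" by (rule sum_Pair_eq[OF i3]) simp
    finally show ?thesis by (simp only: Q_def)
  qed
  have D: "(F k, F l) \<in> D" by (rule FD[OF kl])
  show "(\<integral>x. (U_off q (\<lambda>i j. A (F i) (F j) x) k l - G (F k) (F l) x / 2)\<^sup>2 \<partial>P) \<le> 12 * (4 / real q) + 100 * \<delta>"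
    unfolding Q_def[symmetric]
    by (rule centered_le(1)[OF D b[OF b'] c[OF c'] d[OF d']]) (simp only: U_off_def Q_def)
  show "PP.sq_int (\<lambda>x. U_off q (\<lambda>i j. A (F i) (F j) x) k l)"
    by (rule centered_le(2)[OF D b[OF b'] c[OF c'] d[OF d']]) (simp only: U_off_def Q_def)
qed

lemma H_off_le:
  assumes kl: "k \<in> {1..n}" "l \<in> {1..m}"
  shows "(\<integral>x. (H_off n m (\<lambda>i j. A (Inl i) (Inr j) x) k l - G (Inl k) (Inr l) x / 2)\<^sup>2 \<partial>P) \<le>
      12 * (1 / real n + 1 / real m) + 100 * \<delta>"
    and "PP.sq_int (\<lambda>x. H_off n m (\<lambda>i j. A (Inl i) (Inr j) x) k l)"
proof -
  define N where "N = real n"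
  define Q where "Q = real m"
  have NQ: "1 \<le> N" "1 \<le> Q" using n4 m4 by (auto simp: N_def Q_def)
  let ?S1 = "(\<lambda>i. (Inl i, Inr l)) ` {1..n} :: ((nat + nat) \<times> (nat + nat)) set"
  let ?S2 = "(\<lambda>j. (Inl k, Inr j)) ` {1..m} :: ((nat + nat) \<times> (nat + nat)) set"
  let ?S3 = "(\<lambda>p. (Inl (fst p), Inr (snd p))) ` ({1..n} \<times> {1..m}) :: ((nat + nat) \<times> (nat + nat)) set"
  have FD: "i \<in> {1..n} \<Longrightarrow> j \<in> {1..m} \<Longrightarrow> (Inl i, Inr j) \<in> D" for i j
    by (auto simp: D_iff)
  have i1: "inj_on (\<lambda>i. (Inl i, Inr l)) {1..n}" and i2: "inj_on (\<lambda>j. (Inl k, Inr j)) {1..m}"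
    and i3: "inj_on (\<lambda>p. (Inl (fst p), Inr (snd p))) ({1..n} \<times> {1..m})"
    by (simp_all add: inj_on_def prod_eq_iff)
  have s: "?S1 \<subseteq> D" "?S2 \<subseteq> D" "?S3 \<subseteq> D" using kl by (auto intro!: FD)
  have k: "real (card ?S1) = N" "real (card ?S2) = Q" "real (card ?S3) = N * Q"
    by (simp_all add: card_image[OF i1] card_image[OF i2] card_image[OF i3] card_cartesian_product N_def Q_def)
  have c1: "(1 / N)\<^sup>2 * N \<le> 1 / N + 1 / Q" "(1 / Q)\<^sup>2 * Q \<le> 1 / N + 1 / Q" "(1 / (N * Q))\<^sup>2 * (N * Q) \<le> 1 / N + 1 / Q"
  proof -
    have "(1 / N)\<^sup>2 * N = 1 / N" "(1 / Q)\<^sup>2 * Q = 1 / Q" "(1 / (N * Q))\<^sup>2 * (N * Q) = 1 / (N * Q)"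
      using NQ by (simp_all add: power2_eq_square)
    moreover have "0 < 1 / N" "0 < 1 / Q" using NQ by simp_all
    moreover have "1 / (N * Q) \<le> 1 / N" using NQ by (simp add: field_simps)
    ultimately show "(1 / N)\<^sup>2 * N \<le> 1 / N + 1 / Q" "(1 / Q)\<^sup>2 * Q \<le> 1 / N + 1 / Q"
      "(1 / (N * Q))\<^sup>2 * (N * Q) \<le> 1 / N + 1 / Q" by linarith+
  qed
  have c2: "\<bar>1 / N * N\<bar> \<le> 2" "\<bar>1 / Q * Q\<bar> \<le> 2" "\<bar>1 / (N * Q) * (N * Q)\<bar> \<le> 2" using NQ by simp_all
  note b = average_second_moment_le[OF s(1), of "1 / N" "1 / N + 1 / Q" "\<lambda>x. 1 / real n * (\<Sum>i=1..n. A (Inl i) (Inr l) x)",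
      unfolded k, OF c1(1) c2(1)]
  note c = average_second_moment_le[OF s(2), of "1 / Q" "1 / N + 1 / Q" "\<lambda>x. 1 / real m * (\<Sum>j=1..m. A (Inl k) (Inr j) x)",
      unfolded k, OF c1(2) c2(2)]
  note d = average_second_moment_le[OF s(3), of "1 / (N * Q)" "1 / N + 1 / Q"
      "\<lambda>x. 1 / (real n * real m) * (\<Sum>i=1..n. \<Sum>j=1..m. A (Inl i) (Inr j) x)", unfolded k, OF c1(3) c2(3)]
  have b': "1 / real n * (\<Sum>i=1..n. A (Inl i) (Inr l) x) = 1 / N * (\<Sum>(i, j)\<in>?S1. A i j x)" for x
    unfolding N_def by (subst sum_Pair_eq[OF i1]) auto
  have c': "1 / real m * (\<Sum>j=1..m. A (Inl k) (Inr j) x) = 1 / Q * (\<Sum>(i, j)\<in>?S2. A i j x)" for x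
    unfolding Q_def by (subst sum_Pair_eq[OF i2]) auto
  have d': "1 / (real n * real m) * (\<Sum>i=1..n. \<Sum>j=1..m. A (Inl i) (Inr j) x) = 1 / (N * Q) * (\<Sum>(i, j)\<in>?S3. A i j x)" for x
  proof -
    have "(\<Sum>i=1..n. \<Sum>j=1..m. A (Inl i) (Inr j) x) = (\<Sum>p\<in>{1..n} \<times> {1..m}. A (Inl (fst p)) (Inr (snd p)) x)"
      by (simp add: sum.cartesian_product case_prod_unfold)
    also have "\<dots> = (\<Sum>(i, j)\<in>?S3. A i j x)" by (rule sum_Pair_eq[OF i3]) simp
    finally show ?thesis by (simp only: N_def Q_def)
  qed
  have D: "(Inl k, Inr l) \<in> D" by (rule FD[OF kl])
  show "(\<integral>x. (H_off n m (\<lambda>i j. A (Inl i) (Inr j) x) k l - G (Inl k) (Inr l) x / 2)\<^sup>2 \<partial>P) \<le>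
      12 * (1 / real n + 1 / real m) + 100 * \<delta>"
    unfolding N_def[symmetric] Q_def[symmetric]
    by (rule centered_le(1)[OF D b[OF b'] c[OF c'] d[OF d']]) (simp only: H_off_def N_def Q_def)
  show "PP.sq_int (\<lambda>x. H_off n m (\<lambda>i j. A (Inl i) (Inr j) x) k l)"
    by (rule centered_le(2)[OF D b[OF b'] c[OF c'] d[OF d']]) (simp only: H_off_def N_def Q_def)
qed

end

section \<open>The statistics as sums over ordered pairs of pooled points\<close>

context two_sample
begin

abbreviation N :: real where "N \<equiv> real n + real m"

lemma card_pooled: "real (card ({1..n} <+> {1..m})) = N"
  by (simp add: card_Plus)

lemma sum_D_blocks:
  fixes f :: "(nat + nat) \<times> (nat + nat) \<Rightarrow> real"
  shows "(\<Sum>p\<in>D. f p) = (\<Sum>k=1..n. \<Sum>l\<in>{1..n}-{k}. f (Inl k, Inl l)) + (\<Sum>k=1..n. \<Sum>l=1..m. f (Inl k, Inr l))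
    + (\<Sum>k=1..n. \<Sum>l=1..m. f (Inr l, Inl k)) + (\<Sum>k=1..m. \<Sum>l\<in>{1..m}-{k}. f (Inr k, Inr l))"
proof -
  have l: "({1..n} <+> {1..m}) - {Inl k} = ({1..n} - {k}) <+> {1..m}" for k by auto
  have r: "({1..n} <+> {1..m}) - {Inr k} = {1..n} <+> ({1..m} - {k})" for k by auto
  have "(\<Sum>p\<in>D. f p) = (\<Sum>k=1..n. (\<Sum>l\<in>{1..n}-{k}. f (Inl k, Inl l)) + (\<Sum>l=1..m. f (Inl k, Inr l)))
     + (\<Sum>l=1..m. (\<Sum>k=1..n. f (Inr l, Inl k)) + (\<Sum>k\<in>{1..m}-{l}. f (Inr l, Inr k)))"
    unfolding sum_D by (simp add: sum.Plus l r)
  also have "(\<Sum>l=1..m. (\<Sum>k=1..n. f (Inr l, Inl k)) + (\<Sum>k\<in>{1..m}-{l}. f (Inr l, Inr k))) =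
     (\<Sum>k=1..n. \<Sum>l=1..m. f (Inr l, Inl k)) + (\<Sum>k=1..m. \<Sum>l\<in>{1..m}-{k}. f (Inr k, Inr l))"
    unfolding sum.distrib by (subst (1) sum.swap) simp
  finally show ?thesis by (simp add: sum.distrib)
qed

lemma sum_offdiag_const: "(\<Sum>k=1..q. \<Sum>l\<in>{1..q}-{k}. c) = real q * (real q - 1) * (c :: real)"
proof -
  have "(\<Sum>l\<in>{1..q}-{k}. c) = (real q - 1) * c" if "k \<in> {1..q}" for k
    using that by (simp add: of_nat_diff)
  then have "(\<Sum>k=1..q. \<Sum>l\<in>{1..q}-{k}. c) = (\<Sum>k=1..q. (real q - 1) * c)"
    by (intro sum.cong refl)
  then show ?thesis by simp
qed

lemma card_D: "real (card D) = N * (N - 1)"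
proof -
  have "real (card D) = (\<Sum>p\<in>D. 1)" by simp
  also have "\<dots> = real n * (real n - 1) + real n * real m + real n * real m + real m * (real m - 1)"
    unfolding sum_D_blocks sum_offdiag_const by simp
  finally show ?thesis by (simp add: algebra_simps)
qed

text \<open>The coefficient \<open>2 / (n * m)\<close> of the energy statistic is shared by the two
  orders of a cross pair, whereas the within-sample sums already run over ordered pairs. This makes
  the weights symmetric.\<close>

definition wt :: "nat + nat \<Rightarrow> nat + nat \<Rightarrow> real" where
  "wt i j = (case i of
      Inl _ \<Rightarrow> (case j of Inl _ \<Rightarrow> - 1 / (real n * (real n - 1)) | Inr _ \<Rightarrow> 1 / (real n * real m))
    | Inr _ \<Rightarrow> (case j of Inl _ \<Rightarrow> 1 / (real n * real m) | Inr _ \<Rightarrow> - 1 / (real m * (real m - 1)))) / a_const n m"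

lemma wt_sym: "wt i j = wt j i"
  by (simp add: wt_def split: sum.split)

lemma a_const_square: "(a_const n m)\<^sup>2 = 1 / (real n * real m) + 1 / (2 * real n * (real n - 1)) + 1 / (2 * real m * (real m - 1))"
  using n4 m4 unfolding a_const_def by (intro real_sqrt_pow2 add_nonneg_nonneg divide_nonneg_nonneg mult_nonneg_nonneg) auto

text \<open>The bound is half of \<open>1 / n + 1 / m\<close>. Twice its square is
  \<open>a_const^2\<close> with \<open>n * (n - 1)\<close> and \<open>m * (m - 1)\<close> replaced
  by the larger \<open>n^2\<close> and \<open>m^2\<close>.\<close>

lemma a_const_ge: "N / (real n * real m * 2) \<le> a_const n m"
proof (rule power2_le_imp_le)
  have nm: "4 \<le> real n" "4 \<le> real m" using n4 m4 by auto
  have "(N / (real n * real m * 2))\<^sup>2 \<le> 2 * (N / (real n * real m * 2))\<^sup>2" by simp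
  also have "\<dots> = 1 / (real n * real m) + 1 / (2 * real n * real n) + 1 / (2 * real m * real m)"
    using nm by (simp add: power2_eq_square field_simps)
  also have "\<dots> \<le> (a_const n m)\<^sup>2"
    unfolding a_const_square using nm
    by (intro add_mono order_refl divide_left_mono mult_left_mono mult_pos_pos) auto
  finally show "(N / (real n * real m * 2))\<^sup>2 \<le> (a_const n m)\<^sup>2" .
  show "0 \<le> a_const n m" unfolding a_const_def
    using nm by (intro real_sqrt_ge_zero add_nonneg_nonneg divide_nonneg_nonneg mult_nonneg_nonneg) auto
qed

lemma a_const_pos: "0 < a_const n m"
proof -
  have "0 < N / (real n * real m * 2)" using n4 m4 by (intro divide_pos_pos mult_pos_pos) auto
  then show ?thesis using a_const_ge by linarith
qed

text \<open>The square of \<open>a_const\<close> is half the sum of the squared coefficients of the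
  energy statistic. This is the origin of its formula, and it yields the normalisation demanded by
  the normal approximation.\<close>

lemma wt_square_sum: "(\<Sum>(i, j)\<in>D. (wt i j)\<^sup>2) = 2"
proof -
  have nm: "real n \<noteq> 0" "real m \<noteq> 0" "real n - 1 \<noteq> 0" "real m - 1 \<noteq> 0" using n4 m4 by auto
  have "(\<Sum>(i, j)\<in>D. (wt i j)\<^sup>2) =
      (real n * (real n - 1) * (1 / (real n * (real n - 1)))\<^sup>2 + 2 * (real n * real m * (1 / (real n * real m))\<^sup>2)
       + real m * (real m - 1) * (1 / (real m * (real m - 1)))\<^sup>2) / (a_const n m)\<^sup>2"
    unfolding case_prod_unfold sum_D_blocks
    by (simp add: wt_def sum_offdiag_const power_divide power_mult_distrib add_divide_distrib mult_ac)
  also have "real n * (real n - 1) * (1 / (real n * (real n - 1)))\<^sup>2 + 2 * (real n * real m * (1 / (real n * real m))\<^sup>2)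
       + real m * (real m - 1) * (1 / (real m * (real m - 1)))\<^sup>2 = 2 * (a_const n m)\<^sup>2"
  proof -
    have "a * b * (1 / (a * b))\<^sup>2 = 1 / (a * b)" if "a \<noteq> 0" "b \<noteq> 0" for a b :: real
      using that by (simp add: power2_eq_square)
    then show ?thesis using nm unfolding a_const_square by (simp add: mult.assoc)
  qed
  finally show ?thesis using a_const_pos by simp
qed

text \<open>Comparability of the sample sizes enters here: each coefficient times
  \<open>n * m\<close> is at most \<open>2 * c\<close>, since \<open>b / (a - 1) \<le> 2 * c\<close>
  whenever \<open>b \<le> c * a\<close> and \<open>4 \<le> a\<close>. The lower bound on
  \<open>a_const\<close> then contributes the factor \<open>2 / N\<close>.\<close>

lemma wt_le:
  assumes c: "real m \<le> c * real n" "real n \<le> c * real m"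
  shows "\<bar>wt i j\<bar> \<le> 4 * c / N"
proof -
  have nm: "4 \<le> real n" "4 \<le> real m" using n4 m4 by auto
  have c1: "1 \<le> c"
  proof (rule ccontr)
    assume "\<not> 1 \<le> c"
    then have "c * real n < 1 * real n" "c * real m < 1 * real m"
      using nm by (intro mult_strict_right_mono; auto)+
    then show False using c by linarith
  qed
  have N: "0 < N" using nm by linarith
  have main: "z / a_const n m \<le> 4 * c / N" if "0 \<le> z" "z * (real n * real m) \<le> 2 * c" for z
  proof -
    have "z / a_const n m \<le> z / (N / (real n * real m * 2))"
      using a_const_ge that(1) N nm by (intro divide_left_mono mult_pos_pos divide_pos_pos a_const_pos) auto
    also have "\<dots> = 2 * (z * (real n * real m)) / N" by simp
    also have "\<dots> \<le> 2 * (2 * c) / N" using that(2) N by (intro divide_right_mono mult_left_mono) auto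
    finally show ?thesis by simp
  qed
  have b1: "1 / (real n * real m) * (real n * real m) \<le> 2 * c" using nm c1 by simp
  have b2: "1 / (a * (a - 1)) * (a * b) \<le> 2 * c" if "4 \<le> a" "b \<le> c * a" "0 \<le> b" for a b :: real
  proof -
    have "1 / (a * (a - 1)) * (a * b) = b / (a - 1)" using that by simp
    also have "\<dots> \<le> c * a / (a - 1)" using that by (intro divide_right_mono) auto
    also have "\<dots> \<le> 2 * c"
    proof -
      have "c * a \<le> c * (2 * (a - 1))" using that c1 by (intro mult_left_mono) auto
      then show ?thesis using that by (simp add: pos_divide_le_eq mult_ac)
    qed
    finally show ?thesis .
  qed
  have m1: "1 / (real n * real m) / a_const n m \<le> 4 * c / N"
    by (rule main[OF _ b1]) simp
  have m2: "1 / (real n * (real n - 1)) / a_const n m \<le> 4 * c / N"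
    using nm by (intro main b2 c) auto
  have m3: "1 / (real m * (real m - 1)) / a_const n m \<le> 4 * c / N"
    using nm b2[of "real m" "real n"] c by (intro main) (auto simp: mult.commute[of "real n"])
  show ?thesis
    using m1 m2 m3 a_const_pos nm unfolding wt_def by (auto simp: abs_mult split: sum.split)
qed

definition rem :: "(nat + nat \<Rightarrow> 'a) \<Rightarrow> real" where
  "rem x = (\<Sum>(i, j)\<in>D. wt i j * R i j x)"

definition energy_A :: "(nat + nat \<Rightarrow> 'a) \<Rightarrow> real" where
  "energy_A x = 2 / (real n * real m) * (\<Sum>k=1..n. \<Sum>l=1..m. A (Inl k) (Inr l) x)
     - 1 / (real n * (real n - 1)) * (\<Sum>k=1..n. \<Sum>l\<in>{1..n}-{k}. A (Inl k) (Inl l) x)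
     - 1 / (real m * (real m - 1)) * (\<Sum>k=1..m. \<Sum>l\<in>{1..m}-{k}. A (Inr k) (Inr l) x)"

lemma A_Inr_Inl: "A (Inr k) (Inl l) x = A (Inl l) (Inr k) x"
  by (rule fun_cong[OF A_sym])

text \<open>The half in front of the kernel in \<open>A\<close> is the half in \<open>Ww\<close>, so
  no further factor appears.\<close>

lemma energy_A_eq: "energy_A x / a_const n m = Ww wt x + rem x"
proof -
  have "Ww wt x + rem x = (\<Sum>p\<in>D. wt (fst p) (snd p) * A (fst p) (snd p) x)"
    unfolding Ww_def rem_def A_def case_prod_unfold
    by (simp add: sum_divide_distrib distrib_left flip: sum.distrib)
  also have "\<dots> = energy_A x / a_const n m"
    unfolding sum_D_blocks A_Inr_Inl energy_A_def fst_conv snd_conv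
    by (simp add: wt_def sum_distrib_left sum_divide_distrib add_divide_distrib diff_divide_distrib sum_negf
        sum.distrib[symmetric] mult_ac)
  finally show ?thesis by simp
qed

text \<open>No cancellation is available here: fewer than \<open>N^2\<close> terms, each with weight
  at most \<open>4 * c / N\<close> and \<open>L^1\<close> norm at most \<open>sqrt \<delta>\<close>,
  are added in absolute value.\<close>

lemma rem_L1:
  assumes c: "real m \<le> c * real n" "real n \<le> c * real m"
  shows "(\<integral>x. \<bar>rem x\<bar> \<partial>P) \<le> 4 * c * (N * sqrt \<delta>)" "integrable P rem"
proof -
  have iR: "integrable P (R i j)" if "(i, j) \<in> D" for i j
    using R_sq_int[OF that] unfolding PP.sq_int_def by (auto intro: PP.integrable_if_square)
  show i: "integrable P rem"
    unfolding rem_def[abs_def] case_prod_unfold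
    by (intro Bochner_Integration.integrable_sum integrable_mult_right iR) simp
  have N: "8 \<le> N" using n4 m4 by simp
  have c0: "0 \<le> 4 * c / N" using wt_le[OF c, of undefined undefined] by linarith
  have "(\<integral>x. \<bar>rem x\<bar> \<partial>P) \<le> (\<integral>x. (\<Sum>p\<in>D. 4 * c / N * \<bar>R (fst p) (snd p) x\<bar>) \<partial>P)"
  proof (rule integral_mono)
    show "integrable P (\<lambda>x. \<bar>rem x\<bar>)" using i by (rule integrable_abs)
    show "integrable P (\<lambda>x. \<Sum>p\<in>D. 4 * c / N * \<bar>R (fst p) (snd p) x\<bar>)"
      by (intro Bochner_Integration.integrable_sum integrable_mult_right integrable_abs iR) simp
    fix x
    have "\<bar>rem x\<bar> \<le> (\<Sum>p\<in>D. \<bar>wt (fst p) (snd p) * R (fst p) (snd p) x\<bar>)"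
      unfolding rem_def case_prod_unfold by (rule sum_abs)
    also have "\<dots> \<le> (\<Sum>p\<in>D. 4 * c / N * \<bar>R (fst p) (snd p) x\<bar>)"
      unfolding abs_mult by (intro sum_mono mult_right_mono wt_le c) auto
    finally show "\<bar>rem x\<bar> \<le> (\<Sum>p\<in>D. 4 * c / N * \<bar>R (fst p) (snd p) x\<bar>)" .
  qed
  also have "\<dots> = (\<Sum>p\<in>D. 4 * c / N * (\<integral>x. \<bar>R (fst p) (snd p) x\<bar> \<partial>P))"
    by (subst Bochner_Integration.integral_sum) (auto intro!: integrable_mult_right integrable_abs iR)
  also have "\<dots> \<le> (\<Sum>p\<in>D. 4 * c / N * sqrt \<delta>)"
  proof (intro sum_mono mult_left_mono c0)
    fix p assume p: "p \<in> D"
    then have p': "(fst p, snd p) \<in> D" by simp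
    show "(\<integral>x. \<bar>R (fst p) (snd p) x\<bar> \<partial>P) \<le> sqrt \<delta>"
      using R_sq_int[OF p'] R_le[OF p'] unfolding PP.sq_int_def by (intro PP.expectation_le_sqrt) auto
  qed
  also have "\<dots> = N * (N - 1) * (4 * c / N * sqrt \<delta>)" by (simp add: card_D)
  also have "\<dots> \<le> N * N * (4 * c / N * sqrt \<delta>)"
    using c0 N \<delta>_nonneg by (intro mult_right_mono mult_left_mono mult_nonneg_nonneg) auto
  also have "\<dots> = 4 * c * (N * sqrt \<delta>)" using N by (simp add: field_simps)
  finally show "(\<integral>x. \<bar>rem x\<bar> \<partial>P) \<le> 4 * c * (N * sqrt \<delta>)" .
qed

text \<open>Both orders of a cross pair receive the same entry of the rectangular centring. The
  different factors 4 and 2 in the estimator then merge into a single factor 2 over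
  \<open>D\<close>.\<close>

definition cen :: "(nat + nat) \<times> (nat + nat) \<Rightarrow> (nat + nat \<Rightarrow> 'a) \<Rightarrow> real" where
  "cen p x = (case p of
      (Inl k, Inl l) \<Rightarrow> U_off n (\<lambda>i j. A (Inl i) (Inl j) x) k l
    | (Inl k, Inr l) \<Rightarrow> H_off n m (\<lambda>i j. A (Inl i) (Inr j) x) k l
    | (Inr l, Inl k) \<Rightarrow> H_off n m (\<lambda>i j. A (Inl i) (Inr j) x) k l
    | (Inr k, Inr l) \<Rightarrow> U_off m (\<lambda>i j. A (Inr i) (Inr j) x) k l)"

definition S_A :: "(nat + nat \<Rightarrow> 'a) \<Rightarrow> real" where
  "S_A x = (4 * (\<Sum>k=1..n. \<Sum>l=1..m. (H_off n m (\<lambda>i j. A (Inl i) (Inr j) x) k l)\<^sup>2)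
     + 2 * (\<Sum>k=1..n. \<Sum>l\<in>{1..n}-{k}. (U_off n (\<lambda>i j. A (Inl i) (Inl j) x) k l)\<^sup>2)
     + 2 * (\<Sum>k=1..m. \<Sum>l\<in>{1..m}-{k}. (U_off m (\<lambda>i j. A (Inr i) (Inr j) x) k l)\<^sup>2)) / S_den n m"

lemma S_A_eq: "S_A x = 2 * (\<Sum>p\<in>D. (cen p x)\<^sup>2) / S_den n m"
  unfolding sum_D_blocks by (simp add: S_A_def cen_def algebra_simps)

text \<open>The constant \<open>48 = 12 * 4\<close> covers both the within-sample rate
  \<open>4 / q\<close> and the cross rate \<open>1 / n + 1 / m\<close>.\<close>

lemma cen_le:
  assumes p: "p \<in> D"
  shows "(\<integral>x. (cen p x - G (fst p) (snd p) x / 2)\<^sup>2 \<partial>P) \<le> 48 * (1 / real n + 1 / real m) + 100 * \<delta>"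
    and "PP.sq_int (cen p)"
proof -
  have le12: "12 * (1 / real n + 1 / real m) + 100 * \<delta> \<le> 48 * (1 / real n + 1 / real m) + 100 * \<delta>"
    by (intro add_right_mono mult_right_mono) auto
  obtain i j where ij: "p = (i, j)" by (cases p)
  have "(\<integral>x. (cen p x - G (fst p) (snd p) x / 2)\<^sup>2 \<partial>P) \<le> 48 * (1 / real n + 1 / real m) + 100 * \<delta> \<and> PP.sq_int (cen p)"
  proof (cases i)
    case i: (Inl k)
    show ?thesis
    proof (cases j)
      case j: (Inl l)
      have kl: "k \<in> {1..n}" "l \<in> {1..n}" "k \<noteq> l" using p unfolding ij i j D_iff by auto
      show ?thesis
        using U_off_le[OF n4 inj_Inl InlI kl] by (auto simp: ij i j cen_def[abs_def] intro: order_trans)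
    next
      case j: (Inr l)
      have kl: "k \<in> {1..n}" "l \<in> {1..m}" using p unfolding ij i j D_iff by auto
      show ?thesis
        using order_trans[OF H_off_le(1)[OF kl] le12] H_off_le(2)[OF kl] by (auto simp: ij i j cen_def[abs_def] intro: order_trans)
    qed
  next
    case i: (Inr k)
    show ?thesis
    proof (cases j)
      case j: (Inl l)
      have kl: "l \<in> {1..n}" "k \<in> {1..m}" using p unfolding ij i j D_iff by auto
      show ?thesis
        using order_trans[OF H_off_le(1)[OF kl] le12] H_off_le(2)[OF kl] by (auto simp: ij i j cen_def[abs_def] intro: order_trans simp: G_sym[of "Inr k" "Inl l"])
    next
      case j: (Inr l)
      have kl: "k \<in> {1..m}" "l \<in> {1..m}" "k \<noteq> l" using p unfolding ij i j D_iff by auto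
      show ?thesis
        using U_off_le[OF m4 inj_Inr InrI kl] by (auto simp: ij i j cen_def[abs_def] intro: order_trans)
    qed
  qed
  then show "(\<integral>x. (cen p x - G (fst p) (snd p) x / 2)\<^sup>2 \<partial>P) \<le> 48 * (1 / real n + 1 / real m) + 100 * \<delta>"
    and "PP.sq_int (cen p)" by auto
qed

text \<open>Three errors add up: replacing a centred entry by half the kernel, fluctuation of the
  sum of squares, and the mismatch between the degrees of freedom \<open>S_den\<close> and half the
  number of ordered pairs. The mismatch is \<open>2 * N - 1\<close> and produces the term
  \<open>8 / N\<close>.\<close>

lemma S_A_L1:
  assumes \<epsilon>: "0 \<le> \<epsilon>" and A: "A4 \<le> \<epsilon> * N\<^sup>2" and B: "B4 \<le> \<epsilon> * N" and N: "10 \<le> N"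
  defines "\<beta> \<equiv> 48 * (1 / real n + 1 / real m) + 100 * \<delta>"
  shows "(\<integral>x. \<bar>S_A x - 1\<bar> \<partial>P) \<le> 2 * (4 * sqrt \<beta> + 4 * \<beta>) + 6 * sqrt \<epsilon> + 8 / N"
    and "integrable P (\<lambda>x. \<bar>S_A x - 1\<bar>)" and "S_A \<in> borel_measurable P"
proof -
  have \<beta>: "0 < \<beta>"
    unfolding \<beta>_def using n4 m4 \<delta>_nonneg by (intro add_pos_nonneg mult_pos_pos add_pos_pos) auto
  have den: "S_den n m = N\<^sup>2 / 2 - 5 * N / 2 + 1"
    by (simp add: S_den_def v_const_def power2_eq_square field_simps)
  \<comment> \<open>This comparison is the origin of the threshold 10:
    \<open>N^2 / 4 - 5 * N / 2 + 1\<close> is positive from there on.\<close>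
  have den_ge: "N\<^sup>2 / 4 \<le> S_den n m"
  proof -
    have "10 * N \<le> N * N" using N by (intro mult_right_mono) auto
    moreover have "10 * q \<le> q * q \<Longrightarrow> q\<^sup>2 / 4 \<le> q\<^sup>2 / 2 - 5 * q / 2 + 1" for q :: real
      unfolding power2_eq_square by linarith
    ultimately show ?thesis unfolding den by blast
  qed
  have N2: "0 < N\<^sup>2 / 4" using N by simp
  have den_pos: "0 < S_den n m" using den_ge N2 by linarith
  let ?U = "\<lambda>p x. \<bar>4 * (cen p x)\<^sup>2 - (G (fst p) (snd p) x)\<^sup>2\<bar>"
  let ?V = "\<lambda>x. \<bar>\<Sum>(i, j)\<in>D. (G i j x)\<^sup>2 - 1\<bar>"
  have U: "(\<integral>x. ?U p x \<partial>P) \<le> 4 * sqrt \<beta> + 4 * \<beta>" "integrable P (?U p)" if p: "p \<in> D" for p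
  proof -
    have p': "(fst p, snd p) \<in> D" using p by simp
    have "(\<integral>x. (G (fst p) (snd p) x)\<^sup>2 \<partial>P) \<le> 1" using p' unfolding D_iff by (simp add: E_unit)
    note pp = PP.perturbed_square_L1[OF G_sq_int[OF p'] this cen_le(2)[OF p] cen_le(1)[OF p, folded \<beta>_def] \<beta>]
    show "(\<integral>x. ?U p x \<partial>P) \<le> 4 * sqrt \<beta> + 4 * \<beta>" by (rule pp(1))
    show "integrable P (?U p)" by (rule pp(2))
  qed
  have V: "(\<integral>x. ?V x \<partial>P) \<le> 3 * (N\<^sup>2 * sqrt \<epsilon>)" "integrable P ?V"
    using sum_G_square_L1[OF \<epsilon>] A B by (simp_all only: card_pooled)
  let ?b = "\<lambda>x. ((\<Sum>p\<in>D. ?U p x) / 2 + ?V x / 2 + 2 * N) / S_den n m"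
  have iU: "integrable P (\<lambda>x. \<Sum>p\<in>D. ?U p x)" by (intro Bochner_Integration.integrable_sum U)
  have ib: "integrable P ?b" using iU V(2) by auto
  have le: "\<bar>S_A x - 1\<bar> \<le> ?b x" for x
  proof -
    have eq: "S_A x - 1 = ((\<Sum>p\<in>D. 4 * (cen p x)\<^sup>2 - (G (fst p) (snd p) x)\<^sup>2) / 2 + (\<Sum>(i, j)\<in>D. (G i j x)\<^sup>2 - 1) / 2
        + (2 * N - 1)) / S_den n m"
    proof -
      have "(\<Sum>(i, j)\<in>D. (G i j x)\<^sup>2 - 1) = (\<Sum>p\<in>D. (G (fst p) (snd p) x)\<^sup>2) - N * (N - 1)"
        by (simp add: case_prod_unfold sum_subtractf card_D)
      moreover have "(\<Sum>p\<in>D. 4 * (cen p x)\<^sup>2 - (G (fst p) (snd p) x)\<^sup>2) =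
          4 * (\<Sum>p\<in>D. (cen p x)\<^sup>2) - (\<Sum>p\<in>D. (G (fst p) (snd p) x)\<^sup>2)"
        by (simp add: sum_subtractf sum_distrib_left)
      moreover have "2 * N - 1 = N * (N - 1) / 2 - S_den n m"
        unfolding den by (simp add: power2_eq_square field_simps)
      moreover have "2 * s / d - 1 = ((4 * s - g) / 2 + (g - u) / 2 + (u / 2 - d)) / d" if "d \<noteq> 0" for s d g u :: real
        using that by (simp add: field_simps)
      ultimately show ?thesis unfolding S_A_eq using den_pos by simp
    qed
    have gen: "\<bar>a / 2 + b / 2 + (2 * q - 1)\<bar> \<le> a' / 2 + \<bar>b\<bar> / 2 + 2 * q" if "\<bar>a\<bar> \<le> a'" "10 \<le> q" for a a' b q :: real
      using that by linarith
    have "\<bar>(\<Sum>p\<in>D. 4 * (cen p x)\<^sup>2 - (G (fst p) (snd p) x)\<^sup>2)\<bar> \<le> (\<Sum>p\<in>D. ?U p x)" by (rule sum_abs)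
    from gen[OF this N] have "\<bar>(\<Sum>p\<in>D. 4 * (cen p x)\<^sup>2 - (G (fst p) (snd p) x)\<^sup>2) / 2 + (\<Sum>(i, j)\<in>D. (G i j x)\<^sup>2 - 1) / 2
        + (2 * N - 1)\<bar> \<le> (\<Sum>p\<in>D. ?U p x) / 2 + ?V x / 2 + 2 * N" .
    then show ?thesis unfolding eq abs_divide using den_pos by (simp add: divide_right_mono)
  qed
  have cm: "cen p \<in> borel_measurable P" if "p \<in> D" for p
    using cen_le(2)[OF that] by (rule PP.sq_int_measurable)
  show m: "S_A \<in> borel_measurable P"
    unfolding S_A_eq[abs_def]
    by (intro borel_measurable_divide borel_measurable_times borel_measurable_sum borel_measurable_power borel_measurable_const cm)
  show i: "integrable P (\<lambda>x. \<bar>S_A x - 1\<bar>)"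
  proof (rule Bochner_Integration.integrable_bound[OF ib])
    show "(\<lambda>x. \<bar>S_A x - 1\<bar>) \<in> borel_measurable P" using m by measurable
    show "AE x in P. norm \<bar>S_A x - 1\<bar> \<le> norm (?b x)"
      using le by (intro AE_I2) (simp only: real_norm_def abs_idempotent order_trans[OF le abs_ge_self])
  qed
  have "(\<integral>x. \<bar>S_A x - 1\<bar> \<partial>P) \<le> (\<integral>x. ?b x \<partial>P)" by (rule integral_mono[OF i ib le])
  moreover have "(\<integral>x. ?b x \<partial>P) = ((\<Sum>p\<in>D. \<integral>x. ?U p x \<partial>P) / 2 + (\<integral>x. ?V x \<partial>P) / 2 + 2 * N) / S_den n m"
  proof -
    have "(\<integral>x. (\<Sum>p\<in>D. ?U p x) \<partial>P) = (\<Sum>p\<in>D. \<integral>x. ?U p x \<partial>P)"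
      by (rule Bochner_Integration.integral_sum) (rule U)
    moreover have "(\<integral>x. (u x / 2 + v x / 2 + c) / d \<partial>P) = ((\<integral>x. u x \<partial>P) / 2 + (\<integral>x. v x \<partial>P) / 2 + c) / d"
      if "integrable P u" "integrable P v" for u v :: "_ \<Rightarrow> real" and c d :: real
      using that by (simp add: PP.prob_space)
    ultimately show ?thesis using iU V(2) by simp
  qed
  moreover have "((\<Sum>p\<in>D. \<integral>x. ?U p x \<partial>P) / 2 + (\<integral>x. ?V x \<partial>P) / 2 + 2 * N) / S_den n m \<le>
      (N\<^sup>2 * (4 * sqrt \<beta> + 4 * \<beta>) / 2 + 3 * (N\<^sup>2 * sqrt \<epsilon>) / 2 + 2 * N) / (N\<^sup>2 / 4)"
  proof (rule frac_le)
    have "(\<Sum>p\<in>D. \<integral>x. ?U p x \<partial>P) \<le> (\<Sum>p\<in>D. 4 * sqrt \<beta> + 4 * \<beta>)" by (intro sum_mono U)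
    also have "\<dots> = N * (N - 1) * (4 * sqrt \<beta> + 4 * \<beta>)" by (simp add: card_D)
    also have "\<dots> \<le> N\<^sup>2 * (4 * sqrt \<beta> + 4 * \<beta>)"
      unfolding power2_eq_square using \<beta> N by (intro mult_right_mono mult_left_mono) auto
    finally show "(\<Sum>p\<in>D. \<integral>x. ?U p x \<partial>P) / 2 + (\<integral>x. ?V x \<partial>P) / 2 + 2 * N \<le>
        N\<^sup>2 * (4 * sqrt \<beta> + 4 * \<beta>) / 2 + 3 * (N\<^sup>2 * sqrt \<epsilon>) / 2 + 2 * N"
      using V(1) by linarith
    show "0 \<le> N\<^sup>2 * (4 * sqrt \<beta> + 4 * \<beta>) / 2 + 3 * (N\<^sup>2 * sqrt \<epsilon>) / 2 + 2 * N"
      using \<beta> \<epsilon> N by (intro add_nonneg_nonneg) auto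
  qed (use N2 den_ge in auto)
  moreover have "(N\<^sup>2 * (4 * sqrt \<beta> + 4 * \<beta>) / 2 + 3 * (N\<^sup>2 * sqrt \<epsilon>) / 2 + 2 * N) / (N\<^sup>2 / 4) =
      2 * (4 * sqrt \<beta> + 4 * \<beta>) + 6 * sqrt \<epsilon> + 8 / N"
  proof -
    have f: "(q\<^sup>2 * b / 2 + 3 * (q\<^sup>2 * e) / 2 + 2 * q) / (q\<^sup>2 / 4) = 2 * b + 6 * e + 8 / q" if "q \<noteq> 0" for q b e :: real
      using that by (simp add: field_simps power2_eq_square)
    have "N \<noteq> 0" using N by linarith
    then show ?thesis by (rule f)
  qed
  ultimately show "(\<integral>x. \<bar>S_A x - 1\<bar> \<partial>P) \<le> 2 * (4 * sqrt \<beta> + 4 * \<beta>) + 6 * sqrt \<epsilon> + 8 / N" by linarith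
qed

end

section \<open>From the product space to the sample\<close>

lemma (in prob_space) distr_iid_pool:
  assumes ind: "indep_vars (\<lambda>_. B) Z UNIV" and id: "\<And>i. distr M B (Z i) = \<mu>" and J: "J \<noteq> {}"
  shows "distr M (\<Pi>\<^sub>M _\<in>J. \<mu>) (\<lambda>\<omega>. \<lambda>i\<in>J. Z i \<omega>) = (\<Pi>\<^sub>M _\<in>J. \<mu>)"
    and "(\<lambda>\<omega>. \<lambda>i\<in>J. Z i \<omega>) \<in> measurable M (\<Pi>\<^sub>M _\<in>J. \<mu>)"
proof -
  have rv: "random_variable B (Z i)" for i using ind by (auto simp: indep_vars_def)
  have s: "sets (\<Pi>\<^sub>M _\<in>J. B) = sets (\<Pi>\<^sub>M _\<in>J. \<mu>)"
    using id[of undefined] by (intro sets_PiM_cong) auto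
  have "indep_vars (\<lambda>_. B) Z J" using ind by (rule indep_vars_subset) simp
  then have "distr M (\<Pi>\<^sub>M _\<in>J. B) (\<lambda>\<omega>. \<lambda>i\<in>J. Z i \<omega>) = (\<Pi>\<^sub>M i\<in>J. distr M B (Z i))"
    using indep_vars_iff_distr_eq_PiM'[OF J, where M' = "\<lambda>_. B" and X = Z] rv by simp
  then show "distr M (\<Pi>\<^sub>M _\<in>J. \<mu>) (\<lambda>\<omega>. \<lambda>i\<in>J. Z i \<omega>) = (\<Pi>\<^sub>M _\<in>J. \<mu>)"
    unfolding id using s by (metis (no_types) distr_cong)
  have "(\<lambda>\<omega>. \<lambda>i\<in>J. Z i \<omega>) \<in> measurable M (\<Pi>\<^sub>M _\<in>J. B)"
    by (intro measurable_restrict rv)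
  then show "(\<lambda>\<omega>. \<lambda>i\<in>J. Z i \<omega>) \<in> measurable M (\<Pi>\<^sub>M _\<in>J. \<mu>)"
    using measurable_cong_sets[OF refl s, of M] by simp
qed

text \<open>The estimates on the product measure are pulled back along the map \<open>pool\<close>,
  whose law is that product. The function \<open>u\<close> takes up everything in \<open>K\<close>
  that depends on one point only, constants included, and the centred statistics do not see
  it.\<close>

lemma two_sample_decomposition:
  fixes M :: "'w measure" and B \<mu> :: "'a measure" and X Y :: "nat \<Rightarrow> 'w \<Rightarrow> 'a"
    and K g r :: "'a \<Rightarrow> 'a \<Rightarrow> real" and u :: "'a \<Rightarrow> real" and n m :: nat and \<sigma>2 \<epsilon> \<delta> c :: real
  assumes "prob_space M"
    and ind: "prob_space.indep_vars M (\<lambda>_. B) (case_sum X Y) UNIV"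
    and idX: "\<And>k. distr M B (X k) = \<mu>" and idY: "\<And>k. distr M B (Y k) = \<mu>"
    and nm: "5 \<le> n" "5 \<le> m"
    and g_measurable: "(\<lambda>(x, y). g x y) \<in> borel_measurable (B \<Otimes>\<^sub>M B)"
    and r_measurable: "(\<lambda>(x, y). r x y) \<in> borel_measurable (B \<Otimes>\<^sub>M B)"
    and g_sym: "\<And>x y. x \<in> space B \<Longrightarrow> y \<in> space B \<Longrightarrow> g x y = g y x"
    and r_sym: "\<And>x y. x \<in> space B \<Longrightarrow> y \<in> space B \<Longrightarrow> r x y = r y x"
    and K: "\<And>x y. x \<in> space B \<Longrightarrow> y \<in> space B \<Longrightarrow> K x y = g x y / 2 + r x y + u x + u y"
    and K_diag: "\<And>x. x \<in> space B \<Longrightarrow> K x x = 0"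
    and degenerate: "AE x in \<mu>. has_bochner_integral \<mu> (\<lambda>y. g y x) 0"
    and g4: "integrable M (\<lambda>\<omega>. g (X 0 \<omega>) (X 1 \<omega>) ^ 4)"
    and r2: "integrable M (\<lambda>\<omega>. (r (X 0 \<omega>) (X 1 \<omega>))\<^sup>2)"
    and \<sigma>2: "(\<integral>\<omega>. (g (X 0 \<omega>) (X 1 \<omega>))\<^sup>2 \<partial>M) = \<sigma>2" "0 < \<sigma>2"
    and \<epsilon>: "0 < \<epsilon>"
    and A: "(\<integral>\<omega>. g (X 0 \<omega>) (X 1 \<omega>) ^ 4 \<partial>M) / \<sigma>2\<^sup>2 \<le> \<epsilon> * (real n + real m)\<^sup>2"
    and B: "(\<integral>\<omega>. (g (X 0 \<omega>) (X 2 \<omega>))\<^sup>2 * (g (X 1 \<omega>) (X 2 \<omega>))\<^sup>2 \<partial>M) / \<sigma>2\<^sup>2 \<le> \<epsilon> * (real n + real m)"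
    and C: "\<bar>(\<integral>\<omega>. g (X 0 \<omega>) (X 2 \<omega>) * g (X 1 \<omega>) (X 2 \<omega>) * g (X 0 \<omega>) (X 3 \<omega>) * g (X 1 \<omega>) (X 3 \<omega>) \<partial>M) / \<sigma>2\<^sup>2\<bar> \<le> \<epsilon>"
    and \<delta>: "(\<integral>\<omega>. (r (X 0 \<omega>) (X 1 \<omega>))\<^sup>2 \<partial>M) / \<sigma>2 \<le> \<delta>"
    and c: "real m \<le> c * real n" "real n \<le> c * real m"
  defines "N \<equiv> real n + real m" and "\<eta> \<equiv> (4 * c)\<^sup>2 * sqrt \<epsilon>"
    and "\<beta> \<equiv> 48 * (1 / real n + 1 / real m) + 100 * \<delta>"
  obtains W R S where
    "integrable M W" "integrable M R" "S \<in> borel_measurable M" "integrable M (\<lambda>\<omega>. \<bar>S \<omega> - 1\<bar>)"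
    "(\<integral>\<omega>. \<bar>W \<omega>\<bar> \<partial>M) \<le> 1"
    "\<And>t. cmod ((\<integral>\<omega>. iexp (t * W \<omega>) \<partial>M) - of_real (exp (- (t\<^sup>2) / 2))) \<le>
      \<bar>t\<bar> * (\<bar>t\<bar> / 2 * (9 * \<eta>) + t\<^sup>2 / 4 * (30 * \<eta> + 5 * \<eta>\<^sup>2))"
    "(\<integral>\<omega>. \<bar>R \<omega>\<bar> \<partial>M) \<le> 4 * c * (N * sqrt \<delta>)"
    "(\<integral>\<omega>. \<bar>S \<omega> - 1\<bar> \<partial>M) \<le> 2 * (4 * sqrt \<beta> + 4 * \<beta>) + 6 * sqrt \<epsilon> + 8 / N"
    "\<And>\<omega>. \<omega> \<in> space M \<Longrightarrow> T_stat K n m (\<lambda>k. X k \<omega>) (\<lambda>l. Y l \<omega>) = (W \<omega> + R \<omega>) / sqrt (S \<omega>)"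
proof -
  interpret prob_space M by fact
  define s where "s = sqrt \<sigma>2"
  have s: "0 < s" "s\<^sup>2 = \<sigma>2" "s ^ 4 = \<sigma>2\<^sup>2"
    using \<sigma>2 by (auto simp: s_def power4_eq_xxxx power2_eq_square)
  \<comment> \<open>Division by \<open>s\<close> gives unit second moment. Extension by zero makes
    symmetry hold for all arguments, as the locales demand; on sample points nothing
    changes.\<close>
  define h where "h x y = (if x \<in> space B \<and> y \<in> space B then g x y / s else 0)" for x y
  define rr where "rr x y = (if x \<in> space B \<and> y \<in> space B then r x y / s else 0)" for x y
  have sets_\<mu>: "sets \<mu> = sets B" using idX[of 0] by auto
  then have sp: "space \<mu> = space B" by (rule sets_eq_imp_space_eq)
  have rv: "case_sum X Y i \<in> measurable M B" for i using ind by (auto simp: indep_vars_def)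
  have rvX: "X k \<in> measurable M B" and rvY: "Y k \<in> measurable M B" for k
    using rv[of "Inl k"] rv[of "Inr k"] by simp_all
  have Xs: "X k \<omega> \<in> space B" and Ys: "Y k \<omega> \<in> space B" if "\<omega> \<in> space M" for k \<omega>
    using that rvX rvY by (auto dest: measurable_space)
  have id: "distr M B (case_sum X Y i) = \<mu>" for i
    using idX idY by (cases i) auto
  have prob_\<mu>: "prob_space \<mu>" unfolding idX[of 0, symmetric] by (rule prob_space_distr[OF rvX])
  have pair_sets: "sets (\<mu> \<Otimes>\<^sub>M \<mu>) = sets (B \<Otimes>\<^sub>M B)" using sets_\<mu> by (intro sets_pair_measure_cong)
  let ?Q = "\<Pi>\<^sub>M _\<in>{..<4::nat}. \<mu>"
  \<comment> \<open>The \<open>X\<close> half of a family indexed by a sum type: the indices are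
    grouped into disjoint singletons, and each group is projected back to its only
    coordinate.\<close>
  have indX: "indep_vars (\<lambda>_. B) (\<lambda>k. case_sum X Y (Inl k)) UNIV"
  proof -
    have "indep_vars (\<lambda>j. PiM {Inl j} (\<lambda>_. B)) (\<lambda>j \<omega>. restrict (\<lambda>i. case_sum X Y i \<omega>) {Inl j}) (UNIV :: nat set)"
      by (rule indep_vars_restrict[OF ind]) (auto simp: disjoint_family_on_def)
    then have "indep_vars (\<lambda>_. B) (\<lambda>j. (\<lambda>f. f (Inl j)) \<circ> (\<lambda>\<omega>. restrict (\<lambda>i. case_sum X Y i \<omega>) {Inl j})) (UNIV :: nat set)"
      by (rule indep_vars_compose) simp
    then show ?thesis by (simp add: comp_def)
  qed
  have Q: "distr M ?Q (\<lambda>\<omega>. \<lambda>k\<in>{..<4}. X k \<omega>) = ?Q" and Qm: "(\<lambda>\<omega>. \<lambda>k\<in>{..<4}. X k \<omega>) \<in> measurable M ?Q"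
  proof -
    have "{..<4::nat} \<noteq> {}" by (simp add: lessThan_empty_iff)
    from distr_iid_pool[OF indX id this] show "distr M ?Q (\<lambda>\<omega>. \<lambda>k\<in>{..<4}. X k \<omega>) = ?Q"
      "(\<lambda>\<omega>. \<lambda>k\<in>{..<4}. X k \<omega>) \<in> measurable M ?Q" by simp_all
  qed
  have EQ: "(\<integral>x. \<Phi> x \<partial>?Q) = (\<integral>\<omega>. \<Phi> (\<lambda>k\<in>{..<4}. X k \<omega>) \<partial>M)"
    and IQ: "integrable ?Q \<Phi> \<longleftrightarrow> integrable M (\<lambda>\<omega>. \<Phi> (\<lambda>k\<in>{..<4}. X k \<omega>))"
    if "\<Phi> \<in> borel_measurable ?Q" for \<Phi> :: "(nat \<Rightarrow> 'a) \<Rightarrow> real"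
    using integral_distr[OF Qm that] integrable_distr_eq[OF Qm that] unfolding Q by simp_all
  have hm: "(\<lambda>(x, y). h x y) \<in> borel_measurable (\<mu> \<Otimes>\<^sub>M \<mu>)"
    and rm: "(\<lambda>(x, y). rr x y) \<in> borel_measurable (\<mu> \<Otimes>\<^sub>M \<mu>)"
  proof -
    have "(\<lambda>(x, y). h x y) \<in> borel_measurable (B \<Otimes>\<^sub>M B) \<longleftrightarrow> (\<lambda>z. (\<lambda>(x, y). g x y) z / s) \<in> borel_measurable (B \<Otimes>\<^sub>M B)"
      by (rule measurable_cong) (auto simp: space_pair_measure h_def)
    then show "(\<lambda>(x, y). h x y) \<in> borel_measurable (\<mu> \<Otimes>\<^sub>M \<mu>)"
      using borel_measurable_divide[OF g_measurable borel_measurable_const[of s]]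
      by (simp add: measurable_cong_sets[OF pair_sets refl])
    have "(\<lambda>(x, y). rr x y) \<in> borel_measurable (B \<Otimes>\<^sub>M B) \<longleftrightarrow> (\<lambda>z. (\<lambda>(x, y). r x y) z / s) \<in> borel_measurable (B \<Otimes>\<^sub>M B)"
      by (rule measurable_cong) (auto simp: space_pair_measure rr_def)
    then show "(\<lambda>(x, y). rr x y) \<in> borel_measurable (\<mu> \<Otimes>\<^sub>M \<mu>)"
      using borel_measurable_divide[OF r_measurable borel_measurable_const[of s]]
      by (simp add: measurable_cong_sets[OF pair_sets refl])
  qed
  have coord: "(\<lambda>x. f (x i) (x j)) \<in> borel_measurable ?Q"
    if "(\<lambda>(x, y). f x y) \<in> borel_measurable (\<mu> \<Otimes>\<^sub>M \<mu>)" "i < 4" "j < 4" for f :: "'a \<Rightarrow> 'a \<Rightarrow> real" and i j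
  proof -
    have "(\<lambda>x. (x i, x j)) \<in> measurable ?Q (\<mu> \<Otimes>\<^sub>M \<mu>)"
      using that(2,3) by (intro measurable_Pair measurable_component_singleton) auto
    from measurable_compose[OF this that(1)] show ?thesis by simp
  qed
  have hX: "h (X k \<omega>) (X l \<omega>) = g (X k \<omega>) (X l \<omega>) / s" and rX: "rr (X k \<omega>) (X l \<omega>) = r (X k \<omega>) (X l \<omega>) / s"
    if "\<omega> \<in> space M" for k l \<omega>
    using Xs[OF that] by (simp_all add: h_def rr_def)
  have m4: "(\<lambda>x. h (x 0) (x 1) ^ k) \<in> borel_measurable ?Q" for k
    by (intro borel_measurable_power coord hm) auto
  have mr: "(\<lambda>x. (rr (x 0) (x 1))\<^sup>2) \<in> borel_measurable ?Q"
    by (intro borel_measurable_power coord rm) auto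
  have four: "(\<integral>x. h (x 0) (x 1) ^ 4 \<partial>?Q) = (\<integral>\<omega>. g (X 0 \<omega>) (X 1 \<omega>) ^ 4 \<partial>M) / \<sigma>2\<^sup>2"
    and ifour: "integrable ?Q (\<lambda>x. h (x 0) (x 1) ^ 4)"
  proof -
    have "(\<integral>x. h (x 0) (x 1) ^ 4 \<partial>?Q) = (\<integral>\<omega>. g (X 0 \<omega>) (X 1 \<omega>) ^ 4 / s ^ 4 \<partial>M)"
      unfolding EQ[OF m4] by (intro Bochner_Integration.integral_cong) (simp_all add: hX power_divide)
    then show "(\<integral>x. h (x 0) (x 1) ^ 4 \<partial>?Q) = (\<integral>\<omega>. g (X 0 \<omega>) (X 1 \<omega>) ^ 4 \<partial>M) / \<sigma>2\<^sup>2"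
      by (simp add: s)
    have "integrable M (\<lambda>\<omega>. g (X 0 \<omega>) (X 1 \<omega>) ^ 4 / s ^ 4)" using g4 by simp
    then have "integrable M (\<lambda>\<omega>. h (X 0 \<omega>) (X 1 \<omega>) ^ 4)"
      by (rule Bochner_Integration.integrable_cong[THEN iffD1, rotated -1]) (simp_all add: hX power_divide)
    then show "integrable ?Q (\<lambda>x. h (x 0) (x 1) ^ 4)" unfolding IQ[OF m4] by simp
  qed
  have two: "(\<integral>x. (h (x 0) (x 1))\<^sup>2 \<partial>?Q) = 1"
  proof -
    have "(\<integral>x. (h (x 0) (x 1))\<^sup>2 \<partial>?Q) = (\<integral>\<omega>. (g (X 0 \<omega>) (X 1 \<omega>))\<^sup>2 / s\<^sup>2 \<partial>M)"
      unfolding EQ[OF m4] by (intro Bochner_Integration.integral_cong) (simp_all add: hX power_divide)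
    then show ?thesis using \<sigma>2 by (simp add: s)
  qed
  have r_2: "(\<integral>x. (rr (x 0) (x 1))\<^sup>2 \<partial>?Q) \<le> \<delta>" and ir_2: "integrable ?Q (\<lambda>x. (rr (x 0) (x 1))\<^sup>2)"
  proof -
    have "(\<integral>x. (rr (x 0) (x 1))\<^sup>2 \<partial>?Q) = (\<integral>\<omega>. (r (X 0 \<omega>) (X 1 \<omega>))\<^sup>2 / s\<^sup>2 \<partial>M)"
      unfolding EQ[OF mr] by (intro Bochner_Integration.integral_cong) (simp_all add: rX power_divide)
    then show "(\<integral>x. (rr (x 0) (x 1))\<^sup>2 \<partial>?Q) \<le> \<delta>" using \<delta> by (simp add: s)
    have "integrable M (\<lambda>\<omega>. (r (X 0 \<omega>) (X 1 \<omega>))\<^sup>2 / s\<^sup>2)" using r2 by simp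
    then have "integrable M (\<lambda>\<omega>. (rr (X 0 \<omega>) (X 1 \<omega>))\<^sup>2)"
      by (rule Bochner_Integration.integrable_cong[THEN iffD1, rotated -1]) (simp_all add: rX power_divide)
    then show "integrable ?Q (\<lambda>x. (rr (x 0) (x 1))\<^sup>2)" unfolding IQ[OF mr] by simp
  qed
  have deg: "AE x in \<mu>. has_bochner_integral \<mu> (\<lambda>y. h y x) 0"
    using degenerate AE_space
  proof eventually_elim
    case (elim x)
    have "has_bochner_integral \<mu> (\<lambda>y. g y x / s) (0 / s)"
      using elim(1) by (intro has_bochner_integral_divide_zero) auto
    then show ?case
      by (rule has_bochner_integral_cong[THEN iffD1, rotated -1]) (use elim in \<open>auto simp: h_def sp\<close>)
  qed
  interpret two_sample \<mu> n m h rr \<delta>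
  proof (intro two_sample.intro degenerate_kernel.intro two_sample_axioms.intro)
    have "card ({1..n} <+> {1..m}) = n + m" by (simp add: card_Plus)
    then show "4 \<le> card ({1..n} <+> {1..m})" using nm by linarith
    show "h x y = h y x" for x y using g_sym by (auto simp: h_def)
    show "rr x y = rr y x" for x y using r_sym by (auto simp: rr_def)
    show "finite ({1..n} <+> {1..m})" by simp
    show "4 \<le> n" "4 \<le> m" using nm by linarith+
  qed (fact prob_\<mu> hm rm ifour two deg ir_2 r_2)+
  define pool where "pool \<omega> = (\<lambda>i\<in>{1..n} <+> {1..m}. case_sum X Y i \<omega>)" for \<omega>
  have ne: "({1..n} <+> {1..m} :: (nat + nat) set) \<noteq> {}" using nm by auto
  have P: "distr M P pool = P" and pm: "pool \<in> measurable M P"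
    using distr_iid_pool[OF ind id ne] by (simp_all add: pool_def[abs_def])
  have EP: "(\<integral>x. \<Phi> x \<partial>P) = (\<integral>\<omega>. \<Phi> (pool \<omega>) \<partial>M)" if "\<Phi> \<in> borel_measurable P" for \<Phi> :: "(nat + nat \<Rightarrow> 'a) \<Rightarrow> 'z::{banach, second_countable_topology}"
    using integral_distr[OF pm that] unfolding P by simp
  have IP: "integrable P \<Phi> \<Longrightarrow> integrable M (\<lambda>\<omega>. \<Phi> (pool \<omega>))" for \<Phi> :: "(nat + nat \<Rightarrow> 'a) \<Rightarrow> real"
    using integrable_distr[OF pm, of \<Phi>] unfolding P by simp
  have N: "10 \<le> real n + real m" using nm by simp
  have four': "A4 = (\<integral>\<omega>. g (X 0 \<omega>) (X 1 \<omega>) ^ 4 \<partial>M) / \<sigma>2\<^sup>2" unfolding A4_def by (rule four)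
  have B4': "B4 = (\<integral>\<omega>. (g (X 0 \<omega>) (X 2 \<omega>))\<^sup>2 * (g (X 1 \<omega>) (X 2 \<omega>))\<^sup>2 \<partial>M) / \<sigma>2\<^sup>2"
  proof -
    have "(\<lambda>x. (h (x 0) (x 2))\<^sup>2 * (h (x 1) (x 2))\<^sup>2) \<in> borel_measurable ?Q"
      by (intro borel_measurable_times borel_measurable_power coord hm) auto
    from EQ[OF this] have "B4 = (\<integral>\<omega>. (g (X 0 \<omega>) (X 2 \<omega>))\<^sup>2 * (g (X 1 \<omega>) (X 2 \<omega>))\<^sup>2 / s ^ 4 \<partial>M)"
      unfolding B4_def by (simp only:, intro Bochner_Integration.integral_cong)
        (simp_all add: hX power_divide power4_eq_xxxx power2_eq_square)
    then show ?thesis by (simp add: s)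
  qed
  have C4': "C4 = (\<integral>\<omega>. g (X 0 \<omega>) (X 2 \<omega>) * g (X 1 \<omega>) (X 2 \<omega>) * g (X 0 \<omega>) (X 3 \<omega>) * g (X 1 \<omega>) (X 3 \<omega>) \<partial>M) / \<sigma>2\<^sup>2"
  proof -
    have "(\<lambda>x. h (x 0) (x 2) * h (x 1) (x 2) * h (x 0) (x 3) * h (x 1) (x 3)) \<in> borel_measurable ?Q"
      by (intro borel_measurable_times coord hm) auto
    from EQ[OF this] have "C4 = (\<integral>\<omega>. g (X 0 \<omega>) (X 2 \<omega>) * g (X 1 \<omega>) (X 2 \<omega>) * g (X 0 \<omega>) (X 3 \<omega>) * g (X 1 \<omega>) (X 3 \<omega>) / s ^ 4 \<partial>M)"
      unfolding C4_def by (simp only:, intro Bochner_Integration.integral_cong)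
        (simp_all add: hX power4_eq_xxxx)
    then show ?thesis by (simp add: s)
  qed
  note card_N = card_pooled
  have A': "A4 \<le> \<epsilon> * (real n + real m)\<^sup>2" using A unfolding four' .
  have B': "B4 \<le> \<epsilon> * (real n + real m)" using B unfolding B4' .
  have C': "\<bar>C4\<bar> \<le> \<epsilon>" using C unfolding C4' .
  have c0: "0 < c"
  proof (rule ccontr)
    assume "\<not> 0 < c"
    then have "c * real n \<le> 0" by (intro mult_nonpos_nonneg) auto
    then show False using c(1) nm by linarith
  qed
  define W where "W \<omega> = Ww wt (pool \<omega>)" for \<omega>
  define R' where "R' \<omega> = rem (pool \<omega>)" for \<omega>
  define S where "S \<omega> = S_A (pool \<omega>)" for \<omega>
  have W2: "(\<integral>\<omega>. (W \<omega>)\<^sup>2 \<partial>M) \<le> 1\<^sup>2" "integrable M (\<lambda>\<omega>. (W \<omega>)\<^sup>2)"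
    using Ww_second_moment[OF wt_square_sum] EP[of "\<lambda>x. (Ww wt x)\<^sup>2"] IP[of "\<lambda>x. (Ww wt x)\<^sup>2"]
    by (auto simp: W_def)
  have Wm: "W \<in> borel_measurable M"
    unfolding W_def[abs_def] by (rule measurable_compose[OF pm Ww_measurable])
  show thesis
  proof (rule that)
    show "integrable M W" by (rule integrable_if_square[OF Wm W2(2)])
    show "(\<integral>\<omega>. \<bar>W \<omega>\<bar> \<partial>M) \<le> 1" using expectation_le_sqrt[OF Wm W2(2,1)] by simp
    show "integrable M R'" unfolding R'_def[abs_def] by (rule IP[OF rem_L1(2)[OF c]])
    show "(\<integral>\<omega>. \<bar>R' \<omega>\<bar> \<partial>M) \<le> 4 * c * (N * sqrt \<delta>)"
      using rem_L1[OF c] EP[of "\<lambda>x. \<bar>rem x\<bar>"] by (simp add: R'_def N_def)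
    note SA = S_A_L1[OF less_imp_le[OF \<epsilon>] A' B' N]
    show "S \<in> borel_measurable M"
      unfolding S_def[abs_def] by (rule measurable_compose[OF pm SA(3)])
    show "integrable M (\<lambda>\<omega>. \<bar>S \<omega> - 1\<bar>)" unfolding S_def by (rule IP[OF SA(2)])
    show "(\<integral>\<omega>. \<bar>S \<omega> - 1\<bar> \<partial>M) \<le> 2 * (4 * sqrt \<beta> + 4 * \<beta>) + 6 * sqrt \<epsilon> + 8 / N"
      using SA(1) EP[of "\<lambda>x. \<bar>S_A x - 1\<bar>"] SA(3) by (simp add: S_def N_def \<beta>_def)
    have bound: "real (card ({1..n} <+> {1..m})) * (4 * c / (real n + real m)) \<le> 4 * c"
      unfolding card_N using N by simp
    show "cmod ((\<integral>\<omega>. iexp (t * W \<omega>) \<partial>M) - of_real (exp (- (t\<^sup>2) / 2))) \<le>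
      \<bar>t\<bar> * (\<bar>t\<bar> / 2 * (9 * \<eta>) + t\<^sup>2 / 4 * (30 * \<eta> + 5 * \<eta>\<^sup>2))" for t
    proof -
      have "cmod ((\<integral>x. iexp (t * Ww wt x) \<partial>P) - of_real (exp (- (t\<^sup>2) / 2))) \<le>
          \<bar>t\<bar> * (\<bar>t\<bar> / 2 * (9 * \<eta>) + t\<^sup>2 / 4 * (30 * \<eta> + 5 * \<eta>\<^sup>2))"
        unfolding \<eta>_def
        by (rule normal_approximation[OF \<epsilon> A'[folded card_N] B'[folded card_N] C' wt_sym wt_le[OF c] wt_square_sum bound])
           (use c0 in simp)
      moreover have "(\<lambda>x. iexp (t * Ww wt x)) \<in> borel_measurable P"
        using Ww_measurable[of wt] by measurable
      ultimately show ?thesis unfolding W_def by (simp only: EP)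
    qed
    fix \<omega> assume \<omega>: "\<omega> \<in> space M"
    have pX: "pool \<omega> (Inl k) = X k \<omega>" if "k \<in> {1..n}" for k using that by (simp add: pool_def InlI)
    have pY: "pool \<omega> (Inr k) = Y k \<omega>" if "k \<in> {1..m}" for k using that by (simp add: pool_def InrI)
    \<comment> \<open>The additive part is rescaled along with the kernel, so that \<open>s\<close>
      becomes a common factor of the whole array and cancels in \<open>T_stat\<close>.\<close>
    have Keq: "K x y = s * (h x y / 2 + rr x y + u x / s + u y / s)" if "x \<in> space B" "y \<in> space B" for x y
      using K[OF that] that s by (simp add: h_def rr_def field_simps)
    have xy: "K (X k \<omega>) (Y l \<omega>) = s * (A (Inl k) (Inr l) (pool \<omega>) + u (X k \<omega>) / s + u (Y l \<omega>) / s)"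
      if "k \<in> {1..n}" "l \<in> {1..m}" for k l
      using that Keq[OF Xs Ys, OF \<omega> \<omega>] by (simp add: local.A_def G_def local.R_def pX pY)
    have xx: "K (X k \<omega>) (X l \<omega>) = s * (A (Inl k) (Inl l) (pool \<omega>) + u (X k \<omega>) / s + u (X l \<omega>) / s)"
      if "k \<in> {1..n}" "l \<in> {1..n}" "k \<noteq> l" for k l
      using that Keq[OF Xs Xs, OF \<omega> \<omega>] by (simp add: local.A_def G_def local.R_def pX)
    have yy: "K (Y k \<omega>) (Y l \<omega>) = s * (A (Inr k) (Inr l) (pool \<omega>) + u (Y k \<omega>) / s + u (Y l \<omega>) / s)"
      if "k \<in> {1..m}" "l \<in> {1..m}" "k \<noteq> l" for k l
      using that Keq[OF Ys Ys, OF \<omega> \<omega>] by (simp add: local.A_def G_def local.R_def pY)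
    have E: "energy_stat K n m (\<lambda>k. X k \<omega>) (\<lambda>l. Y l \<omega>) = s * energy_A (pool \<omega>)"
      unfolding energy_A_def using nm
      by (intro energy_stat_additive[where u="\<lambda>k. u (X k \<omega>) / s" and v="\<lambda>k. u (Y k \<omega>) / s"] xy xx yy) auto
    have S': "S_stat K n m (\<lambda>k. X k \<omega>) (\<lambda>l. Y l \<omega>) = s\<^sup>2 * S_A (pool \<omega>)"
      unfolding S_A_def using nm
      by (intro S_stat_additive[where u="\<lambda>k. u (X k \<omega>) / s" and v="\<lambda>k. u (Y k \<omega>) / s"] xy xx yy K_diag Xs Ys \<omega>) auto
    show "T_stat K n m (\<lambda>k. X k \<omega>) (\<lambda>l. Y l \<omega>) = (W \<omega> + R' \<omega>) / sqrt (S \<omega>)"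
      unfolding T_stat_additive[OF s(1) E S'] energy_A_eq W_def R'_def S_def ..
  qed
qed

section \<open>The kernel underlying \<open>H\<close>\<close>

text \<open>Events in the sigma-algebra of \<open>U\<close> are preimages under \<open>U\<close>, so
  testing against them only inserts functions of \<open>U\<close>, and Fubini for the product law of
  the independent pair integrates out \<open>V\<close> first.\<close>

lemma (in prob_space) cond_exp_on_indep:
  fixes f :: "'v \<Rightarrow> 'v \<Rightarrow> real"
  assumes ind: "indep_var S U S V"
    and f: "(\<lambda>(u, v). f u v) \<in> borel_measurable (S \<Otimes>\<^sub>M S)"
    and int: "integrable M (\<lambda>\<omega>. f (U \<omega>) (V \<omega>))"
  shows "AE \<omega> in M. cond_exp_on M S U (\<lambda>\<omega>. f (U \<omega>) (V \<omega>)) \<omega> = (\<integral>v. f (U \<omega>) v \<partial>distr M S V)"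
proof -
  have U[measurable]: "U \<in> measurable M S" and V[measurable]: "V \<in> measurable M S"
    using ind by (auto dest: indep_var_rv1 indep_var_rv2)
  have eq: "distr M S U \<Otimes>\<^sub>M distr M S V = distr M (S \<Otimes>\<^sub>M S) (\<lambda>\<omega>. (U \<omega>, V \<omega>))"
    using ind unfolding indep_var_distribution_eq by simp
  interpret U: prob_space "distr M S U" by (rule prob_space_distr) simp
  interpret V: prob_space "distr M S V" by (rule prob_space_distr) simp
  interpret UV: pair_sigma_finite "distr M S U" "distr M S V" ..
  define F where "F = vimage_algebra (space M) U S"
  have Us: "U \<in> space M \<rightarrow> space S" using measurable_space[OF U] by auto
  have sets_F: "sets F = {U -` A \<inter> space M | A. A \<in> sets S}"
    unfolding F_def by (rule sets_vimage_algebra2[OF Us])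
  have sub: "subalgebra M F"
    unfolding subalgebra_def sets_F using U by (auto simp: F_def)
  interpret F: finite_measure_subalgebra M F by unfold_locales (rule sub)
  define G where "G u = (\<integral>v. f u v \<partial>distr M S V)" for u
  have G[measurable]: "G \<in> borel_measurable S"
    unfolding G_def[abs_def] using f
    by (intro V.borel_measurable_lebesgue_integral) (simp add: measurable_cong_sets[OF sets_pair_measure_cong[OF refl sets_distr] refl])
  have UF: "U \<in> measurable F S"
    unfolding F_def by (rule measurable_vimage_algebra1[OF Us])
  have pairm: "(\<lambda>\<omega>. (U \<omega>, V \<omega>)) \<in> measurable M (S \<Otimes>\<^sub>M S)" by simp
  \<comment> \<open>The test function \<open>k = 1\<close> yields integrability of the candidate;
    indicator functions yield the defining identity of the conditional expectation.\<close>
  have key: "integrable (distr M S U \<Otimes>\<^sub>M distr M S V) (\<lambda>(u, v). k u * f u v)"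
      "(\<integral>\<omega>. k (U \<omega>) * f (U \<omega>) (V \<omega>) \<partial>M) = (\<integral>\<omega>. k (U \<omega>) * G (U \<omega>) \<partial>M)"
      "integrable M (\<lambda>\<omega>. k (U \<omega>) * G (U \<omega>))"
    if k: "k \<in> borel_measurable S" and ik: "integrable M (\<lambda>\<omega>. k (U \<omega>) * f (U \<omega>) (V \<omega>))" for k :: "'v \<Rightarrow> real"
  proof -
    have km: "(\<lambda>(u, v). k u * f u v) \<in> borel_measurable (S \<Otimes>\<^sub>M S)"
    proof -
      have "(\<lambda>z. k (fst z) * (\<lambda>(u, v). f u v) z) \<in> borel_measurable (S \<Otimes>\<^sub>M S)"
        using k f by measurable
      then show ?thesis by (simp add: case_prod_unfold)
    qed
    show i: "integrable (distr M S U \<Otimes>\<^sub>M distr M S V) (\<lambda>(u, v). k u * f u v)"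
      unfolding eq using ik by (subst integrable_distr_eq[OF pairm km]) simp
    have "(\<integral>\<omega>. k (U \<omega>) * f (U \<omega>) (V \<omega>) \<partial>M) = (\<integral>z. (\<lambda>(u, v). k u * f u v) z \<partial>(distr M S U \<Otimes>\<^sub>M distr M S V))"
      unfolding eq by (subst integral_distr[OF pairm km]) simp
    also have "\<dots> = (\<integral>u. (\<integral>v. k u * f u v \<partial>distr M S V) \<partial>distr M S U)"
      using UV.integral_fst'[OF i] by simp
    also have "\<dots> = (\<integral>u. k u * G u \<partial>distr M S U)" by (simp add: G_def)
    also have "\<dots> = (\<integral>\<omega>. k (U \<omega>) * G (U \<omega>) \<partial>M)"
      using k by (subst integral_distr) auto
    finally show "(\<integral>\<omega>. k (U \<omega>) * f (U \<omega>) (V \<omega>) \<partial>M) = (\<integral>\<omega>. k (U \<omega>) * G (U \<omega>) \<partial>M)" .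
    have "integrable (distr M S U) (\<lambda>u. \<integral>v. k u * f u v \<partial>distr M S V)"
      using UV.integrable_fst'[OF i] by simp
    then show "integrable M (\<lambda>\<omega>. k (U \<omega>) * G (U \<omega>))"
      using k by (subst (asm) integrable_distr_eq) (auto simp: G_def[symmetric])
  qed
  have "AE \<omega> in M. real_cond_exp M F (\<lambda>\<omega>. f (U \<omega>) (V \<omega>)) \<omega> = G (U \<omega>)"
  proof (rule F.real_cond_exp_charact[OF _ int])
    show "integrable M (\<lambda>\<omega>. G (U \<omega>))" using key(3)[of "\<lambda>_. 1"] int by simp
    show "(\<lambda>\<omega>. G (U \<omega>)) \<in> borel_measurable F" by (rule measurable_compose[OF UF G])
    fix A assume "A \<in> sets F"
    then obtain A' where A': "A' \<in> sets S" "A = U -` A' \<inter> space M"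
      unfolding sets_F by auto
    have ind: "indicator A \<omega> = (indicator A' (U \<omega>) :: real)" if "\<omega> \<in> space M" for \<omega>
      using that A' by (auto simp: indicator_def)
    have "integrable M (\<lambda>\<omega>. indicator A' (U \<omega>) * f (U \<omega>) (V \<omega>))"
    proof (rule Bochner_Integration.integrable_bound[OF int])
      show "(\<lambda>\<omega>. indicator A' (U \<omega>) * f (U \<omega>) (V \<omega>)) \<in> borel_measurable M"
        using borel_measurable_integrable[OF int] A'(1) by measurable
    qed (auto simp: indicator_def)
    from key(2)[OF _ this]
    have "(\<integral>\<omega>. indicator A' (U \<omega>) * f (U \<omega>) (V \<omega>) \<partial>M) = (\<integral>\<omega>. indicator A' (U \<omega>) * G (U \<omega>) \<partial>M)"
      using A' by simp
    then show "(\<integral>\<omega>\<in>A. f (U \<omega>) (V \<omega>) \<partial>M) = (\<integral>\<omega>\<in>A. G (U \<omega>) \<partial>M)"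
      unfolding set_lebesgue_integral_def using ind by (simp cong: Bochner_Integration.integral_cong)
  qed
  then show ?thesis unfolding cond_exp_on_def F_def[symmetric] G_def .
qed

lemma (in prob_space) indep_var_pair:
  assumes "indep_vars (\<lambda>_. B) Z UNIV" "i \<noteq> j"
  shows "indep_var B (Z i) B (Z j)"
proof -
  have "indep_var (PiM {i} (\<lambda>_. B)) (\<lambda>\<omega>. restrict (\<lambda>i. Z i \<omega>) {i}) (PiM {j} (\<lambda>_. B)) (\<lambda>\<omega>. restrict (\<lambda>i. Z i \<omega>) {j})"
    using assms by (intro indep_var_restrict) auto
  then have "indep_var B ((\<lambda>f. f i) \<circ> (\<lambda>\<omega>. restrict (\<lambda>i. Z i \<omega>) {i})) B ((\<lambda>f. f j) \<circ> (\<lambda>\<omega>. restrict (\<lambda>i. Z i \<omega>) {j}))"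
    by (rule indep_var_compose) simp_all
  then show ?thesis by (simp add: comp_def)
qed

text \<open>\<open>H_ker\<close> is a version of the random variable \<open>H\<close> as a function of the two points.\<close>

definition H_mean :: "(nat \<Rightarrow> (nat \<Rightarrow> real) measure) \<Rightarrow> (nat \<Rightarrow> (nat \<Rightarrow> real) \<Rightarrow> (nat \<Rightarrow> real) \<Rightarrow> real) \<Rightarrow>
    nat \<Rightarrow> (nat \<Rightarrow> real) \<Rightarrow> real" where
  "H_mean \<nu> \<rho> i x = (\<integral>v. \<rho> i x v \<partial>\<nu> i)"

definition H_ker :: "(nat \<Rightarrow> (nat \<Rightarrow> real) measure) \<Rightarrow> (nat \<Rightarrow> (nat \<Rightarrow> real) \<Rightarrow> (nat \<Rightarrow> real) \<Rightarrow> real) \<Rightarrow>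
    nat \<Rightarrow> real \<Rightarrow> (nat \<Rightarrow> nat \<Rightarrow> real) \<Rightarrow> (nat \<Rightarrow> nat \<Rightarrow> real) \<Rightarrow> real" where
  "H_ker \<nu> \<rho> p \<tau> x y = 1 / \<tau> * (\<Sum>i=1..p.
     \<rho> i (x i) (y i) - H_mean \<nu> \<rho> i (x i) - H_mean \<nu> \<rho> i (y i) + (\<integral>u. H_mean \<nu> \<rho> i u \<partial>\<nu> i))"

lemma component_blocks: "i \<in> {1..p} \<Longrightarrow> (\<lambda>x. x i) \<in> measurable (blocks d p) (eucl (d i))"
  unfolding blocks_def by (rule measurable_component_singleton)

lemma kernel_blocks_measurable:
  assumes "(\<lambda>(x, y). f x y) \<in> borel_measurable (eucl (d i) \<Otimes>\<^sub>M eucl (d i))" "i \<in> {1..p}"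
  shows "(\<lambda>(x, y). f (x i) (y i)) \<in> borel_measurable (blocks d p \<Otimes>\<^sub>M blocks d p)"
proof -
  have "(\<lambda>z. (fst z i, snd z i)) \<in> measurable (blocks d p \<Otimes>\<^sub>M blocks d p) (eucl (d i) \<Otimes>\<^sub>M eucl (d i))"
    by (intro measurable_Pair measurable_compose[OF measurable_fst component_blocks]
        measurable_compose[OF measurable_snd component_blocks] assms(2))
  from measurable_compose[OF this assms(1)] show ?thesis by (simp add: case_prod_unfold)
qed

text \<open>The conditional expectations in \<open>H_rv\<close> are formed anew for each pair of
  copies, but \<open>H_ker\<close> depends only on the common laws of the blocks. One and the same
  kernel therefore represents \<open>H\<close> for every pair of distinct copies, with its own null
  set for each pair.\<close>

lemma (in prob_space) H_rv_kernel:
  fixes X Y :: "nat \<Rightarrow> 'a \<Rightarrow> nat \<Rightarrow> nat \<Rightarrow> real"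
  assumes ind: "indep_vars (\<lambda>_. blocks d p) (case_sum X Y) UNIV"
    and idX: "\<And>k. distr M (blocks d p) (X k) = \<mu>"
    and \<rho>m: "\<And>i. i \<in> {1..p} \<Longrightarrow> (\<lambda>(x, y). \<rho> i x y) \<in> borel_measurable (eucl (d i) \<Otimes>\<^sub>M eucl (d i))"
    and \<rho>sym: "\<And>i x y. i \<in> {1..p} \<Longrightarrow> x \<in> space (eucl (d i)) \<Longrightarrow> y \<in> space (eucl (d i)) \<Longrightarrow> \<rho> i x y = \<rho> i y x"
    and int: "\<And>i. i \<in> {1..p} \<Longrightarrow> integrable M (\<lambda>\<omega>. \<rho> i (X 0 \<omega> i) (X 1 \<omega> i))"
  defines "\<nu> \<equiv> \<lambda>i. distr \<mu> (eucl (d i)) (\<lambda>x. x i)"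
  shows "k \<noteq> l \<Longrightarrow> AE \<omega> in M. H_rv M d \<rho> p \<tau> (X k) (X l) \<omega> = H_ker \<nu> \<rho> p \<tau> (X k \<omega>) (X l \<omega>)"
    and "k \<noteq> l \<Longrightarrow> H_rv M d \<rho> p \<tau> (X k) (X l) \<in> borel_measurable M"
    and "(\<lambda>(x, y). H_ker \<nu> \<rho> p \<tau> x y) \<in> borel_measurable (blocks d p \<Otimes>\<^sub>M blocks d p)"
    and "x \<in> space (blocks d p) \<Longrightarrow> y \<in> space (blocks d p) \<Longrightarrow> H_ker \<nu> \<rho> p \<tau> x y = H_ker \<nu> \<rho> p \<tau> y x"
    and "AE x in \<mu>. has_bochner_integral \<mu> (\<lambda>y. H_ker \<nu> \<rho> p \<tau> y x) 0"
proof -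
  let ?B = "blocks d p"
  have rv: "X k \<in> measurable M ?B" for k
    using ind by (auto simp: indep_vars_def split: sum.splits dest!: spec[of _ "Inl k"])
  have sets_\<mu>: "sets \<mu> = sets ?B" using idX[of 0] by auto
  have sp: "space \<mu> = space ?B" by (rule sets_eq_imp_space_eq[OF sets_\<mu>])
  have comp: "i \<in> {1..p} \<Longrightarrow> x \<in> space ?B \<Longrightarrow> x i \<in> space (eucl (d i))" for i x
    using measurable_space[OF component_blocks] .
  have rvi: "i \<in> {1..p} \<Longrightarrow> (\<lambda>\<omega>. X k \<omega> i) \<in> measurable M (eucl (d i))" for i k
    by (rule measurable_compose[OF rv component_blocks])
  have comp\<mu>: "i \<in> {1..p} \<Longrightarrow> (\<lambda>x. x i) \<in> measurable \<mu> (eucl (d i))" for i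
    using component_blocks measurable_cong_sets[OF sets_\<mu> refl] by blast
  have \<nu>: "distr M (eucl (d i)) (\<lambda>\<omega>. X k \<omega> i) = \<nu> i" if "i \<in> {1..p}" for i k
    unfolding \<nu>_def idX[of k, symmetric] by (subst distr_distr[OF component_blocks[OF that] rv]) (simp add: comp_def)
  have prob_\<nu>: "prob_space (\<nu> i)" if "i \<in> {1..p}" for i
    unfolding \<nu>[OF that, of 0, symmetric] by (rule prob_space_distr[OF rvi[OF that]])
  have prob_\<mu>: "prob_space \<mu>" unfolding idX[of 0, symmetric] by (rule prob_space_distr[OF rv])
  have sets_\<nu>: "sets (\<nu> i) = sets (eucl (d i))" for i by (simp add: \<nu>_def)
  have iv: "indep_var (eucl (d i)) (\<lambda>\<omega>. X k \<omega> i) (eucl (d i)) (\<lambda>\<omega>. X l \<omega> i)" if "i \<in> {1..p}" "k \<noteq> l" for i k l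
  proof -
    have "indep_var ?B (X k) ?B (X l)"
      using indep_var_pair[OF ind, of "Inl k" "Inl l"] that(2) by simp
    from indep_var_compose[OF this component_blocks[OF that(1)] component_blocks[OF that(1)]]
    show ?thesis by (simp add: comp_def)
  qed
  have pair: "distr M (eucl (d i) \<Otimes>\<^sub>M eucl (d i)) (\<lambda>\<omega>. (X k \<omega> i, X l \<omega> i)) = \<nu> i \<Otimes>\<^sub>M \<nu> i"
    if "i \<in> {1..p}" "k \<noteq> l" for i k l
    using iv[OF that] unfolding indep_var_distribution_eq \<nu>[OF that(1)] by simp
  have pairm: "(\<lambda>\<omega>. (X k \<omega> i, X l \<omega> i)) \<in> measurable M (eucl (d i) \<Otimes>\<^sub>M eucl (d i))" if "i \<in> {1..p}" for i k l
    using rvi[OF that] by (intro measurable_Pair)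
  \<comment> \<open>All pairs of distinct copies have the same joint law, so integrability for
    copies 0 and 1 is carried to the product law and from there to every pair.\<close>
  have iP: "integrable (\<nu> i \<Otimes>\<^sub>M \<nu> i) (\<lambda>(x, y). \<rho> i x y)" if i: "i \<in> {1..p}" for i
    unfolding pair[OF i zero_neq_one, symmetric]
    using int[OF i] by (subst integrable_distr_eq[OF pairm[OF i] \<rho>m[OF i]]) simp
  have ikl: "integrable M (\<lambda>\<omega>. \<rho> i (X k \<omega> i) (X l \<omega> i))" if i: "i \<in> {1..p}" "k \<noteq> l" for i k l
    using iP[OF i(1)] unfolding pair[OF i, symmetric]
    by (subst (asm) integrable_distr_eq[OF pairm[OF i(1)] \<rho>m[OF i(1)]]) simp
  let ?c = "\<lambda>i. \<integral>u. H_mean \<nu> \<rho> i u \<partial>\<nu> i"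
  have ckl: "(\<integral>\<omega>. \<rho> i (X k \<omega> i) (X l \<omega> i) \<partial>M) = ?c i" if i: "i \<in> {1..p}" "k \<noteq> l" for i k l
  proof -
    interpret N: prob_space "\<nu> i" by (rule prob_\<nu>[OF i(1)])
    interpret NN: pair_sigma_finite "\<nu> i" "\<nu> i" ..
    have "(\<integral>\<omega>. \<rho> i (X k \<omega> i) (X l \<omega> i) \<partial>M) = (\<integral>z. (\<lambda>(x, y). \<rho> i x y) z \<partial>(\<nu> i \<Otimes>\<^sub>M \<nu> i))"
      unfolding pair[OF i, symmetric] by (subst integral_distr[OF pairm[OF i(1)] \<rho>m[OF i(1)]]) simp
    then show ?thesis using NN.integral_fst'[OF iP[OF i(1)]] by (simp add: H_mean_def)
  qed
  have mean_m: "H_mean \<nu> \<rho> i \<in> borel_measurable (eucl (d i))" if i: "i \<in> {1..p}" for i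
  proof -
    interpret N: prob_space "\<nu> i" by (rule prob_\<nu>[OF i])
    show ?thesis
      unfolding H_mean_def[abs_def] using \<rho>m[OF i]
      by (intro N.borel_measurable_lebesgue_integral)
         (simp add: measurable_cong_sets[OF sets_pair_measure_cong[OF refl sets_\<nu>] refl])
  qed
  have sym': "\<rho> i v u = \<rho> i u v" if "i \<in> {1..p}" "u \<in> space (eucl (d i))" "v \<in> space (\<nu> i)" for i u v
    using that \<rho>sym sets_eq_imp_space_eq[OF sets_\<nu>[of i]] by simp
  show "AE \<omega> in M. H_rv M d \<rho> p \<tau> (X k) (X l) \<omega> = H_ker \<nu> \<rho> p \<tau> (X k \<omega>) (X l \<omega>)" if kl: "k \<noteq> l"
  proof -
    have a: "AE \<omega> in M. \<forall>i\<in>{1..p}. cond_exp_on M (eucl (d i)) (\<lambda>\<omega>'. X k \<omega>' i) (\<lambda>\<omega>'. \<rho> i (X k \<omega>' i) (X l \<omega>' i)) \<omega> =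
        H_mean \<nu> \<rho> i (X k \<omega> i)"
    proof (rule AE_finite_allI)
      fix i assume i: "i \<in> {1..p}"
      show "AE \<omega> in M. cond_exp_on M (eucl (d i)) (\<lambda>\<omega>'. X k \<omega>' i) (\<lambda>\<omega>'. \<rho> i (X k \<omega>' i) (X l \<omega>' i)) \<omega> =
          H_mean \<nu> \<rho> i (X k \<omega> i)"
        using cond_exp_on_indep[where f = "\<rho> i" and U = "\<lambda>\<omega>. X k \<omega> i" and V = "\<lambda>\<omega>. X l \<omega> i",
            OF iv[OF i kl] \<rho>m[OF i] ikl[OF i kl]] unfolding \<nu>[OF i] H_mean_def .
    qed simp
    \<comment> \<open>Conditioning on the second argument: the previous result is applied to the
      kernel with swapped arguments, and symmetry turns the outcome back into
      \<open>H_mean\<close>.\<close>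
    have b: "AE \<omega> in M. \<forall>i\<in>{1..p}. cond_exp_on M (eucl (d i)) (\<lambda>\<omega>'. X l \<omega>' i) (\<lambda>\<omega>'. \<rho> i (X k \<omega>' i) (X l \<omega>' i)) \<omega> =
        H_mean \<nu> \<rho> i (X l \<omega> i)"
    proof (rule AE_finite_allI)
      fix i assume i: "i \<in> {1..p}"
      have lk: "l \<noteq> k" using kl by simp
      have m: "(\<lambda>(u, v). \<rho> i v u) \<in> borel_measurable (eucl (d i) \<Otimes>\<^sub>M eucl (d i))"
        using measurable_compose[OF measurable_pair_swap' \<rho>m[OF i]] by (simp add: case_prod_unfold)
      have "AE \<omega> in M. cond_exp_on M (eucl (d i)) (\<lambda>\<omega>'. X l \<omega>' i) (\<lambda>\<omega>'. \<rho> i (X k \<omega>' i) (X l \<omega>' i)) \<omega> =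
          (\<integral>v. \<rho> i v (X l \<omega> i) \<partial>\<nu> i)"
        using cond_exp_on_indep[where f = "\<lambda>u v. \<rho> i v u" and U = "\<lambda>\<omega>. X l \<omega> i" and V = "\<lambda>\<omega>. X k \<omega> i",
            OF iv[OF i lk] m ikl[OF i kl]] unfolding \<nu>[OF i] .
      then show "AE \<omega> in M. cond_exp_on M (eucl (d i)) (\<lambda>\<omega>'. X l \<omega>' i) (\<lambda>\<omega>'. \<rho> i (X k \<omega>' i) (X l \<omega>' i)) \<omega> =
          H_mean \<nu> \<rho> i (X l \<omega> i)"
        using AE_space
      proof eventually_elim
        case (elim \<omega>)
        have "X l \<omega> i \<in> space (eucl (d i))" using measurable_space[OF rvi[OF i] elim(2)] .
        then have "(\<integral>v. \<rho> i v (X l \<omega> i) \<partial>\<nu> i) = (\<integral>v. \<rho> i (X l \<omega> i) v \<partial>\<nu> i)"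
          using i by (intro Bochner_Integration.integral_cong refl sym')
        then show ?case using elim(1) by (simp add: H_mean_def)
      qed
    qed simp
    show ?thesis using a b
    proof eventually_elim
      case (elim \<omega>)
      then show ?case unfolding H_rv_def H_ker_def using ckl[OF _ kl]
        by (intro arg_cong[of _ _ "\<lambda>z. 1 / \<tau> * z"] sum.cong refl) simp
    qed
  qed
  show "H_rv M d \<rho> p \<tau> (X k) (X l) \<in> borel_measurable M" if kl: "k \<noteq> l"
    unfolding H_rv_def[abs_def] cond_exp_on_def
    by (intro borel_measurable_times borel_measurable_sum borel_measurable_add borel_measurable_diff
        borel_measurable_const borel_measurable_cond_exp2 borel_measurable_integrable[OF ikl] kl)
  show mk: "(\<lambda>(x, y). H_ker \<nu> \<rho> p \<tau> x y) \<in> borel_measurable (?B \<Otimes>\<^sub>M ?B)"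
  proof -
    have 1: "(\<lambda>z. fst z i) \<in> measurable (?B \<Otimes>\<^sub>M ?B) (eucl (d i))"
      and 2: "(\<lambda>z. snd z i) \<in> measurable (?B \<Otimes>\<^sub>M ?B) (eucl (d i))" if i: "i \<in> {1..p}" for i
      using measurable_compose[OF measurable_fst component_blocks[OF i]]
        measurable_compose[OF measurable_snd component_blocks[OF i]] by auto
    have 3: "(\<lambda>z. H_mean \<nu> \<rho> i (fst z i)) \<in> borel_measurable (?B \<Otimes>\<^sub>M ?B)"
      and 4: "(\<lambda>z. H_mean \<nu> \<rho> i (snd z i)) \<in> borel_measurable (?B \<Otimes>\<^sub>M ?B)"
      and 5: "(\<lambda>z. \<rho> i (fst z i) (snd z i)) \<in> borel_measurable (?B \<Otimes>\<^sub>M ?B)" if i: "i \<in> {1..p}" for i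
      using measurable_compose[OF 1[OF i] mean_m[OF i]] measurable_compose[OF 2[OF i] mean_m[OF i]]
        kernel_blocks_measurable[where f = "\<rho> i" and d = d and i = i and p = p, OF \<rho>m[OF i] i] by (simp_all add: case_prod_unfold)
    have "(\<lambda>z. H_ker \<nu> \<rho> p \<tau> (fst z) (snd z)) \<in> borel_measurable (?B \<Otimes>\<^sub>M ?B)"
      unfolding H_ker_def
      by (intro borel_measurable_times borel_measurable_sum borel_measurable_add borel_measurable_diff
          borel_measurable_const 3 4 5)
    then show ?thesis by (simp add: case_prod_unfold)
  qed
  show "x \<in> space ?B \<Longrightarrow> y \<in> space ?B \<Longrightarrow> H_ker \<nu> \<rho> p \<tau> x y = H_ker \<nu> \<rho> p \<tau> y x"
    unfolding H_ker_def
    by (intro arg_cong[of _ _ "\<lambda>z. 1 / \<tau> * z"] sum.cong refl) (simp add: \<rho>sym comp)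
  show "AE x in \<mu>. has_bochner_integral \<mu> (\<lambda>y. H_ker \<nu> \<rho> p \<tau> y x) 0"
  proof -
    interpret MU: prob_space \<mu> by (rule prob_\<mu>)
    have "AE x in \<mu>. \<forall>i\<in>{1..p}. integrable (\<nu> i) (\<lambda>v. \<rho> i (x i) v)"
    proof (rule AE_finite_allI)
      fix i assume i: "i \<in> {1..p}"
      interpret N: prob_space "\<nu> i" by (rule prob_\<nu>[OF i])
      interpret NN: pair_sigma_finite "\<nu> i" "\<nu> i" ..
      have "AE u in \<nu> i. integrable (\<nu> i) (\<lambda>v. \<rho> i u v)"
        using NN.AE_integrable_fst'[OF iP[OF i]] by simp
      then show "AE x in \<mu>. integrable (\<nu> i) (\<lambda>v. \<rho> i (x i) v)"
        unfolding \<nu>_def by (rule AE_distrD[OF comp\<mu>[OF i]])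
    qed simp
    then show ?thesis using AE_space
    \<comment> \<open>At such an \<open>x\<close>, the first two terms of a summand have integrals
      \<open>H_mean\<close> at \<open>x\<close> and the overall mean, and the last two are constants
      in \<open>y\<close>; everything cancels block by block.\<close>
    proof eventually_elim
      case (elim x)
      have x: "x i \<in> space (eucl (d i))" if "i \<in> {1..p}" for i using comp[OF that] elim(2) sp by simp
      have summand: "has_bochner_integral \<mu>
          (\<lambda>y. \<rho> i (y i) (x i) - H_mean \<nu> \<rho> i (y i) - H_mean \<nu> \<rho> i (x i) + ?c i)
          (H_mean \<nu> \<rho> i (x i) - ?c i - H_mean \<nu> \<rho> i (x i) + ?c i)" if i: "i \<in> {1..p}" for i
      proof -
        interpret N: prob_space "\<nu> i" by (rule prob_\<nu>[OF i])
        interpret NN: pair_sigma_finite "\<nu> i" "\<nu> i" ..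
        have "has_bochner_integral (\<nu> i) (\<lambda>v. \<rho> i (x i) v) (H_mean \<nu> \<rho> i (x i))"
          using elim(1) i by (auto simp: H_mean_def has_bochner_integral_iff)
        then have "has_bochner_integral (\<nu> i) (\<lambda>v. \<rho> i v (x i)) (H_mean \<nu> \<rho> i (x i))"
          by (rule has_bochner_integral_cong[THEN iffD1, rotated -1]) (auto simp: sym'[OF i x[OF i]])
        then have 1: "has_bochner_integral \<mu> (\<lambda>y. \<rho> i (y i) (x i)) (H_mean \<nu> \<rho> i (x i))"
        proof -
          assume hb: "has_bochner_integral (\<nu> i) (\<lambda>v. \<rho> i v (x i)) (H_mean \<nu> \<rho> i (x i))"
          have \<nu>i: "\<nu> i = distr \<mu> (eucl (d i)) (\<lambda>x. x i)" by (simp add: \<nu>_def)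
          have m: "(\<lambda>v. \<rho> i v (x i)) \<in> borel_measurable (eucl (d i))"
            using borel_measurable_has_bochner_integral[OF hb] measurable_cong_sets[OF sets_\<nu> refl] by blast
          show ?thesis
            using hb unfolding has_bochner_integral_iff \<nu>i[THEN arg_cong, of "\<lambda>N. integrable N _"]
              \<nu>i[THEN arg_cong, of "\<lambda>N. integral\<^sup>L N (\<lambda>v. \<rho> i v (x i))"]
              integrable_distr_eq[OF comp\<mu>[OF i] m] integral_distr[OF comp\<mu>[OF i] m] .
        qed
        have "integrable (\<nu> i) (H_mean \<nu> \<rho> i)"
          unfolding H_mean_def[abs_def] using NN.integrable_fst'[OF iP[OF i]] by simp
        then have "integrable \<mu> (\<lambda>y. H_mean \<nu> \<rho> i (y i))"
          by (subst (asm) \<nu>_def) (rule integrable_distr[OF comp\<mu>[OF i]])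
        moreover have "(\<integral>y. H_mean \<nu> \<rho> i (y i) \<partial>\<mu>) = ?c i"
        proof -
          have "(\<integral>u. H_mean \<nu> \<rho> i u \<partial>distr \<mu> (eucl (d i)) (\<lambda>x. x i)) = (\<integral>y. H_mean \<nu> \<rho> i (y i) \<partial>\<mu>)"
            by (rule integral_distr[OF comp\<mu>[OF i] mean_m[OF i]])
          then show ?thesis by (simp add: \<nu>_def)
        qed
        ultimately have 2: "has_bochner_integral \<mu> (\<lambda>y. H_mean \<nu> \<rho> i (y i)) (?c i)"
          by (simp add: has_bochner_integral_iff)
        have 3: "has_bochner_integral \<mu> (\<lambda>y. z) z" for z :: real
          by (simp add: has_bochner_integral_iff MU.prob_space)
        show ?thesis
          by (intro has_bochner_integral_add has_bochner_integral_diff 1 2 3)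
      qed
      have "has_bochner_integral \<mu> (\<lambda>y. H_ker \<nu> \<rho> p \<tau> y x)
          (1 / \<tau> * (\<Sum>i=1..p. H_mean \<nu> \<rho> i (x i) - ?c i - H_mean \<nu> \<rho> i (x i) + ?c i))"
        unfolding H_ker_def by (intro has_bochner_integral_mult_right has_bochner_integral_sum summand)
      then show ?case by simp
    qed
  qed
qed

section \<open>Measurability, the block distances, and the model at a fixed dimension\<close>

lemma T_stat_measurable:
  fixes X Y :: "nat \<Rightarrow> 'w \<Rightarrow> 'a"
  assumes K: "(\<lambda>(x, y). K x y) \<in> borel_measurable (B \<Otimes>\<^sub>M B)"
    and X: "\<And>k. X k \<in> measurable M B" and Y: "\<And>k. Y k \<in> measurable M B"
  shows "(\<lambda>\<omega>. T_stat K n m (\<lambda>k. X k \<omega>) (\<lambda>l. Y l \<omega>)) \<in> borel_measurable M"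
proof -
  have KUV: "(\<lambda>\<omega>. K (U \<omega>) (V \<omega>)) \<in> borel_measurable M"
    if "U \<in> measurable M B" "V \<in> measurable M B" for U V
    using measurable_compose[OF measurable_Pair[OF that] K] by simp
  have [measurable]: "(\<lambda>\<omega>. K (X k \<omega>) (Y l \<omega>)) \<in> borel_measurable M"
    "(\<lambda>\<omega>. K (X k \<omega>) (X l \<omega>)) \<in> borel_measurable M" "(\<lambda>\<omega>. K (Y k \<omega>) (Y l \<omega>)) \<in> borel_measurable M" for k l
    by (intro KUV X Y)+
  have [measurable]: "(\<lambda>\<omega>. U_center q (\<lambda>k l. K (X k \<omega>) (X l \<omega>)) k l) \<in> borel_measurable M"
    "(\<lambda>\<omega>. U_center q (\<lambda>k l. K (Y k \<omega>) (Y l \<omega>)) k l) \<in> borel_measurable M" for q k l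
    unfolding U_center_def by (cases "k = l"; simp; measurable)+
  show ?thesis
    unfolding T_stat_def energy_stat_def S_stat_def cdCov2_def K_hat_def dCov2_def by measurable
qed

lemma sq_dist_eq: "sq_dist d x y = (\<Sum>j<d. (x j - y j)\<^sup>2)"
  by (simp add: sq_dist_def L2_set_def sum_nonneg)

lemma sq_dist_measurable: "(\<lambda>(x, y). sq_dist d x y) \<in> borel_measurable (eucl d \<Otimes>\<^sub>M eucl d)"
proof -
  have "(\<lambda>z. \<Sum>j<d. (fst z j - snd z j)\<^sup>2) \<in> borel_measurable (eucl d \<Otimes>\<^sub>M eucl d)"
    unfolding eucl_def
    by (intro borel_measurable_sum borel_measurable_power borel_measurable_diff
        measurable_compose[OF measurable_fst measurable_component_singleton]
        measurable_compose[OF measurable_snd measurable_component_singleton])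
  then show ?thesis by (simp add: sq_dist_eq case_prod_unfold)
qed

text \<open>What both cases S1 and S2 provide.\<close>

definition semimetric_kernel :: "nat \<Rightarrow> ((nat \<Rightarrow> real) \<Rightarrow> (nat \<Rightarrow> real) \<Rightarrow> real) \<Rightarrow> bool" where
  "semimetric_kernel d \<rho> \<longleftrightarrow> (\<lambda>(x, y). \<rho> x y) \<in> borel_measurable (eucl d \<Otimes>\<^sub>M eucl d) \<and>
     (\<forall>x\<in>space (eucl d). \<rho> x x = 0 \<and> (\<forall>y\<in>space (eucl d). 0 \<le> \<rho> x y \<and> \<rho> x y = \<rho> y x))"

lemma semimetric_kernel_Metric:
  assumes "(\<lambda>(x, y). \<rho> x y) \<in> borel_measurable (eucl d \<Otimes>\<^sub>M eucl d)" "Metric_space (space (eucl d)) \<rho>"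
  shows "semimetric_kernel d \<rho>"
proof -
  interpret Metric_space "space (eucl d)" \<rho> by fact
  show ?thesis unfolding semimetric_kernel_def using assms(1) zero by (auto simp: commute)
qed

lemma semimetric_kernel_sq_dist:
  assumes "\<forall>x\<in>space (eucl d). \<forall>y\<in>space (eucl d). \<rho> x y = sq_dist d x y"
  shows "semimetric_kernel d \<rho>"
proof -
  have "(\<lambda>(x, y). \<rho> x y) \<in> borel_measurable (eucl d \<Otimes>\<^sub>M eucl d) \<longleftrightarrow>
      (\<lambda>(x, y). sq_dist d x y) \<in> borel_measurable (eucl d \<Otimes>\<^sub>M eucl d)"
    using assms by (intro measurable_cong) (auto simp: space_pair_measure)
  then show ?thesis
    unfolding semimetric_kernel_def using assms sq_dist_measurable
    by (auto simp: sq_dist_eq sum_nonneg power2_commute)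
qed

lemma K_dist_measurable:
  assumes "\<And>i. i \<in> {1..p} \<Longrightarrow> semimetric_kernel (d i) (\<rho> i)"
  shows "(\<lambda>(x, y). K_dist \<rho> p x y) \<in> borel_measurable (blocks d p \<Otimes>\<^sub>M blocks d p)"
proof -
  have 1: "(\<lambda>z. \<rho> i (fst z i) (snd z i)) \<in> borel_measurable (blocks d p \<Otimes>\<^sub>M blocks d p)" if i: "i \<in> {1..p}" for i
    using kernel_blocks_measurable[where f = "\<rho> i" and d = d and i = i and p = p] assms[OF i] i
    by (simp add: case_prod_unfold semimetric_kernel_def)
  have "(\<lambda>z. sqrt (\<Sum>i=1..p. \<rho> i (fst z i) (snd z i))) \<in> borel_measurable (blocks d p \<Otimes>\<^sub>M blocks d p)"
    by (rule measurable_compose[OF borel_measurable_sum[OF 1]]) measurable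
  then show ?thesis by (simp add: K_dist_def case_prod_unfold)
qed

lemma space_blocks: "x \<in> space (blocks d p) \<Longrightarrow> i \<in> {1..p} \<Longrightarrow> x i \<in> space (eucl (d i))"
  using measurable_space[OF component_blocks] .

text \<open>The identity \<open>K = \<tau> (1 + L / 2 + R)\<close>, with \<open>\<tau> L\<close> replaced by \<open>H\<close> up to functions of one point.\<close>

lemma K_dist_decomposition:
  assumes \<rho>: "\<And>i. i \<in> {1..p} \<Longrightarrow> semimetric_kernel (d i) (\<rho> i)" and \<tau>: "0 < \<tau>"
  shows "\<exists>u. \<forall>x\<in>space (blocks d p). \<forall>y\<in>space (blocks d p).
    K_dist \<rho> p x y = H_ker \<nu> \<rho> p \<tau> x y / 2 + \<tau> * R_fun \<tau> (K_dist \<rho> p) x y + u x + u y"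
proof -
  let ?C = "\<Sum>i=1..p. \<integral>v. H_mean \<nu> \<rho> i v \<partial>\<nu> i"
  \<comment> \<open>\<open>\<tau> * (1 + L / 2)\<close> equals
    \<open>\<tau> / 2 + K^2 / (2 * \<tau>)\<close>, and replacing the last term by half of
    \<open>H\<close> leaves the one-point means and the constant \<open>- ?C / (2 * \<tau>)\<close>.
    Both constants are shared equally by the two arguments, hence the quarters.\<close>
  define u where "u x = (\<Sum>i=1..p. H_mean \<nu> \<rho> i (x i)) / (2 * \<tau>) - ?C / (4 * \<tau>) + \<tau> / 4" for x
  have "K_dist \<rho> p x y = H_ker \<nu> \<rho> p \<tau> x y / 2 + \<tau> * R_fun \<tau> (K_dist \<rho> p) x y + u x + u y"
    if xy: "x \<in> space (blocks d p)" "y \<in> space (blocks d p)" for x y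
  proof -
    let ?S = "\<Sum>i=1..p. \<rho> i (x i) (y i)"
    have "0 \<le> ?S"
      using \<rho> space_blocks[OF xy(1)] space_blocks[OF xy(2)] by (intro sum_nonneg) (auto simp: semimetric_kernel_def)
    then have sq: "(K_dist \<rho> p x y)\<^sup>2 = ?S" by (simp add: K_dist_def)
    have H: "H_ker \<nu> \<rho> p \<tau> x y = 1 / \<tau> * (?S - (\<Sum>i=1..p. H_mean \<nu> \<rho> i (x i)) - (\<Sum>i=1..p. H_mean \<nu> \<rho> i (y i)) + ?C)"
      by (simp add: H_ker_def sum.distrib sum_subtractf)
    have id: "k = 1 / t * (s - a - b + c) / 2 + t * (k / t - 1 - (s - t\<^sup>2) / t\<^sup>2 / 2) +
        (a / (2 * t) - c / (4 * t) + t / 4) + (b / (2 * t) - c / (4 * t) + t / 4)"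
      if "t \<noteq> 0" for k t s a b c :: real
      using that by (simp add: field_simps power2_eq_square)
    show ?thesis
      unfolding H u_def R_fun_def L_fun_def sq using \<tau> by (intro id) simp
  qed
  then show ?thesis by blast
qed

text \<open>The hypotheses speak about \<open>H\<close> as a random variable, the estimates about a
  kernel. Since the two agree almost surely at distinct copies, all moments carry over, and from
  here on only rates of convergence remain to be studied.\<close>

lemma model_decomposition:
  fixes M :: "'w measure" and X Y :: "nat \<Rightarrow> 'w \<Rightarrow> nat \<Rightarrow> nat \<Rightarrow> real" and n m :: nat and \<epsilon> \<delta> c :: real
  assumes "prob_space M"
    and ind: "prob_space.indep_vars M (\<lambda>_. blocks d p) (case_sum X Y) UNIV"
    and idX: "\<And>k. distr M (blocks d p) (X k) = \<mu>" and idY: "\<And>k. distr M (blocks d p) (Y k) = \<mu>"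
    and \<rho>: "\<And>i. i \<in> {1..p} \<Longrightarrow> semimetric_kernel (d i) (\<rho> i)"
    and \<tau>: "0 < \<tau>"
  defines "K \<equiv> K_dist \<rho> p" and "H \<equiv> \<lambda>k l. H_rv M d \<rho> p \<tau> (X k) (X l)"
    and "R \<equiv> \<lambda>\<omega>. R_fun \<tau> (K_dist \<rho> p) (X 0 \<omega>) (X 1 \<omega>)"
  assumes K2: "integrable M (\<lambda>\<omega>. (K (X 0 \<omega>) (X 1 \<omega>))\<^sup>2)"
    and H4: "integrable M (\<lambda>\<omega>. (H 0 1 \<omega>) ^ 4)" and R4: "integrable M (\<lambda>\<omega>. (R \<omega>) ^ 4)"
    and \<sigma>2: "(\<integral>\<omega>. (H 0 1 \<omega>)\<^sup>2 \<partial>M) = \<sigma>2" "0 < \<sigma>2"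
    and nm: "5 \<le> n" "5 \<le> m" and \<epsilon>: "0 < \<epsilon>"
    and A: "(\<integral>\<omega>. (H 0 1 \<omega>) ^ 4 \<partial>M) / \<sigma>2\<^sup>2 \<le> \<epsilon> * (real n + real m)\<^sup>2"
    and B: "(\<integral>\<omega>. (H 0 2 \<omega>)\<^sup>2 * (H 1 2 \<omega>)\<^sup>2 \<partial>M) / \<sigma>2\<^sup>2 \<le> \<epsilon> * (real n + real m)"
    and C: "\<bar>(\<integral>\<omega>. H 0 2 \<omega> * H 1 2 \<omega> * H 0 3 \<omega> * H 1 3 \<omega> \<partial>M) / \<sigma>2\<^sup>2\<bar> \<le> \<epsilon>"
    and \<delta>: "sqrt (\<tau> ^ 4 * (\<integral>\<omega>. (R \<omega>) ^ 4 \<partial>M) / \<sigma>2\<^sup>2) \<le> \<delta>"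
    and c: "real m \<le> c * real n" "real n \<le> c * real m"
  defines "N \<equiv> real n + real m" and "\<eta> \<equiv> (4 * c)\<^sup>2 * sqrt \<epsilon>"
    and "\<beta> \<equiv> 48 * (1 / real n + 1 / real m) + 100 * \<delta>"
  obtains W Rem S where
    "integrable M W" "integrable M Rem" "S \<in> borel_measurable M" "integrable M (\<lambda>\<omega>. \<bar>S \<omega> - 1\<bar>)"
    "(\<integral>\<omega>. \<bar>W \<omega>\<bar> \<partial>M) \<le> 1"
    "\<And>t. cmod ((\<integral>\<omega>. iexp (t * W \<omega>) \<partial>M) - of_real (exp (- (t\<^sup>2) / 2))) \<le>
      \<bar>t\<bar> * (\<bar>t\<bar> / 2 * (9 * \<eta>) + t\<^sup>2 / 4 * (30 * \<eta> + 5 * \<eta>\<^sup>2))"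
    "(\<integral>\<omega>. \<bar>Rem \<omega>\<bar> \<partial>M) \<le> 4 * c * (N * sqrt \<delta>)"
    "(\<integral>\<omega>. \<bar>S \<omega> - 1\<bar> \<partial>M) \<le> 2 * (4 * sqrt \<beta> + 4 * \<beta>) + 6 * sqrt \<epsilon> + 8 / N"
    "\<And>\<omega>. \<omega> \<in> space M \<Longrightarrow> T_stat K n m (\<lambda>k. X k \<omega>) (\<lambda>l. Y l \<omega>) = (W \<omega> + Rem \<omega>) / sqrt (S \<omega>)"
proof -
  interpret prob_space M by fact
  let ?B = "blocks d p"
  define \<nu> where "\<nu> = (\<lambda>i. distr \<mu> (eucl (d i)) (\<lambda>x. x i))"
  define g where "g = H_ker \<nu> \<rho> p \<tau>"
  define r where "r x y = \<tau> * R_fun \<tau> K x y" for x y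
  have rv: "X k \<in> measurable M ?B" for k
    using ind by (auto simp: indep_vars_def split: sum.splits dest!: spec[of _ "Inl k"])
  have Xs: "X k \<omega> \<in> space ?B" if "\<omega> \<in> space M" for k \<omega> using measurable_space[OF rv that] .
  have K_sq: "(K x y)\<^sup>2 = (\<Sum>i=1..p. \<rho> i (x i) (y i))" if "x \<in> space ?B" "y \<in> space ?B" for x y
    using \<rho> space_blocks[OF that(1)] space_blocks[OF that(2)]
    unfolding K_def K_dist_def by (intro real_sqrt_pow2 sum_nonneg) (auto simp: semimetric_kernel_def)
  have \<rho>_pos: "0 \<le> \<rho> i (x i) (y i)" if "x \<in> space ?B" "y \<in> space ?B" "i \<in> {1..p}" for x y i
    using \<rho>[OF that(3)] space_blocks[OF that(1,3)] space_blocks[OF that(2,3)] by (simp add: semimetric_kernel_def)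
  have \<rho>m: "(\<lambda>(x, y). \<rho> i x y) \<in> borel_measurable (eucl (d i) \<Otimes>\<^sub>M eucl (d i))" if "i \<in> {1..p}" for i
    using \<rho>[OF that] by (simp add: semimetric_kernel_def)
  have \<rho>sym: "\<rho> i x y = \<rho> i y x" if "i \<in> {1..p}" "x \<in> space (eucl (d i))" "y \<in> space (eucl (d i))" for i x y
    using \<rho>[OF that(1)] that by (simp add: semimetric_kernel_def)
  \<comment> \<open>Block distances are nonnegative and add up to \<open>K^2\<close>, so each of
    them is dominated by it.\<close>
  have int: "integrable M (\<lambda>\<omega>. \<rho> i (X 0 \<omega> i) (X 1 \<omega> i))" if i: "i \<in> {1..p}" for i
  proof (rule Bochner_Integration.integrable_bound[OF K2])
    have "(\<lambda>\<omega>. (X 0 \<omega> i, X 1 \<omega> i)) \<in> measurable M (eucl (d i) \<Otimes>\<^sub>M eucl (d i))"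
      using measurable_compose[OF rv component_blocks[OF i]] by (intro measurable_Pair)
    from measurable_compose[OF this \<rho>m[OF i]]
    show "(\<lambda>\<omega>. \<rho> i (X 0 \<omega> i) (X 1 \<omega> i)) \<in> borel_measurable M" by simp
    show "AE \<omega> in M. norm (\<rho> i (X 0 \<omega> i) (X 1 \<omega> i)) \<le> norm ((K (X 0 \<omega>) (X 1 \<omega>))\<^sup>2)"
    proof (rule AE_I2)
      fix \<omega> assume \<omega>: "\<omega> \<in> space M"
      have "\<rho> i (X 0 \<omega> i) (X 1 \<omega> i) \<le> (\<Sum>i=1..p. \<rho> i (X 0 \<omega> i) (X 1 \<omega> i))"
        using i \<rho>_pos[OF Xs[OF \<omega>] Xs[OF \<omega>]] by (intro member_le_sum) auto
      then show "norm (\<rho> i (X 0 \<omega> i) (X 1 \<omega> i)) \<le> norm ((K (X 0 \<omega>) (X 1 \<omega>))\<^sup>2)"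
        unfolding K_sq[OF Xs[OF \<omega>] Xs[OF \<omega>]] using \<rho>_pos[OF Xs[OF \<omega>] Xs[OF \<omega>] i] by simp
    qed
  qed
  have HAE: "AE \<omega> in M. H k l \<omega> = g (X k \<omega>) (X l \<omega>)" if "k \<noteq> l" for k l
    unfolding H_def g_def \<nu>_def
    by (rule H_rv_kernel(1)[where X = X and Y = Y, OF ind idX]) (fact \<rho>m \<rho>sym int that)+
  have Hm: "H k l \<in> borel_measurable M" if "k \<noteq> l" for k l
    unfolding H_def
    by (rule H_rv_kernel(2)[where X = X and Y = Y, OF ind idX]) (fact \<rho>m \<rho>sym int that)+
  have gm: "(\<lambda>(x, y). g x y) \<in> borel_measurable (?B \<Otimes>\<^sub>M ?B)"
    unfolding g_def \<nu>_def
    by (rule H_rv_kernel(3)[where X = X and Y = Y, OF ind idX]) (fact \<rho>m \<rho>sym int)+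
  have Km: "(\<lambda>(x, y). K x y) \<in> borel_measurable (?B \<Otimes>\<^sub>M ?B)" unfolding K_def using \<rho> by (rule K_dist_measurable)
  have rm: "(\<lambda>(x, y). r x y) \<in> borel_measurable (?B \<Otimes>\<^sub>M ?B)"
  proof -
    have [measurable]: "(\<lambda>z. K (fst z) (snd z)) \<in> borel_measurable (?B \<Otimes>\<^sub>M ?B)" using Km by (simp add: case_prod_unfold)
    have "(\<lambda>z. r (fst z) (snd z)) \<in> borel_measurable (?B \<Otimes>\<^sub>M ?B)"
      unfolding r_def R_fun_def L_fun_def by measurable
    then show ?thesis by (simp add: case_prod_unfold)
  qed
  have on_sample: "(\<lambda>\<omega>. f (X k \<omega>) (X l \<omega>)) \<in> borel_measurable M"
    if "(\<lambda>(x, y). f x y) \<in> borel_measurable (?B \<Otimes>\<^sub>M ?B)" for f :: "_ \<Rightarrow> _ \<Rightarrow> real" and k l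
    using measurable_compose[OF measurable_Pair[OF rv rv] that, of k l] by simp
  have gX: "(\<lambda>\<omega>. g (X k \<omega>) (X l \<omega>)) \<in> borel_measurable M" for k l by (rule on_sample[OF gm])
  have m01: "H 0 1 \<in> borel_measurable M" and m02: "H 0 2 \<in> borel_measurable M" and m12: "H 1 2 \<in> borel_measurable M"
    and m03: "H 0 3 \<in> borel_measurable M" and m13: "H 1 3 \<in> borel_measurable M"
    by (rule Hm; simp)+
  have a01: "AE \<omega> in M. H 0 1 \<omega> = g (X 0 \<omega>) (X 1 \<omega>)" and a02: "AE \<omega> in M. H 0 2 \<omega> = g (X 0 \<omega>) (X 2 \<omega>)"
    and a12: "AE \<omega> in M. H 1 2 \<omega> = g (X 1 \<omega>) (X 2 \<omega>)" and a03: "AE \<omega> in M. H 0 3 \<omega> = g (X 0 \<omega>) (X 3 \<omega>)"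
    and a13: "AE \<omega> in M. H 1 3 \<omega> = g (X 1 \<omega>) (X 3 \<omega>)"
    by (rule HAE; simp)+
  have e2: "(\<integral>\<omega>. (H 0 1 \<omega>)\<^sup>2 \<partial>M) = (\<integral>\<omega>. (g (X 0 \<omega>) (X 1 \<omega>))\<^sup>2 \<partial>M)"
  proof (rule integral_cong_AE)
    show "AE \<omega> in M. (H 0 1 \<omega>)\<^sup>2 = (g (X 0 \<omega>) (X 1 \<omega>))\<^sup>2" using a01 by eventually_elim simp
  qed (intro borel_measurable_power m01 gX)+
  have e4: "(\<integral>\<omega>. (H 0 1 \<omega>) ^ 4 \<partial>M) = (\<integral>\<omega>. g (X 0 \<omega>) (X 1 \<omega>) ^ 4 \<partial>M)"
  proof (rule integral_cong_AE)
    show "AE \<omega> in M. (H 0 1 \<omega>) ^ 4 = g (X 0 \<omega>) (X 1 \<omega>) ^ 4" using a01 by eventually_elim simp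
  qed (intro borel_measurable_power m01 gX)+
  have eB: "(\<integral>\<omega>. (H 0 2 \<omega>)\<^sup>2 * (H 1 2 \<omega>)\<^sup>2 \<partial>M) = (\<integral>\<omega>. (g (X 0 \<omega>) (X 2 \<omega>))\<^sup>2 * (g (X 1 \<omega>) (X 2 \<omega>))\<^sup>2 \<partial>M)"
  proof (rule integral_cong_AE)
    show "AE \<omega> in M. (H 0 2 \<omega>)\<^sup>2 * (H 1 2 \<omega>)\<^sup>2 = (g (X 0 \<omega>) (X 2 \<omega>))\<^sup>2 * (g (X 1 \<omega>) (X 2 \<omega>))\<^sup>2"
      using a02 a12 by eventually_elim simp
  qed (intro borel_measurable_times borel_measurable_power m02 m12 gX)+
  have eC: "(\<integral>\<omega>. H 0 2 \<omega> * H 1 2 \<omega> * H 0 3 \<omega> * H 1 3 \<omega> \<partial>M) =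
      (\<integral>\<omega>. g (X 0 \<omega>) (X 2 \<omega>) * g (X 1 \<omega>) (X 2 \<omega>) * g (X 0 \<omega>) (X 3 \<omega>) * g (X 1 \<omega>) (X 3 \<omega>) \<partial>M)"
  proof (rule integral_cong_AE)
    show "AE \<omega> in M. H 0 2 \<omega> * H 1 2 \<omega> * H 0 3 \<omega> * H 1 3 \<omega> =
        g (X 0 \<omega>) (X 2 \<omega>) * g (X 1 \<omega>) (X 2 \<omega>) * g (X 0 \<omega>) (X 3 \<omega>) * g (X 1 \<omega>) (X 3 \<omega>)"
      using a02 a12 a03 a13 by eventually_elim simp
  qed (intro borel_measurable_times m02 m12 m03 m13 gX)+
  have g4: "integrable M (\<lambda>\<omega>. g (X 0 \<omega>) (X 1 \<omega>) ^ 4)"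
  proof (rule integrable_cong_AE_imp[OF H4])
    show "AE \<omega> in M. (H 0 1 \<omega>) ^ 4 = g (X 0 \<omega>) (X 1 \<omega>) ^ 4" using a01 by eventually_elim simp
  qed (intro borel_measurable_power gX)
  have Rm: "R \<in> borel_measurable M"
  proof -
    have "(\<lambda>\<omega>. r (X 0 \<omega>) (X 1 \<omega>) / \<tau>) \<in> borel_measurable M"
      by (intro borel_measurable_divide on_sample[OF rm] borel_measurable_const)
    then show ?thesis using \<tau> by (simp add: r_def R_def K_def)
  qed
  have iR2: "integrable M (\<lambda>\<omega>. (R \<omega>)\<^sup>2)"
  proof (rule integrable_if_square)
    show "(\<lambda>\<omega>. (R \<omega>)\<^sup>2) \<in> borel_measurable M" using Rm by (rule borel_measurable_power)
    show "integrable M (\<lambda>\<omega>. ((R \<omega>)\<^sup>2)\<^sup>2)" using R4 by (simp flip: power_mult)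
  qed
  have r2_eq: "(r (X 0 \<omega>) (X 1 \<omega>))\<^sup>2 = \<tau>\<^sup>2 * (R \<omega>)\<^sup>2" for \<omega>
    by (simp add: r_def R_def K_def power_mult_distrib)
  \<comment> \<open>Jensen's inequality: the bound is on the fourth moment of \<open>R\<close>,
    while the pooled estimates ask for the second moment of \<open>r = \<tau> * R\<close>.\<close>
  have \<delta>': "(\<integral>\<omega>. (r (X 0 \<omega>) (X 1 \<omega>))\<^sup>2 \<partial>M) / \<sigma>2 \<le> \<delta>"
  proof -
    have "(\<integral>\<omega>. \<bar>(R \<omega>)\<^sup>2\<bar> \<partial>M) \<le> sqrt (\<integral>\<omega>. (R \<omega>) ^ 4 \<partial>M)"
    proof (rule expectation_le_sqrt)
      show "(\<lambda>\<omega>. (R \<omega>)\<^sup>2) \<in> borel_measurable M" using Rm by (rule borel_measurable_power)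
      show "integrable M (\<lambda>\<omega>. ((R \<omega>)\<^sup>2)\<^sup>2)" using R4 by (simp flip: power_mult)
      show "(\<integral>\<omega>. ((R \<omega>)\<^sup>2)\<^sup>2 \<partial>M) \<le> (\<integral>\<omega>. (R \<omega>) ^ 4 \<partial>M)" by (simp flip: power_mult)
    qed
    then have "\<tau>\<^sup>2 * (\<integral>\<omega>. (R \<omega>)\<^sup>2 \<partial>M) / \<sigma>2 \<le> \<tau>\<^sup>2 * sqrt (\<integral>\<omega>. (R \<omega>) ^ 4 \<partial>M) / \<sigma>2"
      using \<sigma>2(2) by (intro divide_right_mono mult_left_mono) auto
    also have "\<dots> = sqrt (\<tau> ^ 4 * (\<integral>\<omega>. (R \<omega>) ^ 4 \<partial>M) / \<sigma>2\<^sup>2)"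
    proof -
      have "sqrt (\<tau> ^ 4) = \<tau>\<^sup>2" by (rule real_sqrt_unique) (simp_all flip: power_mult)
      then show ?thesis using \<sigma>2(2) by (simp add: real_sqrt_mult real_sqrt_divide)
    qed
    finally show ?thesis using \<delta> unfolding r2_eq by simp
  qed
  have "\<exists>u. \<forall>x\<in>space ?B. \<forall>y\<in>space ?B. K x y = g x y / 2 + r x y + u x + u y"
    unfolding g_def r_def K_def by (rule K_dist_decomposition) (fact \<rho> \<tau>)+
  then obtain u where u: "\<And>x y. x \<in> space ?B \<Longrightarrow> y \<in> space ?B \<Longrightarrow> K x y = g x y / 2 + r x y + u x + u y"
    by blast
  have K_sym: "K x y = K y x" if "x \<in> space ?B" "y \<in> space ?B" for x y
    unfolding K_def K_dist_def using \<rho>sym space_blocks[OF that(1)] space_blocks[OF that(2)]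
    by (intro arg_cong[of _ _ sqrt] sum.cong refl) blast
  have r_sym: "r x y = r y x" if "x \<in> space ?B" "y \<in> space ?B" for x y
    using K_sym[OF that] by (simp add: r_def R_fun_def L_fun_def)
  have K_diag: "K x x = 0" if "x \<in> space ?B" for x
  proof -
    have "(\<Sum>i=1..p. \<rho> i (x i) (x i)) = 0"
      using \<rho> space_blocks[OF that] by (intro sum.neutral) (auto simp: semimetric_kernel_def)
    then show ?thesis unfolding K_def K_dist_def by simp
  qed
  show thesis
  proof (rule two_sample_decomposition[where M = M and B = ?B and \<mu> = \<mu> and X = X and Y = Y and K = K and g = g
        and r = r and u = u and n = n and m = m and ?\<sigma>2.0 = \<sigma>2 and \<epsilon> = \<epsilon> and \<delta> = \<delta> and c = c])
    show "g x y = g y x" if "x \<in> space ?B" "y \<in> space ?B" for x y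
      unfolding g_def \<nu>_def
      by (rule H_rv_kernel(4)[where X = X and Y = Y, OF ind idX]) (fact \<rho>m \<rho>sym int that)+
    show "AE x in \<mu>. has_bochner_integral \<mu> (\<lambda>y. g y x) 0"
      unfolding g_def \<nu>_def
      by (rule H_rv_kernel(5)[where X = X and Y = Y, OF ind idX]) (fact \<rho>m \<rho>sym int)+
    show "integrable M (\<lambda>\<omega>. (r (X 0 \<omega>) (X 1 \<omega>))\<^sup>2)" unfolding r2_eq using iR2 by simp
    show "(\<integral>\<omega>. (g (X 0 \<omega>) (X 1 \<omega>))\<^sup>2 \<partial>M) = \<sigma>2" using \<sigma>2(1) unfolding e2 .
    show "(\<integral>\<omega>. g (X 0 \<omega>) (X 1 \<omega>) ^ 4 \<partial>M) / \<sigma>2\<^sup>2 \<le> \<epsilon> * (real n + real m)\<^sup>2"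
      using A unfolding e4 .
    show "(\<integral>\<omega>. (g (X 0 \<omega>) (X 2 \<omega>))\<^sup>2 * (g (X 1 \<omega>) (X 2 \<omega>))\<^sup>2 \<partial>M) / \<sigma>2\<^sup>2 \<le> \<epsilon> * (real n + real m)"
      using B unfolding eB .
    show "\<bar>(\<integral>\<omega>. g (X 0 \<omega>) (X 2 \<omega>) * g (X 1 \<omega>) (X 2 \<omega>) * g (X 0 \<omega>) (X 3 \<omega>) * g (X 1 \<omega>) (X 3 \<omega>) \<partial>M) / \<sigma>2\<^sup>2\<bar> \<le> \<epsilon>"
      using C unfolding eC .
    fix W Rem S
    assume "integrable M W" "integrable M Rem" "S \<in> borel_measurable M" "integrable M (\<lambda>\<omega>. \<bar>S \<omega> - 1\<bar>)"
      "(\<integral>\<omega>. \<bar>W \<omega>\<bar> \<partial>M) \<le> 1"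
      "\<And>t. cmod ((\<integral>\<omega>. iexp (t * W \<omega>) \<partial>M) - of_real (exp (- (t\<^sup>2) / 2))) \<le>
        \<bar>t\<bar> * (\<bar>t\<bar> / 2 * (9 * ((4 * c)\<^sup>2 * sqrt \<epsilon>)) +
          t\<^sup>2 / 4 * (30 * ((4 * c)\<^sup>2 * sqrt \<epsilon>) + 5 * ((4 * c)\<^sup>2 * sqrt \<epsilon>)\<^sup>2))"
      "(\<integral>\<omega>. \<bar>Rem \<omega>\<bar> \<partial>M) \<le> 4 * c * ((real n + real m) * sqrt \<delta>)"
      "(\<integral>\<omega>. \<bar>S \<omega> - 1\<bar> \<partial>M) \<le> 2 * (4 * sqrt (48 * (1 / real n + 1 / real m) + 100 * \<delta>) +
          4 * (48 * (1 / real n + 1 / real m) + 100 * \<delta>)) + 6 * sqrt \<epsilon> + 8 / (real n + real m)"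
      "\<And>\<omega>. \<omega> \<in> space M \<Longrightarrow> T_stat K n m (\<lambda>k. X k \<omega>) (\<lambda>l. Y l \<omega>) = (W \<omega> + Rem \<omega>) / sqrt (S \<omega>)"
    then show thesis by (rule that[unfolded N_def \<eta>_def \<beta>_def])
  qed (fact ind idX idY nm gm rm r_sym u K_diag g4 \<sigma>2(2) \<epsilon> \<delta>' c \<open>prob_space M\<close>)+
qed

section \<open>Passage to the limit\<close>

theorem theoremB1:
  fixes M :: "nat \<Rightarrow> 'w measure"
    and d :: "nat \<Rightarrow> nat \<Rightarrow> nat"
    and \<rho> :: "nat \<Rightarrow> nat \<Rightarrow> (nat \<Rightarrow> real) \<Rightarrow> (nat \<Rightarrow> real) \<Rightarrow> real"
    and X Y :: "nat \<Rightarrow> nat \<Rightarrow> 'w \<Rightarrow> nat \<Rightarrow> nat \<Rightarrow> real"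
    and K :: "nat \<Rightarrow> (nat \<Rightarrow> nat \<Rightarrow> real) \<Rightarrow> (nat \<Rightarrow> nat \<Rightarrow> real) \<Rightarrow> real"
    and \<tau> :: "nat \<Rightarrow> real"
    and H L R :: "nat \<Rightarrow> nat \<Rightarrow> nat \<Rightarrow> 'w \<Rightarrow> real"
    and EH2 :: "nat \<Rightarrow> real"
    and \<alpha> :: "nat \<Rightarrow> real"
    and \<alpha>0 :: real
    and n m p :: "nat \<Rightarrow> nat"
  \<comment> \<open>dimensions and (semi)metrics\<close>
  assumes dim: "\<exists>D. \<forall>q. \<forall>i\<in>{1..q}. 1 \<le> d q i \<and> d q i \<le> D"
    and cases_S1_S2:
      "(\<forall>q. \<forall>i\<in>{1..q}.
          (\<lambda>(x, y). \<rho> q i x y) \<in> borel_measurable (eucl (d q i) \<Otimes>\<^sub>M eucl (d q i)) \<and>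
          Metric_space (space (eucl (d q i))) (\<rho> q i) \<and>
          strong_negative_type (eucl (d q i)) (\<rho> q i))
       \<or> (\<forall>q. \<forall>i\<in>{1..q}. \<forall>x\<in>space (eucl (d q i)). \<forall>y\<in>space (eucl (d q i)).
            \<rho> q i x y = sq_dist (d q i) x y)"
  \<comment> \<open>for each dimension parameter q: X q 0, X q 1, ... are i.i.d. copies of X and, independently,
      Y q 0, Y q 1, ... are i.i.d. copies of Y; the samples are X q 1, ..., X q n and
      Y q 1, ..., Y q m, and X q 0, X q 1, X q 2, X q 3 serve as X, X', X'', X''' in expectations\<close>
    and prob: "\<And>q. prob_space (M q)"
    and indep: "\<And>q. prob_space.indep_vars (M q) (\<lambda>_. blocks (d q) q)
                  (case_sum (X q) (Y q)) (UNIV :: (nat + nat) set)"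
    and X_ident: "\<And>q k. distr (M q) (blocks (d q) q) (X q k) = distr (M q) (blocks (d q) q) (X q 0)"
    and Y_ident: "\<And>q k. distr (M q) (blocks (d q) q) (Y q k) = distr (M q) (blocks (d q) q) (Y q 0)"
    and H0: "\<And>q. distr (M q) (blocks (d q) q) (X q 0) = distr (M q) (blocks (d q) q) (Y q 0)"
  \<comment> \<open>notation\<close>
    and K_def: "\<And>q. K q = K_dist (\<rho> q) q"
    and tau_def: "\<And>q. \<tau> q = sqrt (\<integral>\<omega>. (K q (X q 0 \<omega>) (X q 1 \<omega>))\<^sup>2 \<partial>M q)"
    and H_def: "\<And>q k l. H q k l = H_rv (M q) (d q) (\<rho> q) q (\<tau> q) (X q k) (X q l)"
    and L_def: "\<And>q k l. L q k l = (\<lambda>\<omega>. L_fun (\<tau> q) (K q) (X q k \<omega>) (X q l \<omega>))"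
    and R_def: "\<And>q k l. R q k l = (\<lambda>\<omega>. R_fun (\<tau> q) (K q) (X q k \<omega>) (X q l \<omega>))"
    and EH2_def: "\<And>q. EH2 q = (\<integral>\<omega>. (H q 0 1 \<omega>)\<^sup>2 \<partial>M q)"
  \<comment> \<open>the moments used below are finite and the denominators nonzero\<close>
    and moments: "\<forall>\<^sub>F q in sequentially.
        integrable (M q) (\<lambda>\<omega>. (K q (X q 0 \<omega>) (X q 1 \<omega>))\<^sup>2) \<and>
        integrable (M q) (\<lambda>\<omega>. (H q 0 1 \<omega>) ^ 4) \<and>
        integrable (M q) (\<lambda>\<omega>. (L q 0 1 \<omega>)\<^sup>2) \<and>
        integrable (M q) (\<lambda>\<omega>. (R q 0 1 \<omega>) ^ 4)"
    and nondegenerate: "\<forall>\<^sub>F q in sequentially. 0 < \<tau> q \<and> 0 < EH2 q"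
  \<comment> \<open>asymptotic regime\<close>
    and n_lim: "filterlim n at_top sequentially"
    and m_lim: "filterlim m at_top sequentially"
    and p_lim: "filterlim p at_top sequentially"
    and i: "\<alpha>0 > 0" "(\<lambda>t. real (m t) / real (n t)) \<longlonglongrightarrow> \<alpha>0"
    and ii_1: "(\<lambda>t. 1 / (real (n t))\<^sup>2 *
        ((\<integral>\<omega>. (H (p t) 0 1 \<omega>) ^ 4 \<partial>M (p t)) / (EH2 (p t))\<^sup>2)) \<in> o(\<lambda>_. 1)"
    and ii_2: "(\<lambda>t. 1 / real (n t) *
        ((\<integral>\<omega>. (H (p t) 0 2 \<omega>)\<^sup>2 * (H (p t) 1 2 \<omega>)\<^sup>2 \<partial>M (p t)) / (EH2 (p t))\<^sup>2)) \<in> o(\<lambda>_. 1)"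
    and ii_3: "(\<lambda>t.
        (\<integral>\<omega>. H (p t) 0 2 \<omega> * H (p t) 1 2 \<omega> * H (p t) 0 3 \<omega> * H (p t) 1 3 \<omega> \<partial>M (p t))
          / (EH2 (p t))\<^sup>2) \<in> o(\<lambda>_. 1)"
    and iii_alpha: "\<And>q. \<alpha> q > 0"
    and iii_1: "(\<lambda>q. \<integral>\<omega>. (L q 0 1 \<omega>)\<^sup>2 \<partial>M q) \<in> O(\<lambda>q. (\<alpha> q)\<^sup>2)"
    and iii_2: "(\<lambda>q. \<tau> q * (\<alpha> q)\<^sup>2) \<in> o(\<lambda>_. 1)"
    and iii_3: "(\<lambda>t. real (n t) ^ 4 * (\<tau> (p t)) ^ 4 *
        (\<integral>\<omega>. (R (p t) 0 1 \<omega>) ^ 4 \<partial>M (p t)) / (EH2 (p t))\<^sup>2) \<in> o(\<lambda>_. 1)"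
  shows "weak_conv_m
     (\<lambda>t. distr (M (p t)) borel
            (\<lambda>\<omega>. T_stat (K (p t)) (n t) (m t) (\<lambda>k. X (p t) k \<omega>) (\<lambda>l. Y (p t) l \<omega>)))
     std_normal_distribution"
proof -
  have sk: "semimetric_kernel (d q i) (\<rho> q i)" if "i \<in> {1..q}" for q i
    using cases_S1_S2 that by (auto intro: semimetric_kernel_Metric semimetric_kernel_sq_dist)
  have rv: "case_sum (X q) (Y q) j \<in> measurable (M q) (blocks (d q) q)" for q j
    using indep[of q] unfolding prob_space.indep_vars_def[OF prob] by blast
  have rvX: "X q k \<in> measurable (M q) (blocks (d q) q)" and rvY: "Y q k \<in> measurable (M q) (blocks (d q) q)" for q k
    using rv[of q "Inl k"] rv[of q "Inr k"] by simp_all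
  have T_m: "(\<lambda>\<omega>. T_stat (K q) n' m' (\<lambda>k. X q k \<omega>) (\<lambda>l. Y q l \<omega>)) \<in> borel_measurable (M q)" for q n' m'
    unfolding K_def by (rule T_stat_measurable[OF K_dist_measurable rvX rvY]) (rule sk)
  have n_top: "filterlim (\<lambda>t. real (n t)) at_top sequentially" and m_top: "filterlim (\<lambda>t. real (m t)) at_top sequentially"
    using filterlim_compose[OF filterlim_real_sequentially n_lim] filterlim_compose[OF filterlim_real_sequentially m_lim] by auto
  have inv_n: "(\<lambda>t. 1 / real (n t)) \<longlonglongrightarrow> 0" and inv_m: "(\<lambda>t. 1 / real (m t)) \<longlonglongrightarrow> 0"
    using tendsto_inverse_0_at_top[OF n_top] tendsto_inverse_0_at_top[OF m_top] by (simp_all add: inverse_eq_divide)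

  have n_pos: "\<forall>\<^sub>F t in sequentially. real (n t) > 0" and m_pos: "\<forall>\<^sub>F t in sequentially. real (m t) > 0"
    using n_top m_top unfolding filterlim_at_top_dense by blast+

  \<comment> \<open>Strictly above both \<open>\<alpha>0\<close> and \<open>1 / \<alpha>0\<close>,
    the limits of \<open>m / n\<close> and \<open>n / m\<close>, so both comparisons hold
    eventually.\<close>
  define c where "c = \<alpha>0 + 1 + 1 / \<alpha>0"
  have c_ev: "\<forall>\<^sub>F t in sequentially. real (m t) \<le> c * real (n t) \<and> real (n t) \<le> c * real (m t)"
  proof -
    have "(\<lambda>t. inverse (real (m t) / real (n t))) \<longlonglongrightarrow> inverse \<alpha>0" using i by (intro tendsto_inverse) auto
    then have inv: "(\<lambda>t. real (n t) / real (m t)) \<longlonglongrightarrow> 1 / \<alpha>0" by (simp add: inverse_eq_divide)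
    have "\<alpha>0 < c" "1 / \<alpha>0 < c" using i(1) by (auto simp: c_def add_pos_pos)
    then have "\<forall>\<^sub>F t in sequentially. real (m t) / real (n t) < c" "\<forall>\<^sub>F t in sequentially. real (n t) / real (m t) < c"
      using order_tendstoD(2)[OF i(2)] order_tendstoD(2)[OF inv] by auto
    then show ?thesis using n_pos m_pos by eventually_elim (auto simp: pos_divide_less_eq less_imp_le)
  qed

  define good where "good q \<longleftrightarrow> integrable (M q) (\<lambda>\<omega>. (K q (X q 0 \<omega>) (X q 1 \<omega>))\<^sup>2) \<and>
      integrable (M q) (\<lambda>\<omega>. (H q 0 1 \<omega>) ^ 4) \<and> integrable (M q) (\<lambda>\<omega>. (R q 0 1 \<omega>) ^ 4) \<and> 0 < \<tau> q \<and> 0 < EH2 q" for q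
  have "\<forall>\<^sub>F q in sequentially. good q"
    using moments nondegenerate by eventually_elim (simp add: good_def)
  then have good_ev: "\<forall>\<^sub>F t in sequentially. good (p t)"
    using p_lim by (rule eventually_compose_filterlim)

  define a where "a t = 1 / (real (n t))\<^sup>2 * ((\<integral>\<omega>. (H (p t) 0 1 \<omega>) ^ 4 \<partial>M (p t)) / (EH2 (p t))\<^sup>2)" for t
  define b where "b t = 1 / real (n t) *
      ((\<integral>\<omega>. (H (p t) 0 2 \<omega>)\<^sup>2 * (H (p t) 1 2 \<omega>)\<^sup>2 \<partial>M (p t)) / (EH2 (p t))\<^sup>2)" for t
  define e where "e t = (\<integral>\<omega>. H (p t) 0 2 \<omega> * H (p t) 1 2 \<omega> * H (p t) 0 3 \<omega> * H (p t) 1 3 \<omega> \<partial>M (p t))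
      / (EH2 (p t))\<^sup>2" for t
  define x where "x t = real (n t) ^ 4 * (\<tau> (p t)) ^ 4 * (\<integral>\<omega>. (R (p t) 0 1 \<omega>) ^ 4 \<partial>M (p t)) / (EH2 (p t))\<^sup>2" for t
  have a0: "a \<longlonglongrightarrow> 0" and b0: "b \<longlonglongrightarrow> 0" and e0: "e \<longlonglongrightarrow> 0" and x0: "x \<longlonglongrightarrow> 0"
    using smalloD_tendsto[OF ii_1] smalloD_tendsto[OF ii_2] smalloD_tendsto[OF ii_3] smalloD_tendsto[OF iii_3]
    unfolding a_def b_def e_def x_def by simp_all
  have a_pos: "0 \<le> a t" and b_pos: "0 \<le> b t" for t
    by (auto simp: a_def b_def intro!: mult_nonneg_nonneg divide_nonneg_nonneg Bochner_Integration.integral_nonneg)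

  \<comment> \<open>The summand \<open>1 / n\<close> keeps \<open>\<epsilon> t\<close> strictly
    positive even if all three moment ratios vanish; the third-moment bound divides by a positive
    multiple of its square root.\<close>
  define \<epsilon> where "\<epsilon> t = a t + b t + \<bar>e t\<bar> + 1 / real (n t)" for t
  \<comment> \<open>\<open>x t\<close> contains \<open>n^4\<close>. Its square root divided by
    \<open>n^2\<close> is exactly the quantity that the decomposition at a fixed dimension asks to
    bound.\<close>
  define \<delta> where "\<delta> t = sqrt (x t) * (1 / real (n t) * (1 / real (n t)))" for t
  define \<beta> where "\<beta> t = 48 * (1 / real (n t) + 1 / real (m t)) + 100 * \<delta> t" for t
  define \<eta> where "\<eta> t = (4 * c)\<^sup>2 * sqrt (\<epsilon> t)" for t
  define N where "N t = real (n t) + real (m t)" for t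
  have \<epsilon>0: "\<epsilon> \<longlonglongrightarrow> 0"
    unfolding \<epsilon>_def using tendsto_add[OF tendsto_add[OF tendsto_add[OF a0 b0] tendsto_rabs_zero[OF e0]] inv_n] by simp
  have \<delta>0: "\<delta> \<longlonglongrightarrow> 0"
    unfolding \<delta>_def using tendsto_mult[OF tendsto_real_sqrt[OF x0] tendsto_mult[OF inv_n inv_n]] by simp
  have \<beta>0: "\<beta> \<longlonglongrightarrow> 0"
    unfolding \<beta>_def
    using tendsto_add[OF tendsto_mult[OF tendsto_const[of 48] tendsto_add[OF inv_n inv_m]] tendsto_mult[OF tendsto_const[of 100] \<delta>0]]
    by simp
  have \<eta>0: "\<eta> \<longlonglongrightarrow> 0"
    unfolding \<eta>_def using tendsto_mult[OF tendsto_const[of "(4 * c)\<^sup>2"] tendsto_real_sqrt[OF \<epsilon>0]] by simp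
  have N0: "(\<lambda>t. 1 / N t) \<longlonglongrightarrow> 0"
  proof (rule tendsto_sandwich[OF _ _ tendsto_const inv_n])
    show "\<forall>\<^sub>F t in sequentially. 0 \<le> 1 / N t" by (simp add: N_def)
    show "\<forall>\<^sub>F t in sequentially. 1 / N t \<le> 1 / real (n t)"
      using n_pos by eventually_elim (auto simp: N_def intro!: divide_left_mono mult_pos_pos)
  qed
  \<comment> \<open>For positive \<open>n t\<close> this is \<open>1 + m / n\<close> times the
    fourth root of \<open>x t\<close>. The power \<open>n^4\<close> of (iii) is used up exactly,
    since the first factor only stays bounded.\<close>
  have N\<delta>: "(\<lambda>t. N t * sqrt (\<delta> t)) \<longlonglongrightarrow> 0"
  proof -
    have "(\<lambda>t. (1 + real (m t) / real (n t)) * sqrt (sqrt (x t))) \<longlonglongrightarrow> (1 + \<alpha>0) * sqrt (sqrt 0)"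
      by (intro tendsto_intros i(2) x0)
    moreover have "\<forall>\<^sub>F t in sequentially. (1 + real (m t) / real (n t)) * sqrt (sqrt (x t)) = N t * sqrt (\<delta> t)"
    proof -
      show ?thesis using n_pos
      proof eventually_elim
        case (elim t)
        have "sqrt (\<delta> t) = sqrt (sqrt (x t)) / real (n t)"
          unfolding \<delta>_def using elim by (simp add: real_sqrt_mult real_sqrt_divide)
        then show ?case using elim by (simp add: N_def field_simps)
      qed
    qed
    ultimately show ?thesis by (simp add: tendsto_cong)
  qed

  \<comment> \<open>Five points per sample give \<open>10 \<le> n + m\<close> for the denominator of
    the variance estimator, along with the four points needed for U-centring.\<close>
  define ok where "ok t \<longleftrightarrow> good (p t) \<and> 5 \<le> n t \<and> 5 \<le> m t \<and>
      real (m t) \<le> c * real (n t) \<and> real (n t) \<le> c * real (m t)" for t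
  have ok_ev: "\<forall>\<^sub>F t in sequentially. ok t"
  proof -
    have "\<forall>\<^sub>F t in sequentially. 5 \<le> n t" "\<forall>\<^sub>F t in sequentially. 5 \<le> m t"
      using n_lim m_lim by (auto simp: filterlim_at_top)
    then show ?thesis using good_ev c_ev by eventually_elim (simp add: ok_def)
  qed
  \<comment> \<open>All properties are collected in one predicate so that \<open>W\<close>,
    \<open>Rem\<close> and \<open>S\<close> can be chosen as functions of \<open>t\<close> at once;
    where \<open>ok t\<close> fails, their values are arbitrary.\<close>
  define dec where "dec t W Rem S \<longleftrightarrow>
      integrable (M (p t)) W \<and> integrable (M (p t)) Rem \<and> S \<in> borel_measurable (M (p t)) \<and>
      integrable (M (p t)) (\<lambda>\<omega>. \<bar>S \<omega> - 1\<bar>) \<and> (\<integral>\<omega>. \<bar>W \<omega>\<bar> \<partial>M (p t)) \<le> 1 \<and>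
      (\<forall>s. cmod ((\<integral>\<omega>. iexp (s * W \<omega>) \<partial>M (p t)) - of_real (exp (- (s\<^sup>2) / 2))) \<le>
        \<bar>s\<bar> * (\<bar>s\<bar> / 2 * (9 * \<eta> t) + s\<^sup>2 / 4 * (30 * \<eta> t + 5 * (\<eta> t)\<^sup>2))) \<and>
      (\<integral>\<omega>. \<bar>Rem \<omega>\<bar> \<partial>M (p t)) \<le> 4 * c * (N t * sqrt (\<delta> t)) \<and>
      (\<integral>\<omega>. \<bar>S \<omega> - 1\<bar> \<partial>M (p t)) \<le> 2 * (4 * sqrt (\<beta> t) + 4 * \<beta> t) + 6 * sqrt (\<epsilon> t) + 8 / N t \<and>
      (\<forall>\<omega>\<in>space (M (p t)). T_stat (K (p t)) (n t) (m t) (\<lambda>k. X (p t) k \<omega>) (\<lambda>l. Y (p t) l \<omega>) =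
        (W \<omega> + Rem \<omega>) / sqrt (S \<omega>))" for t and W Rem S :: "'w \<Rightarrow> real"
  have "\<exists>W Rem S. dec t W Rem S" if ok: "ok t" for t
  proof -
    have good: "good (p t)" and nm: "5 \<le> n t" "5 \<le> m t"
      and c: "real (m t) \<le> c * real (n t)" "real (n t) \<le> c * real (m t)" using ok by (simp_all add: ok_def)
    have g: "integrable (M (p t)) (\<lambda>\<omega>. (K (p t) (X (p t) 0 \<omega>) (X (p t) 1 \<omega>))\<^sup>2)"
      "integrable (M (p t)) (\<lambda>\<omega>. (H (p t) 0 1 \<omega>) ^ 4)" "integrable (M (p t)) (\<lambda>\<omega>. (R (p t) 0 1 \<omega>) ^ 4)"
      "0 < \<tau> (p t)" "0 < EH2 (p t)" using good by (simp_all add: good_def)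
    have n0: "0 < real (n t)" using nm by simp
    have \<epsilon>_ge: "a t \<le> \<epsilon> t" "b t \<le> \<epsilon> t" "\<bar>e t\<bar> \<le> \<epsilon> t" "0 < \<epsilon> t"
      using a_pos[of t] b_pos[of t] n0 by (auto simp: \<epsilon>_def intro!: add_nonneg_pos add_nonneg_nonneg)
    have A: "(\<integral>\<omega>. (H (p t) 0 1 \<omega>) ^ 4 \<partial>M (p t)) / (EH2 (p t))\<^sup>2 \<le> \<epsilon> t * (real (n t) + real (m t))\<^sup>2"
    proof -
      have "(\<integral>\<omega>. (H (p t) 0 1 \<omega>) ^ 4 \<partial>M (p t)) / (EH2 (p t))\<^sup>2 = a t * (real (n t))\<^sup>2"
        using n0 by (simp add: a_def)
      also have "\<dots> \<le> \<epsilon> t * (real (n t) + real (m t))\<^sup>2"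
        using \<epsilon>_ge by (intro mult_mono power_mono) auto
      finally show ?thesis .
    qed
    have B: "(\<integral>\<omega>. (H (p t) 0 2 \<omega>)\<^sup>2 * (H (p t) 1 2 \<omega>)\<^sup>2 \<partial>M (p t)) / (EH2 (p t))\<^sup>2 \<le> \<epsilon> t * (real (n t) + real (m t))"
    proof -
      have "(\<integral>\<omega>. (H (p t) 0 2 \<omega>)\<^sup>2 * (H (p t) 1 2 \<omega>)\<^sup>2 \<partial>M (p t)) / (EH2 (p t))\<^sup>2 = b t * real (n t)"
        using n0 by (simp add: b_def)
      also have "\<dots> \<le> \<epsilon> t * (real (n t) + real (m t))"
        using \<epsilon>_ge by (intro mult_mono) auto
      finally show ?thesis .
    qed
    have D: "sqrt (\<tau> (p t) ^ 4 * (\<integral>\<omega>. (R (p t) 0 1 \<omega>) ^ 4 \<partial>M (p t)) / (EH2 (p t))\<^sup>2) \<le> \<delta> t"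
    proof -
      let ?z = "\<tau> (p t) ^ 4 * (\<integral>\<omega>. (R (p t) 0 1 \<omega>) ^ 4 \<partial>M (p t)) / (EH2 (p t))\<^sup>2"
      have "x t = (real (n t))\<^sup>2 * (real (n t))\<^sup>2 * ?z" by (simp add: x_def flip: power_add)
      then have "sqrt (x t) = (real (n t))\<^sup>2 * sqrt ?z" by (simp only: real_sqrt_mult real_sqrt_mult_self) simp
      then show ?thesis using n0 by (simp add: \<delta>_def power2_eq_square)
    qed
    show ?thesis
    proof (rule model_decomposition[where M = "M (p t)" and d = "d (p t)" and p = "p t" and X = "X (p t)" and Y = "Y (p t)"
          and \<mu> = "distr (M (p t)) (blocks (d (p t)) (p t)) (X (p t) 0)" and \<rho> = "\<rho> (p t)" and \<tau> = "\<tau> (p t)"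
          and ?\<sigma>2.0 = "EH2 (p t)" and n = "n t" and m = "m t" and \<epsilon> = "\<epsilon> t" and \<delta> = "\<delta> t" and c = c,
          folded K_def H_def])
      show "distr (M (p t)) (blocks (d (p t)) (p t)) (Y (p t) k) = distr (M (p t)) (blocks (d (p t)) (p t)) (X (p t) 0)" for k
        using Y_ident[of "p t" k] H0[of "p t"] by simp
      show "semimetric_kernel (d (p t) i) (\<rho> (p t) i)" if "i \<in> {1..p t}" for i using that by (rule sk)
      show "integrable (M (p t)) (\<lambda>\<omega>. (R_fun (\<tau> (p t)) (K (p t)) (X (p t) 0 \<omega>) (X (p t) 1 \<omega>)) ^ 4)"
        using g(3) by (simp only: R_def)
      show "(\<integral>\<omega>. (H (p t) 0 1 \<omega>)\<^sup>2 \<partial>M (p t)) = EH2 (p t)" by (simp only: EH2_def)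
      show "sqrt (\<tau> (p t) ^ 4 * (\<integral>\<omega>. (R_fun (\<tau> (p t)) (K (p t)) (X (p t) 0 \<omega>) (X (p t) 1 \<omega>)) ^ 4 \<partial>M (p t))
          / (EH2 (p t))\<^sup>2) \<le> \<delta> t"
        using D by (simp only: R_def)
      show "\<bar>(\<integral>\<omega>. H (p t) 0 2 \<omega> * H (p t) 1 2 \<omega> * H (p t) 0 3 \<omega> * H (p t) 1 3 \<omega> \<partial>M (p t)) / (EH2 (p t))\<^sup>2\<bar> \<le> \<epsilon> t"
        using \<epsilon>_ge(3) by (simp only: e_def)
      fix W Rem S
      assume "integrable (M (p t)) W" "integrable (M (p t)) Rem" "S \<in> borel_measurable (M (p t))"
        "integrable (M (p t)) (\<lambda>\<omega>. \<bar>S \<omega> - 1\<bar>)" "(\<integral>\<omega>. \<bar>W \<omega>\<bar> \<partial>M (p t)) \<le> 1"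
        "\<And>s. cmod ((\<integral>\<omega>. iexp (s * W \<omega>) \<partial>M (p t)) - of_real (exp (- (s\<^sup>2) / 2))) \<le>
          \<bar>s\<bar> * (\<bar>s\<bar> / 2 * (9 * ((4 * c)\<^sup>2 * sqrt (\<epsilon> t))) +
            s\<^sup>2 / 4 * (30 * ((4 * c)\<^sup>2 * sqrt (\<epsilon> t)) + 5 * ((4 * c)\<^sup>2 * sqrt (\<epsilon> t))\<^sup>2))"
        "(\<integral>\<omega>. \<bar>Rem \<omega>\<bar> \<partial>M (p t)) \<le> 4 * c * ((real (n t) + real (m t)) * sqrt (\<delta> t))"
        "(\<integral>\<omega>. \<bar>S \<omega> - 1\<bar> \<partial>M (p t)) \<le>
          2 * (4 * sqrt (48 * (1 / real (n t) + 1 / real (m t)) + 100 * \<delta> t) +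
            4 * (48 * (1 / real (n t) + 1 / real (m t)) + 100 * \<delta> t)) + 6 * sqrt (\<epsilon> t) + 8 / (real (n t) + real (m t))"
        "\<And>\<omega>. \<omega> \<in> space (M (p t)) \<Longrightarrow>
          T_stat (K (p t)) (n t) (m t) (\<lambda>k. X (p t) k \<omega>) (\<lambda>l. Y (p t) l \<omega>) = (W \<omega> + Rem \<omega>) / sqrt (S \<omega>)"
      then have "dec t W Rem S" unfolding dec_def N_def \<beta>_def \<eta>_def by blast
      then show ?thesis by blast
    qed (fact prob indep X_ident g nm \<epsilon>_ge A B c)+
  qed
  then obtain W Rem S where dec: "\<And>t. ok t \<Longrightarrow> dec t (W t) (Rem t) (S t)" by metis

  show ?thesis
  proof (rule weak_conv_studentized[where W = W and R = Rem and S = S and C = 1])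
    show "prob_space (M (p t))" for t by (rule prob)
    show "(\<lambda>\<omega>. T_stat (K (p t)) (n t) (m t) (\<lambda>k. X (p t) k \<omega>) (\<lambda>l. Y (p t) l \<omega>)) \<in> borel_measurable (M (p t))" for t
      by (rule T_m)
    show "\<forall>\<^sub>F t in sequentially. S t \<in> borel_measurable (M (p t)) \<and> integrable (M (p t)) (W t) \<and>
       integrable (M (p t)) (Rem t) \<and> integrable (M (p t)) (\<lambda>\<omega>. \<bar>S t \<omega> - 1\<bar>) \<and> (\<integral>\<omega>. \<bar>W t \<omega>\<bar> \<partial>M (p t)) \<le> 1 \<and>
       (\<forall>\<omega>\<in>space (M (p t)). T_stat (K (p t)) (n t) (m t) (\<lambda>k. X (p t) k \<omega>) (\<lambda>l. Y (p t) l \<omega>) =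
         (W t \<omega> + Rem t \<omega>) / sqrt (S t \<omega>))"
      using ok_ev by eventually_elim (use dec in \<open>simp add: dec_def\<close>)
    show "(\<lambda>t. \<integral>\<omega>. \<bar>Rem t \<omega>\<bar> \<partial>M (p t)) \<longlonglongrightarrow> 0"
    proof (rule tendsto_sandwich[OF _ _ tendsto_const])
      show "\<forall>\<^sub>F t in sequentially. 0 \<le> (\<integral>\<omega>. \<bar>Rem t \<omega>\<bar> \<partial>M (p t))" by simp
      show "\<forall>\<^sub>F t in sequentially. (\<integral>\<omega>. \<bar>Rem t \<omega>\<bar> \<partial>M (p t)) \<le> 4 * c * (N t * sqrt (\<delta> t))"
        using ok_ev by eventually_elim (use dec in \<open>simp add: dec_def\<close>)
      show "(\<lambda>t. 4 * c * (N t * sqrt (\<delta> t))) \<longlonglongrightarrow> 0"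
        using tendsto_mult[OF tendsto_const[of "4 * c"] N\<delta>] by simp
    qed
    show "(\<lambda>t. \<integral>\<omega>. \<bar>S t \<omega> - 1\<bar> \<partial>M (p t)) \<longlonglongrightarrow> 0"
    proof (rule tendsto_sandwich[OF _ _ tendsto_const])
      show "\<forall>\<^sub>F t in sequentially. 0 \<le> (\<integral>\<omega>. \<bar>S t \<omega> - 1\<bar> \<partial>M (p t))" by simp
      show "\<forall>\<^sub>F t in sequentially. (\<integral>\<omega>. \<bar>S t \<omega> - 1\<bar> \<partial>M (p t)) \<le>
          2 * (4 * sqrt (\<beta> t) + 4 * \<beta> t) + 6 * sqrt (\<epsilon> t) + 8 * (1 / N t)"
        using ok_ev by eventually_elim (use dec in \<open>simp add: dec_def\<close>)
      have "(\<lambda>t. 2 * (4 * sqrt (\<beta> t) + 4 * \<beta> t) + 6 * sqrt (\<epsilon> t) + 8 * (1 / N t)) \<longlonglongrightarrow>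
          2 * (4 * sqrt 0 + 4 * 0) + 6 * sqrt 0 + 8 * 0"
        by (intro tendsto_intros \<beta>0 \<epsilon>0 N0)
      then show "(\<lambda>t. 2 * (4 * sqrt (\<beta> t) + 4 * \<beta> t) + 6 * sqrt (\<epsilon> t) + 8 * (1 / N t)) \<longlonglongrightarrow> 0" by simp
    qed
    fix s :: real
    have "(\<lambda>t. (\<integral>\<omega>. iexp (s * W t \<omega>) \<partial>M (p t)) - of_real (exp (- (s\<^sup>2) / 2))) \<longlonglongrightarrow> 0"
    proof (rule Lim_null_comparison)
      show "\<forall>\<^sub>F t in sequentially. norm ((\<integral>\<omega>. iexp (s * W t \<omega>) \<partial>M (p t)) - of_real (exp (- (s\<^sup>2) / 2))) \<le>
          \<bar>s\<bar> * (\<bar>s\<bar> / 2 * (9 * \<eta> t) + s\<^sup>2 / 4 * (30 * \<eta> t + 5 * (\<eta> t)\<^sup>2))"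
        using ok_ev by eventually_elim (use dec in \<open>simp only: dec_def\<close>)
      have "(\<lambda>t. \<bar>s\<bar> * (\<bar>s\<bar> / 2 * (9 * \<eta> t) + s\<^sup>2 / 4 * (30 * \<eta> t + 5 * (\<eta> t)\<^sup>2))) \<longlonglongrightarrow>
          \<bar>s\<bar> * (\<bar>s\<bar> / 2 * (9 * 0) + s\<^sup>2 / 4 * (30 * 0 + 5 * 0\<^sup>2))"
        by (intro tendsto_intros \<eta>0) simp_all
      then show "(\<lambda>t. \<bar>s\<bar> * (\<bar>s\<bar> / 2 * (9 * \<eta> t) + s\<^sup>2 / 4 * (30 * \<eta> t + 5 * (\<eta> t)\<^sup>2))) \<longlonglongrightarrow> 0" by simp
    qed
    then show "(\<lambda>t. \<integral>\<omega>. iexp (s * W t \<omega>) \<partial>M (p t)) \<longlonglongrightarrow> of_real (exp (- (s\<^sup>2) / 2))"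
      by (rule LIM_zero_cancel)
  qed
qed

end
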